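(* Let $\mathbb{F}$ be a field and let $n\geq 2$. Let $A(s)\in \mathbb{F}[s]^{n \times n}$ be a regular matrix pencil and $\alpha_1(s)\mid \dots\mid \alpha_n(s)$ be its invariant factors. Let $q(s)\in \mathbb{F}[s]$ be a nonzero monic polynomial with $\deg (q(s))\leq n$. Assume that $\mathbb{F}\cup \{\infty\}\not\subseteq \Lambda(A(s))\cup \Lambda^n(q(s))$. Let $r$ be a nonnegative integer, $r\leq n$. There exists a matrix pencil $P(s)\in \mathbb{F}[s]^{n \times n}$ such that $\operatorname{rank}(P(s))= r$ and $\det(A(s)+P(s))=kq(s)$ with $0\neq k \in \mathbb{F}$ if and only if $$\alpha_1(s)\cdots\alpha_{n-r}(s)\mid q(s)\quad\text{and}\quad \sum_{i=1}^{n-r}m_i(\infty, A(s)) \leq n-\deg(q(s)).$$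
   Context: A matrix pencil is a polynomial matrix $G(s)=G_0+sG_1\in\mathbb{F}[s]^{m\times n}$ of degree at most $1$ ($G_0,G_1\in\mathbb{F}^{m\times n}$). It is regular if $m=n$ and $\det G(s)$ is a nonzero polynomial. $\operatorname{rank}(G(s))$ denotes the normal rank, i.e. the rank of $G(s)$ over the field of fractions of $\mathbb{F}[s]$. For a pencil $G(s)=G_0+sG_1$ of normal rank $\rho$, its invariant factors $\gamma_1(s)\mid\dots\mid\gamma_\rho(s)$ are the monic polynomials $\gamma_k(s)=D_k(s)/D_{k-1}(s)$, where $D_k(s)$ is the monic greatest common divisor of the $k\times k$ minors of $G(s)$ and $D_0:=1$. Put $G(s,t)=tG_0+sG_1\in\mathbb{F}[s,t]^{m\times n}$. For $1\le k\le\rho$, let $\Delta_k(s,t)$ be the greatest common divisor of the $k\times k$ minors of $G(s,t)$, a homogeneous polynomial normalized to be monic with respect to $s$ (the monomial of highest degree in $s$ has coefficient $1$), and $\Delta_0:=1$. The homogeneous invariant factors of $G(s)$ are $\Gamma_k(s,t)=\Delta_k(s,t)/\Delta_{k-1}(s,t)$. They satisfy $\Gamma_i(s,t)=t^{m_i(\infty,G(s))}\,t^{\deg(\gamma_i)}\gamma_i(s/t)$ for integers $0\le m_1(\infty,G(s))\le\dots\le m_\rho(\infty,G(s))$, which defines the partial multiplicities $m_i(\infty,G(s))$ at $\infty$. With $\overline{\mathbb{F}}$ the algebraic closure of $\mathbb{F}$, the spectrum of a pencil is $\Lambda(G(s))=\{\lambda\in\overline{\mathbb{F}}\cup\{\infty\}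 : \operatorname{rank}(G(\lambda))<\operatorname{rank}(G(s))\}$, where $G(\infty):=G_1$. For $q(s)\in\mathbb{F}[s]$ with $\deg(q(s))\le n$, $\Lambda^n(q(s)):=\{\lambda\in\overline{\mathbb{F}} : q(\lambda)=0\}$ if $\deg(q(s))=n$, and $\Lambda^n(q(s)):=\{\lambda\in\overline{\mathbb{F}} : q(\lambda)=0\}\cup\{\infty\}$ if $\deg(q(s))<n$. An empty product equals $1$ and an empty sum equals $0$. *)

theory Defs
  imports
    "Jordan_Normal_Form.DL_Rank"
    "Jordan_Normal_Form.DL_Submatrix"
    "HOL-Algebra.Algebraic_Closure_Type"
    "HOL-Computational_Algebra.Polynomial_Factorial"
begin

hide_const (open) Polynomials.degree Polynomials.lead_coeff up_ring.coeff up_ring.monom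

section \<open>Matrix pencils\<close>

definition matrix_pencil :: "nat \<Rightarrow> nat \<Rightarrow> 'a::field poly mat \<Rightarrow> bool" where
  "matrix_pencil m n G \<longleftrightarrow> G \<in> carrier_mat m n \<and> (\<forall>i<m. \<forall>j<n. degree (G $$ (i, j)) \<le> 1)"

definition regular_pencil :: "nat \<Rightarrow> 'a::field poly mat \<Rightarrow> bool" where
  "regular_pencil n G \<longleftrightarrow> matrix_pencil n n G \<and> det G \<noteq> 0"

definition mat_rank :: "'a::field mat \<Rightarrow> nat" where
  "mat_rank M = vec_space.rank (dim_row M) M"

definition normal_rank :: "'a::field poly mat \<Rightarrow> nat" where
  "normal_rank G = mat_rank (map_mat to_fract G)"


section \<open>Invariant factors\<close>

definition minors :: "nat \<Rightarrow> 'a::comm_ring_1 mat \<Rightarrow> 'a set" where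
  "minors k M = {det (submatrix M I J) | I J.
     I \<subseteq> {..<dim_row M} \<and> J \<subseteq> {..<dim_col M} \<and> card I = k \<and> card J = k}"

text \<open>
  The library constant \<open>Gcd\<close> requires a coefficient field of class \<open>field_gcd\<close>; the order-theoretic
  definition below makes sense over every field.
\<close>

definition is_gcd_of :: "'a::comm_semiring_1 set \<Rightarrow> 'a \<Rightarrow> bool" where
  "is_gcd_of S d \<longleftrightarrow> (\<forall>x\<in>S. d dvd x) \<and> (\<forall>e. (\<forall>x\<in>S. e dvd x) \<longrightarrow> e dvd d)"

definition det_divisor :: "'a::field poly mat \<Rightarrow> nat \<Rightarrow> 'a poly" where
  "det_divisor G k = (THE d. is_gcd_of (minors k G) d \<and> lead_coeff d = 1)"

text \<open>
  The definite descriptions in this theory are meaningful for \<open>k\<close> at most the normal rank. For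
  \<open>k = 0\<close> the only minor is the empty determinant, so \<open>det_divisor G 0 = 1\<close>.
\<close>

definition invariant_factor :: "'a::field poly mat \<Rightarrow> nat \<Rightarrow> 'a poly" where
  "invariant_factor G k = det_divisor G k div det_divisor G (k - 1)"


section \<open>Homogeneous invariant factors and partial multiplicities at infinity\<close>

text \<open>
  The ring \<open>F[s,t]\<close> is represented as \<open>'a poly poly\<close>, that is \<open>F[t][s]\<close>: \<open>s\<close> is the outer and \<open>t\<close>
  the inner variable. An entry \<open>a + s b\<close> of a pencil becomes \<open>t a + s b\<close>.
\<close>

definition hom_pencil :: "'a::field poly mat \<Rightarrow> 'a poly poly mat" where
  "hom_pencil G = map_mat (\<lambda>p. [:[:0, coeff p 0:], [:coeff p 1:]:]) G"

text \<open>
  The leading coefficient with respect to \<open>s\<close> of a homogeneous polynomial is a monomial in \<open>t\<close>,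
  so the monomial of highest degree in \<open>s\<close> has coefficient \<open>lead_coeff (lead_coeff d)\<close>.
\<close>

definition hom_det_divisor :: "'a::field poly mat \<Rightarrow> nat \<Rightarrow> 'a poly poly" where
  "hom_det_divisor G k =
     (THE d. is_gcd_of (minors k (hom_pencil G)) d \<and> lead_coeff (lead_coeff d) = 1)"

definition hom_invariant_factor :: "'a::field poly mat \<Rightarrow> nat \<Rightarrow> 'a poly poly" where
  "hom_invariant_factor G k = hom_det_divisor G k div hom_det_divisor G (k - 1)"

text \<open>The homogenization \<open>t^(deg p) p(s/t)\<close>.\<close>

definition homogenize :: "'a::field poly \<Rightarrow> 'a poly poly" where
  "homogenize p = (\<Sum>i\<le>degree p. monom (monom (coeff p i) (degree p - i)) i)"

definition mult_infinity :: "'a::field poly mat \<Rightarrow> nat \<Rightarrow> nat" where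
  "mult_infinity G i =
     (THE e. hom_invariant_factor G i = [:monom 1 e:] * homogenize (invariant_factor G i))"


section \<open>Spectra\<close>

datatype 'a ext_point = Fin 'a | Infty

fun pencil_at :: "'a::field poly mat \<Rightarrow> 'a alg_closure ext_point \<Rightarrow> 'a alg_closure mat" where
  "pencil_at G (Fin z) = map_mat (\<lambda>p. poly (map_poly to_ac p) z) G"
| "pencil_at G Infty = map_mat (\<lambda>p. to_ac (coeff p 1)) G"

definition pencil_spectrum :: "'a::field poly mat \<Rightarrow> 'a alg_closure ext_point set" where
  "pencil_spectrum G = {z. mat_rank (pencil_at G z) < normal_rank G}"

definition poly_spectrum :: "nat \<Rightarrow> 'a::field poly \<Rightarrow> 'a alg_closure ext_point set" where
  "poly_spectrum n q = Fin ` {z. poly (map_poly to_ac q) z = 0} \<union>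
     (if degree q < n then {Infty} else {})"

definition base_points :: "'a::field alg_closure ext_point set" where
  "base_points = insert Infty (Fin ` range to_ac)"

end

theory Submission
  imports
    Defs
    "Jordan_Normal_Form.DL_Rank_Submatrix"
    "Jordan_Normal_Form.Char_Poly"
    "Jordan_Normal_Form.Column_Operations"
begin

text \<open>
  Put \<open>k = n - r\<close>, let \<open>D\<^sub>k\<close> be the monic gcd of the \<open>k \<times> k\<close> minors of \<open>A(s)\<close> and \<open>b\<close> the
  largest degree of such a minor. Since \<open>\<Delta>\<^sub>k = t\<^sup>e D\<^sub>k\<^sup>h\<close> with \<open>e = k - b\<close>, where \<open>D\<^sub>k\<^sup>h\<close> is the
  homogenization of \<open>D\<^sub>k\<close>, the right-hand side says that \<open>D\<^sub>k\<close> divides \<open>q\<close> and that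
  \<open>deg q \<le> b + r\<close>.

  Both conditions are necessary because \<open>det (A + P)\<close> is a sum of determinants with some rows
  from \<open>A\<close> and the others from \<open>P\<close>. The terms with more than \<open>r\<close> rows from \<open>P\<close> vanish, and in
  each of the other terms one can expand down to minors of \<open>A\<close> of order \<open>k\<close>.

  For the converse, a shift and a reversal of the variable move a point outside the spectra to
  infinity. Then the leading coefficient matrix is invertible and \<open>A\<close> may be replaced by
  \<open>s - M\<close>. By the Smith form there are \<open>r\<close> constant vectors such that the characteristic
  polynomial of \<open>M\<close> on the quotient by the invariant subspace \<open>K\<close> they generate divides \<open>D\<^sub>k\<close>.
  The space \<open>K\<close> has a basis of at most \<open>r\<close> chains \<open>v, M v, M\<^sup>2 v, \<dots>\<close>. Changing \<open>M\<close> on the ends of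
  the chains only, which is a perturbation of rank at most \<open>r\<close>, gives any characteristic
  polynomial on \<open>K\<close>. Finally, the rank of the perturbation \<open>B - A\<close> can be raised by one at a
  time up to \<open>r\<close>, by replacing \<open>B\<close> with \<open>B (1 + u v\<^sup>T)\<close> where \<open>v\<^sup>T u = 0\<close>.
\<close>

text \<open>Why the quotient by \<open>K\<close> behaves so: if \<open>s - M = U Dg V\<close> is the
  Smith form, then column \<open>j\<close> of \<open>U\<close>, reduced modulo \<open>s - M\<close>
  to a constant vector, generates a cyclic summand of order \<open>Dg $$ (j,j)\<close> in the module
  \<open>F^n\<close> on which \<open>s\<close> acts as \<open>M\<close>. Killing the
  \<open>r\<close> summands of largest order leaves the product of the first \<open>k\<close>
  diagonal entries, and this product divides every \<open>k \<times> k\<close> minor. In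
  \<open>flag_block_dvd\<close> a factorization of matrices replaces the module language.

  The gcd enters the construction only through its universal property: whatever divides all minors
  divides \<open>q\<close>. This form is carried through substitutions, and through reversal under a
  degree bound, without computing a new gcd.

  Moving \<open>z\<close> to infinity and back turns a constant perturbation into
  \<open>s - z\<close> times a constant matrix.

  The rank obtained can be smaller than \<open>r\<close>; the perturbation can even be zero if
  \<open>M\<close> already has the desired characteristic polynomial. Hence the separate raising of
  the rank, and \<open>n \<ge> 2\<close>: for \<open>n = 1\<close> there are no nonzero
  \<open>u\<close>, \<open>v\<close> with \<open>v\<^sup>T u = 0\<close>.\<close>

no_notation fps_nth (infixl \<open>$\<close> 75)

section \<open>Minors\<close>

text \<open>Sorting the selected rows is a row permutation, so only a sign is lost;
  \<open>pick\<close> lists a set in increasing order.\<close>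

lemma det_select_rows:
  fixes h :: "nat \<Rightarrow> nat \<Rightarrow> 'a::comm_ring_1"
  assumes inj: "inj_on f {0..<k}"
  shows "\<exists>e. (e = 1 \<or> e = -1) \<and> det (mat k k (\<lambda>(i,j). h (f i) (g j))) =
     e * det (mat k k (\<lambda>(i,j). h (pick (f ` {0..<k}) i) (g j)))"
proof -
  let ?I = "f ` {0..<k}"
  \<comment> \<open>\<open>p i\<close> is the position of \<open>f i\<close> in the sorted image;
    the value \<open>i\<close> from \<open>k\<close> on makes \<open>p\<close> a permutation in the
    sense of \<open>permutes\<close>.\<close>
  define p where "p i = (if i < k then card {a\<in>?I. a < f i} else i)" for i
  have fin: "finite ?I" and cardI: "card ?I = k" using inj by (auto simp: card_image)
  have pick_p: "pick ?I (p i) = f i" if "i < k" for i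
    using that by (simp add: p_def pick_card_in_set)
  have p_less: "p i < k" if "i < k" for i
  proof -
    have "{a\<in>?I. a < f i} \<subset> ?I" using that by auto
    then show ?thesis using psubset_card_mono[OF fin] cardI that by (simp add: p_def)
  qed
  have "inj_on p {0..<k}"
    by (rule inj_onI) (metis inj inj_onD pick_p atLeastLessThan_iff)
  moreover have "p ` {0..<k} \<subseteq> {0..<k}" using p_less by auto
  ultimately have "bij_betw p {0..<k} {0..<k}"
    by (simp add: bij_betw_def endo_inj_surj)
  then have "p permutes {0..<k}"
    by (rule bij_imp_permutes) (simp add: p_def)
  then have "det (mat k k (\<lambda>(i,j). (mat k k (\<lambda>(i,j). h (pick ?I i) (g j))) $$ (p i, j))) =
      signof p * det (mat k k (\<lambda>(i,j). h (pick ?I i) (g j)))"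
    by (intro det_permute_rows) auto
  moreover have "mat k k (\<lambda>(i,j). (mat k k (\<lambda>(i,j). h (pick ?I i) (g j))) $$ (p i, j)) =
      mat k k (\<lambda>(i,j). h (f i) (g j))"
    by (rule eq_matI) (auto simp: p_less pick_p)
  moreover have "signof p = (1::'a) \<or> signof p = (-1::'a)" by (simp add: sign_def)
  ultimately show ?thesis by metis
qed

lemma det_repeated_rows:
  fixes h :: "nat \<Rightarrow> nat \<Rightarrow> 'a::comm_ring_1"
  assumes "\<not> inj_on f {0..<k}"
  shows "det (mat k k (\<lambda>(i,j). h (f i) (g j))) = 0"
proof -
  obtain i j where "i < k" "j < k" "i \<noteq> j" "f i = f j" using assms by (auto simp: inj_on_def)
  then show ?thesis by (intro det_identical_rows[of _ k i j]) (auto intro!: eq_vecI)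
qed

lemma det_mat_flip:
  fixes h :: "nat \<Rightarrow> nat \<Rightarrow> 'a::comm_ring_1"
  shows "det (mat k k (\<lambda>(i,j). h (f i) (g j))) = det (mat k k (\<lambda>(i,j). h (f j) (g i)))"
proof -
  have "det (mat k k (\<lambda>(i,j). h (f i) (g j)))\<^sup>T = det (mat k k (\<lambda>(i,j). h (f i) (g j)))"
    by (rule det_transpose) auto
  moreover have "(mat k k (\<lambda>(i,j). h (f i) (g j)))\<^sup>T = mat k k (\<lambda>(i,j). h (f j) (g i))"
    by (rule eq_matI) auto
  ultimately show ?thesis by simp
qed

lemma submatrix_eq_mat:
  assumes "I \<subseteq> {..<dim_row M}" "J \<subseteq> {..<dim_col M}" "card I = k" "card J = k"
  shows "submatrix M I J = mat k k (\<lambda>(i,j). M $$ (pick I i, pick J j))"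
proof -
  have "{i. i < dim_row M \<and> i \<in> I} = I" "{j. j < dim_col M \<and> j \<in> J} = J" using assms by auto
  then show ?thesis using assms by (simp add: submatrix_def)
qed

text \<open>Unsorted indices cost a sign and repeated ones give 0, so a property of minors passes to
  arbitrary selections of rows and columns once it holds for 0 and is stable under negation. The
  typical \<open>Q\<close> is divisibility by a fixed element or a degree bound.\<close>

lemma det_select_minor:
  fixes M :: "'a::comm_ring_1 mat"
  assumes f: "\<And>i. i < k \<Longrightarrow> f i < dim_row M" and g: "\<And>j. j < k \<Longrightarrow> g j < dim_col M"
    and base: "\<And>x. x \<in> minors k M \<Longrightarrow> Q x" and zero: "Q 0" and neg: "\<And>x. Q x \<Longrightarrow> Q (- x)"
  shows "Q (det (mat k k (\<lambda>(i,j). M $$ (f i, g j))))"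
proof (cases "inj_on f {0..<k} \<and> inj_on g {0..<k}")
  case False
  then have "det (mat k k (\<lambda>(i,j). M $$ (f i, g j))) = 0"
    using det_repeated_rows[of f k "\<lambda>i j. M $$ (i,j)" g] det_repeated_rows[of g k "\<lambda>j i. M $$ (i,j)" f]
      det_mat_flip[of k "\<lambda>i j. M $$ (i,j)" f g] by auto
  then show ?thesis using zero by simp
next
  case True
  let ?I = "f ` {0..<k}" and ?J = "g ` {0..<k}"
  obtain e where e: "e = 1 \<or> e = -1" and 1: "det (mat k k (\<lambda>(i,j). M $$ (f i, g j))) =
      e * det (mat k k (\<lambda>(i,j). M $$ (pick ?I i, g j)))"
    using det_select_rows[of f k "\<lambda>i j. M $$ (i,j)" g] True by blast
  obtain e' where e': "e' = 1 \<or> e' = -1" and 2: "det (mat k k (\<lambda>(i,j). M $$ (pick ?I j, g i))) =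
      e' * det (mat k k (\<lambda>(i,j). M $$ (pick ?I j, pick ?J i)))"
    using det_select_rows[of g k "\<lambda>j i. M $$ (i,j)" "pick ?I"] True by blast
  have "submatrix M ?I ?J = mat k k (\<lambda>(i,j). M $$ (pick ?I i, pick ?J j))"
    using True f g by (intro submatrix_eq_mat) (auto simp: card_image)
  moreover have "det (submatrix M ?I ?J) \<in> minors k M"
    unfolding minors_def using True f g
    by (intro CollectI exI[of _ ?I] exI[of _ ?J]) (auto simp: card_image)
  ultimately have "Q (det (mat k k (\<lambda>(i,j). M $$ (pick ?I i, pick ?J j))))" using base by simp
  moreover have "det (mat k k (\<lambda>(i,j). M $$ (f i, g j))) =
      (e * e') * det (mat k k (\<lambda>(i,j). M $$ (pick ?I i, pick ?J j)))"
    using 1 2 det_mat_flip[of k "\<lambda>i j. M $$ (i,j)" "pick ?I" g]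
      det_mat_flip[of k "\<lambda>i j. M $$ (i,j)" "pick ?I" "pick ?J"] by simp
  ultimately show ?thesis using e e' neg by auto
qed

text \<open>Laplace expansion down to order \<open>k\<close>. The rows in \<open>I\<close> come from
  \<open>M\<close>, possibly repeated and in another order; the remaining rows only have entries in
  \<open>E\<close>. The first argument of \<open>Q\<close> is the current order, so that a degree
  bound may grow by one with each expansion.\<close>

lemma det_induct_minors:
  fixes M Z :: "'a::comm_ring_1 mat"
  assumes Z: "Z \<in> carrier_mat N N" and I: "I \<subseteq> {..<N}" "k \<le> card I"
    and Zf: "\<And>i j. i \<in> I \<Longrightarrow> j < N \<Longrightarrow> Z $$ (i,j) = M $$ (f i, g j)"
    and f: "\<And>i. i \<in> I \<Longrightarrow> f i < dim_row M" and g: "\<And>j. j < N \<Longrightarrow> g j < dim_col M"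
    and base: "\<And>x. x \<in> minors k M \<Longrightarrow> Q k x"
    and zero: "\<And>m. Q m 0" and neg: "\<And>m x. Q m x \<Longrightarrow> Q m (- x)"
    and add: "\<And>m x y. Q m x \<Longrightarrow> Q m y \<Longrightarrow> Q m (x + y)"
    and mult: "\<And>m a x. E a \<Longrightarrow> Q m x \<Longrightarrow> Q (Suc m) (a * x)"
    and E: "\<And>i j. i < N \<Longrightarrow> j < N \<Longrightarrow> E (Z $$ (i,j))"
  shows "Q N (det Z)"
  using Z I Zf f g E
proof (induction N arbitrary: Z I f g)
  case 0
  then have "mat 0 0 (\<lambda>(i,j). M $$ (f i, g j)) = Z" by (intro eq_matI) auto
  with 0 show ?case using det_select_minor[of 0 f M g "Q 0", OF _ _ _ zero neg] base by auto
next
  case (Suc N)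
  show ?case
  proof (cases "k = Suc N")
    case True
    have "card {..<Suc N} \<le> card I" using Suc.prems(3) True by simp
    then have "I = {..<Suc N}" using Suc.prems(2) by (intro card_seteq) auto
    then have "mat k k (\<lambda>(i,j). M $$ (f i, g j)) = Z" using True Suc.prems by (intro eq_matI) auto
    moreover have "Q k (det (mat k k (\<lambda>(i,j). M $$ (f i, g j))))"
      using Suc.prems(5,6) True \<open>I = _\<close> by (intro det_select_minor[where Q = "Q k", OF _ _ base zero neg]) auto
    ultimately show ?thesis using True by simp
  next
    case False
    have finI: "finite I" using Suc.prems(2) finite_subset by blast
    have "card I \<le> Suc N" using card_mono[OF _ Suc.prems(2)] by simp
    \<comment> \<open>If \<open>I\<close> has more than \<open>k\<close> elements, one of its rows
      can be spared; otherwise the expansion goes along a row outside \<open>I\<close>. So at order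
      \<open>k\<close> all rows come from \<open>M\<close>.\<close>
    obtain r where r: "r < Suc N" "k \<le> card (I - {r})"
    proof (cases "k < card I")
      case True
      then obtain r where "r \<in> I" by fastforce
      then show ?thesis using True that[of r] Suc.prems(2) by auto
    next
      case False
      then have "card I < Suc N" using \<open>k \<noteq> Suc N\<close> Suc.prems(3) \<open>card I \<le> Suc N\<close> by linarith
      then have "I \<noteq> {..<Suc N}" by auto
      then obtain r where "r < Suc N" "r \<notin> I" using Suc.prems(2) by auto
      then show ?thesis using that[of r] Suc.prems(3) by simp
    qed
    define I' where "I' = {i. i < N \<and> insert_index r i \<in> I}"
    have "insert_index r ` I' = I - {r}"
    proof
      show "I - {r} \<subseteq> insert_index r ` I'"
      proof
        fix i assume i: "i \<in> I - {r}"
        then have "insert_index r (delete_index r i) = i" by (intro insert_delete_index) auto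
        moreover have "delete_index r i < N" using i r Suc.prems(2) by (auto simp: delete_index_def)
        ultimately show "i \<in> insert_index r ` I'" using i by (force simp: I'_def)
      qed
    qed (auto simp: I'_def insert_index_def)
    then have cI': "card I' = card (I - {r})"
      using card_image[OF insert_index_inj_on] by metis
    have "Q N (det (mat_delete Z r c))" if c: "c < Suc N" for c
    proof (rule Suc.IH[where I = I' and f = "f \<circ> insert_index r" and g = "g \<circ> insert_index c"])
      show "mat_delete Z r c \<in> carrier_mat N N" using Suc.prems(1) by (simp add: mat_delete_def)
      show "I' \<subseteq> {..<N}" by (auto simp: I'_def)
      show "k \<le> card I'" using cI' r by simp
      have md: "mat_delete Z r c $$ (i,j) = Z $$ (insert_index r i, insert_index c j)" if "i < N" "j < N" for i j
        using mat_delete_index[OF Suc.prems(1) r(1) c that] by simp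
      have ins: "insert_index c j < Suc N" if "j < N" for j c using that by (simp add: insert_index_def)
      show "mat_delete Z r c $$ (i,j) = M $$ ((f \<circ> insert_index r) i, (g \<circ> insert_index c) j)"
        if "i \<in> I'" "j < N" for i j
        using that md Suc.prems(4) ins by (auto simp: I'_def)
      show "(f \<circ> insert_index r) i < dim_row M" if "i \<in> I'" for i
        using that Suc.prems(5) by (auto simp: I'_def)
      show "(g \<circ> insert_index c) j < dim_col M" if "j < N" for j
        using that Suc.prems(6) ins by auto
      show "E (mat_delete Z r c $$ (i,j))" if "i < N" "j < N" for i j
        using that Suc.prems(7) ins md by auto
    qed
    then have summand: "Q (Suc N) (Z $$ (r,c) * cofactor Z r c)" if "c < Suc N" for c
      using that r Suc.prems(7) neg by (intro mult) (auto simp: cofactor_def minus_one_power_iff)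
    have "Q (Suc N) (\<Sum>c\<in>C. Z $$ (r,c) * cofactor Z r c)" if "finite C" "C \<subseteq> {..<Suc N}" for C
      using that by (induction C rule: finite_induct) (auto intro: zero add summand)
    then show ?thesis using laplace_expansion_row[OF Suc.prems(1) r(1)] by (metis finite_lessThan order_refl)
  qed
qed

lemma det_dvd_of_minors:
  fixes M Z :: "'a::comm_ring_1 mat"
  assumes "Z \<in> carrier_mat N N" and "I \<subseteq> {..<N}" "k \<le> card I"
    and "\<And>i j. i \<in> I \<Longrightarrow> j < N \<Longrightarrow> Z $$ (i,j) = M $$ (f i, g j)"
    and "\<And>i. i \<in> I \<Longrightarrow> f i < dim_row M" and "\<And>j. j < N \<Longrightarrow> g j < dim_col M"
    and "\<And>x. x \<in> minors k M \<Longrightarrow> d dvd x"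
  shows "d dvd det Z"
  using assms by (intro det_induct_minors[where Q = "\<lambda>_ x. d dvd x" and E = "\<lambda>_. True" and I = I and k = k and M = M and f = f and g = g]) auto

text \<open>Each of the \<open>N - k\<close> expansion steps multiplies by an entry of degree at
  most one.\<close>

lemma degree_det_of_minors:
  fixes M Z :: "'a::field poly mat"
  assumes "Z \<in> carrier_mat N N" and "I \<subseteq> {..<N}" "k \<le> card I"
    and "\<And>i j. i \<in> I \<Longrightarrow> j < N \<Longrightarrow> Z $$ (i,j) = M $$ (f i, g j)"
    and "\<And>i. i \<in> I \<Longrightarrow> f i < dim_row M" and "\<And>j. j < N \<Longrightarrow> g j < dim_col M"
    and "\<And>x. x \<in> minors k M \<Longrightarrow> degree x \<le> b"
    and "\<And>i j. i < N \<Longrightarrow> j < N \<Longrightarrow> degree (Z $$ (i,j)) \<le> 1"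
  shows "degree (det Z) + k \<le> b + N"
proof -
  have k: "k \<le> N" using assms(2,3) by (metis card_lessThan card_mono finite_lessThan order_trans)
  \<comment> \<open>For orders \<open>m < k\<close> the bound can fail for the zero polynomial,
    whose degree is 0 by convention; hence the extra disjunct.\<close>
  have "det Z = 0 \<or> degree (det Z) + k \<le> b + N"
  proof (rule det_induct_minors[where Q = "\<lambda>m x. x = 0 \<or> degree x + k \<le> b + m"
        and E = "\<lambda>x. degree x \<le> 1", OF assms(1-6)])
    fix m and x y :: "'a poly" assume *: "x = 0 \<or> degree x + k \<le> b + m" "y = 0 \<or> degree y + k \<le> b + m"
    from * degree_add_le_max[of x y] show "x + y = 0 \<or> degree (x + y) + k \<le> b + m" by auto
  next
    fix m and a x :: "'a poly" assume *: "degree a \<le> 1" "x = 0 \<or> degree x + k \<le> b + m"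
    show "a * x = 0 \<or> degree (a * x) + k \<le> b + Suc m"
      using * degree_mult_le[of a x] by auto
  qed (use assms(7,8) in auto)
  then show ?thesis using k by auto
qed

section \<open>Determinantal divisors and homogenization\<close>

lemma dvd_antisym_lead_coeff:
  fixes p q :: "'a::idom poly"
  assumes "p dvd q" "q dvd p" "lead_coeff p = lead_coeff q"
  shows "p = q"
proof (cases "p = 0")
  case False
  obtain k where k: "q = p * k" using assms(1) by (elim dvdE)
  have "q \<noteq> 0" using False assms(2) by auto
  have "degree q \<le> degree p" using assms(2) False by (rule dvd_imp_degree_le)
  then have "degree k = 0" using k \<open>q \<noteq> 0\<close> by (auto simp: degree_mult_eq)
  moreover have "lead_coeff k = 1" using k assms(3) False by (simp add: lead_coeff_mult)
  ultimately have "k = 1" by (metis degree_eq_zeroE coeff_pCons_0 one_pCons)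
  then show ?thesis using k by simp
qed (use assms in auto)

text \<open>Divisibility passes to the leading coefficients, so the one-variable case applies first
  to these and then to \<open>p\<close> and \<open>q\<close>. This gives the uniqueness behind
  \<open>hom_det_divisor\<close>.\<close>

lemma dvd_antisym_lead_coeff2:
  fixes p q :: "'a::idom poly poly"
  assumes "p dvd q" "q dvd p" "lead_coeff (lead_coeff p) = lead_coeff (lead_coeff q)"
  shows "p = q"
proof -
  have "lead_coeff p dvd lead_coeff q" "lead_coeff q dvd lead_coeff p"
    using assms(1,2) by (metis dvdE dvd_triv_left lead_coeff_mult)+
  then show ?thesis using assms by (blast intro: dvd_antisym_lead_coeff)
qed

lemma is_gcd_of_dvd:
  "is_gcd_of S d \<Longrightarrow> is_gcd_of S d' \<Longrightarrow> d dvd d'"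
  by (simp add: is_gcd_of_def)

text \<open>A nonzero element of least degree in the ideal generated by \<open>S\<close> is a gcd of \<open>S\<close>.\<close>

lemma is_gcd_of_exists:
  fixes S :: "'a::field poly set"
  assumes "x0 \<in> S" "x0 \<noteq> 0"
  shows "\<exists>d. is_gcd_of S d \<and> lead_coeff d = 1"
proof -
  interpret M: module "(*) :: 'a poly \<Rightarrow> 'a poly \<Rightarrow> 'a poly"
    by unfold_locales (auto simp: algebra_simps)
  let ?I = "M.span S"
  have "x0 \<in> ?I" using assms(1) by (rule M.span_base)
  then obtain d where d: "d \<in> ?I" "d \<noteq> 0" and min: "\<And>y. y \<in> ?I \<Longrightarrow> y \<noteq> 0 \<Longrightarrow> degree d \<le> degree y"
    using ex_has_least_nat[of "\<lambda>x. x \<in> ?I \<and> x \<noteq> 0" x0 degree] assms(2) by blast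
  have "d dvd x" if "x \<in> S" for x
  proof -
    have "x - (x div d) * d \<in> ?I" using that d(1) by (intro M.span_diff M.span_scale) (auto intro: M.span_base)
    then have "x mod d \<in> ?I" by (simp add: minus_div_mult_eq_mod)
    then show ?thesis using min[of "x mod d"] degree_mod_less[of d x] d(2)
      by (metis dvd_eq_mod_eq_0 leD)
  qed
  moreover have "e dvd y" if "\<And>x. x \<in> S \<Longrightarrow> e dvd x" "y \<in> ?I" for e y
    using that(2) by (rule M.span_induct) (auto simp: M.subspace_def that(1))
  ultimately have gcd: "is_gcd_of S d" using d(1) by (auto simp: is_gcd_of_def)
  let ?d = "smult (inverse (lead_coeff d)) d"
  have "lead_coeff ?d = 1" using d(2) by simp
  moreover have "is_gcd_of S ?d"
    using gcd d(2) by (auto simp: is_gcd_of_def smult_dvd_iff intro: dvd_smult)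
  ultimately show ?thesis by blast
qed

lemma det_divisor_is_gcd:
  assumes "x \<in> minors k G" "x \<noteq> 0"
  shows "is_gcd_of (minors k G) (det_divisor G k)" "lead_coeff (det_divisor G k) = 1"
proof -
  have "\<exists>!d. is_gcd_of (minors k G) d \<and> lead_coeff d = 1"
    using is_gcd_of_exists[OF assms] by (auto intro: dvd_antisym_lead_coeff is_gcd_of_dvd)
  from theI'[OF this] show "is_gcd_of (minors k G) (det_divisor G k)" "lead_coeff (det_divisor G k) = 1"
    unfolding det_divisor_def by blast+
qed

text \<open>
  The substitution \<open>p(s,t) \<mapsto> p(s t, t)\<close>, with values in \<open>F[s][t]\<close>. It sends the homogeneous
  polynomials of degree \<open>d\<close> to the monomials of degree \<open>d\<close> in \<open>t\<close>, which turns questions on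
  divisors of homogeneous polynomials into questions on divisors of monomials.
\<close>

definition cone :: "'a::field poly poly \<Rightarrow> 'a poly poly" where
  "cone p = poly (map_poly (map_poly (\<lambda>x. [:x:])) p) (monom [:0, 1:] 1)"

lemma map_poly_hom_const: "map_poly_comm_ring_hom (\<lambda>x::'a::comm_ring_1. [:x:])"
  by unfold_locales (auto simp: one_pCons)

lemma cone_hom: "comm_ring_hom (cone :: 'a::field poly poly \<Rightarrow> 'a poly poly)"
proof -
  interpret c: map_poly_comm_ring_hom "\<lambda>x::'a. [:x:]" by (rule map_poly_hom_const)
  interpret m: map_poly_comm_ring_hom "map_poly (\<lambda>x::'a. [:x:])" ..
  show ?thesis by unfold_locales (auto simp: cone_def hom_distribs m.hom_mult m.hom_add)
qed

interpretation cone: comm_ring_hom "cone :: 'a::field poly poly \<Rightarrow> 'a poly poly"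
  by (rule cone_hom)

lemma cone_pCons: "cone (pCons c p) = map_poly (\<lambda>x. [:x:]) c + monom [:0,1:] 1 * cone p"
proof (cases "pCons c p = 0")
  case False
  then show ?thesis by (simp add: cone_def map_poly_pCons)
qed (simp add: cone_def)

text \<open>The monomial \<open>s^a t^b\<close> goes to \<open>s^a t^(a + b)\<close>. No two
  monomials collide, which is why \<open>cone\<close> is injective.\<close>

lemma coeff_cone:
  "coeff (coeff (cone p) m) a = (if a \<le> m then coeff (coeff p a) (m - a) else 0)"
proof (induction p arbitrary: m a)
  case 0
  show ?case by (simp add: cone_def)
next
  case (pCons c p)
  show ?case
    by (cases a; cases m) (auto simp: cone_pCons coeff_monom_mult coeff_map_poly coeff_pCons pCons.IH)
qed

lemma cone_inj: "cone p = cone q \<Longrightarrow> p = q"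
proof (intro poly_eqI)
  fix a b assume "cone p = cone q"
  then have "coeff (coeff (cone p) (a + b)) a = coeff (coeff (cone q) (a + b)) a" by simp
  then show "coeff (coeff p a) b = coeff (coeff q a) b" by (simp add: coeff_cone)
qed

lemma cone_const_monom [simp]: "cone [:monom 1 e:] = monom 1 e"
  by (intro poly_eqI) (auto simp: coeff_cone coeff_pCons split: nat.splits)

lemma coeff_homogenize:
  "coeff (coeff (homogenize p) a) b = (if a \<le> degree p \<and> b = degree p - a then coeff p a else 0)"
proof -
  have "coeff (coeff (homogenize p) a) b =
    (\<Sum>i\<le>degree p. if i = a then (if b = degree p - i then coeff p i else 0) else 0)"
    unfolding homogenize_def coeff_sum by (intro sum.cong) (auto simp: coeff_monom)
  then show ?thesis by (simp add: sum.delta)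
qed

lemma cone_homogenize [simp]: "cone (homogenize p) = monom p (degree p)"
proof (intro poly_eqI)
  fix m a
  show "coeff (coeff (cone (homogenize p)) m) a = coeff (coeff (monom p (degree p)) m) a"
    by (auto simp: coeff_cone coeff_homogenize coeff_eq_0)
qed

lemma lead_coeff_homogenize:
  assumes "p \<noteq> 0"
  shows "lead_coeff (homogenize p) = [:lead_coeff p:]"
proof -
  have c: "coeff (homogenize p) (degree p) = [:lead_coeff p:]"
    by (rule poly_eqI) (auto simp: coeff_homogenize coeff_pCons split: nat.splits)
  have "degree (homogenize p) \<le> degree p"
    by (rule degree_le) (auto intro!: poly_eqI simp: coeff_homogenize)
  moreover have "degree p \<le> degree (homogenize p)"
    using c assms by (intro le_degree) auto
  ultimately show ?thesis using c by simp
qed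

lemma homogenize_nonzero: "p \<noteq> 0 \<Longrightarrow> homogenize p \<noteq> 0"
  using lead_coeff_homogenize[of p] by auto

text \<open>In a domain the lowest exponent is additive on products, as the degree is. For a
  monomial both equal \<open>k\<close>, so in each factor they agree as well. Under
  \<open>cone\<close> this forces divisors of homogeneous polynomials to be homogeneous.\<close>

lemma monom_eq_mult:
  fixes p q :: "'a::idom poly"
  assumes "p * q = monom c k" "c \<noteq> 0"
  obtains a b j where "j \<le> k" "p = monom a j" "q = monom b (k - j)" "a * b = c"
proof -
  have nz: "p \<noteq> 0" "q \<noteq> 0" using assms by auto
  define i where "i = (LEAST i. coeff p i \<noteq> 0)"
  define j where "j = (LEAST j. coeff q j \<noteq> 0)"
  have i: "coeff p i \<noteq> 0" "\<And>m. m < i \<Longrightarrow> coeff p m = 0"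
  proof -
    have "coeff p (degree p) \<noteq> 0" using nz by simp
    then show "coeff p i \<noteq> 0" unfolding i_def by (rule LeastI)
    show "coeff p m = 0" if "m < i" for m using not_less_Least[OF that[unfolded i_def]] by simp
  qed
  have j: "coeff q j \<noteq> 0" "\<And>m. m < j \<Longrightarrow> coeff q m = 0"
  proof -
    have "coeff q (degree q) \<noteq> 0" using nz by simp
    then show "coeff q j \<noteq> 0" unfolding j_def by (rule LeastI)
    show "coeff q m = 0" if "m < j" for m using not_less_Least[OF that[unfolded j_def]] by simp
  qed
  have "coeff (p * q) (i + j) = (\<Sum>m\<le>i + j. if m = i then coeff p i * coeff q j else 0)"
    unfolding coeff_mult
  proof (intro sum.cong refl)
    fix m assume "m \<in> {..i + j}"
    then show "coeff p m * coeff q (i + j - m) = (if m = i then coeff p i * coeff q j else 0)"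
      using i(2)[of m] j(2)[of "i + j - m"] by (cases m i rule: linorder_cases) auto
  qed
  then have "coeff (p * q) (i + j) \<noteq> 0" using i(1) j(1) by simp
  then have "i + j = k" using assms(1) by (auto simp: coeff_monom split: if_splits)
  moreover have "degree p + degree q = k"
    using assms nz by (metis degree_monom_eq degree_mult_eq)
  moreover have "i \<le> degree p" "j \<le> degree q" using i(1) j(1) by (auto intro: le_degree)
  ultimately have d: "i = degree p" "j = degree q" by auto
  have "p = monom (coeff p i) i"
    using i(2) d(1) by (intro poly_eqI) (metis coeff_eq_0 coeff_monom linorder_neqE_nat)
  moreover have "q = monom (coeff q j) (k - i)"
    using j(2) d(2) \<open>i + j = k\<close> by (intro poly_eqI) (metis add_diff_cancel_left' coeff_eq_0 coeff_monom linorder_neqE_nat)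
  moreover have "coeff p i * coeff q j = c"
    using \<open>coeff (p * q) (i + j) = _\<close> assms(1) \<open>i + j = k\<close> by simp
  ultimately show ?thesis using that[of i] \<open>i + j = k\<close> by auto
qed

text \<open>The exponent of \<open>t\<close> in \<open>cone e\<close> records the total degree,
  which bounds the exponent of \<open>s\<close>.\<close>

lemma degree_le_of_cone:
  assumes "cone e = monom p j"
  shows "degree p \<le> j"
proof (rule degree_le, intro allI impI)
  fix a assume "j < a"
  then show "coeff p a = 0" using coeff_cone[of e j a] assms by simp
qed

section \<open>Minors of consecutive orders and of the homogenized pencil\<close>

lemma minors_nonzero:
  fixes A :: "'a::comm_ring_1 mat"
  assumes "A \<in> carrier_mat n n" "det A \<noteq> 0" "k \<le> n"
  shows "\<exists>x\<in>minors k A. x \<noteq> 0"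
proof (rule ccontr)
  assume "\<not> ?thesis"
  \<comment> \<open>Vanishing is divisibility by \<open>0\<close>, which the expansion transports
    from the minors to the determinant.\<close>
  then have "0 dvd det A"
    using assms by (intro det_dvd_of_minors[of A n "{..<n}" k A id id]) auto
  with assms(2) show False by simp
qed

lemma finite_minors: "finite (minors k M)"
proof (rule finite_subset)
  show "minors k M \<subseteq> (\<lambda>(I,J). det (submatrix M I J)) ` (Pow {..<dim_row M} \<times> Pow {..<dim_col M})"
    by (auto simp: minors_def)
qed simp

lemma minorsE:
  fixes M :: "'a::comm_ring_1 mat"
  assumes "x \<in> minors k M"
  obtains I J where "I \<subseteq> {..<dim_row M}" "J \<subseteq> {..<dim_col M}" "card I = k" "card J = k"
    "x = det (mat k k (\<lambda>(i,j). M $$ (pick I i, pick J j)))"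
    "\<And>i. i < k \<Longrightarrow> pick I i < dim_row M" "\<And>j. j < k \<Longrightarrow> pick J j < dim_col M"
proof -
  obtain I J where IJ: "I \<subseteq> {..<dim_row M}" "J \<subseteq> {..<dim_col M}" "card I = k" "card J = k"
    "x = det (submatrix M I J)" using assms by (auto simp: minors_def)
  moreover have "pick I i < dim_row M" if "i < k" for i
    using pick_in_set_le[of i I] that IJ by auto
  moreover have "pick J j < dim_col M" if "j < k" for j
    using pick_in_set_le[of j J] that IJ by auto
  ultimately show ?thesis using that[of I J] submatrix_eq_mat[of I M J k] by simp
qed

lemma minors_Suc_dvd:
  fixes M :: "'a::comm_ring_1 mat"
  assumes "\<And>x. x \<in> minors k M \<Longrightarrow> d dvd x" "x \<in> minors (Suc k) M"
  shows "d dvd x"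
proof -
  obtain I J where *: "x = det (mat (Suc k) (Suc k) (\<lambda>(i,j). M $$ (pick I i, pick J j)))"
    "\<And>i. i < Suc k \<Longrightarrow> pick I i < dim_row M" "\<And>j. j < Suc k \<Longrightarrow> pick J j < dim_col M"
    by (rule minorsE[OF assms(2)]) blast
  show ?thesis unfolding *(1)
    by (rule det_dvd_of_minors[of _ "Suc k" "{..<Suc k}" k M "pick I" "pick J"]) (use * assms(1) in auto)
qed

lemma minors_Suc_degree:
  fixes M :: "'a::field poly mat"
  assumes "matrix_pencil m n M" "\<And>x. x \<in> minors k M \<Longrightarrow> degree x \<le> b" "x \<in> minors (Suc k) M"
  shows "degree x \<le> Suc b"
proof -
  obtain I J where *: "x = det (mat (Suc k) (Suc k) (\<lambda>(i,j). M $$ (pick I i, pick J j)))"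
    "\<And>i. i < Suc k \<Longrightarrow> pick I i < dim_row M" "\<And>j. j < Suc k \<Longrightarrow> pick J j < dim_col M"
    by (rule minorsE[OF assms(3)]) blast
  have "degree x + k \<le> b + Suc k" unfolding *(1)
    by (rule degree_det_of_minors[of _ "Suc k" "{..<Suc k}" k M "pick I" "pick J"])
      (use * assms(1,2) in \<open>auto simp: matrix_pencil_def\<close>)
  then show ?thesis by simp
qed

lemma minors_0: "minors 0 M = {1}"
proof -
  have "det (submatrix M {} {}) = 1" by (rule det_dim_zero) (auto simp: submatrix_def)
  moreover have "I = {}" if "I \<subseteq> {..<b}" "card I = 0" for I :: "nat set" and b
    using that finite_subset[OF that(1)] by simp
  ultimately have "x \<in> minors 0 M \<longleftrightarrow> x = 1" for x
    unfolding minors_def mem_Collect_eq by (metis card.empty empty_subsetI)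
  then show ?thesis by blast
qed

lemma degree_minor_le:
  fixes M :: "'a::field poly mat"
  assumes "matrix_pencil m n M" "x \<in> minors k M"
  shows "degree x \<le> k"
  using assms(2)
proof (induction k arbitrary: x)
  case (Suc k)
  then show ?case using minors_Suc_degree[OF assms(1)] by blast
qed (simp add: minors_0)

text \<open>On entries, \<open>cone\<close> turns \<open>t a + s b\<close> into
  \<open>t (a + s b)\<close>. A minor of order \<open>k\<close> therefore only acquires the factor
  \<open>t^k\<close>.\<close>

lemma cone_minor:
  fixes A :: "'a::field poly mat"
  assumes A: "matrix_pencil m n A"
    and IJ: "I \<subseteq> {..<dim_row A}" "J \<subseteq> {..<dim_col A}" "card I = k" "card J = k"
  shows "cone (det (submatrix (hom_pencil A) I J)) = monom (det (submatrix A I J)) k"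
proof -
  let ?X = "submatrix (hom_pencil A) I J" and ?Y = "submatrix A I J"
  interpret c: comm_ring_hom "\<lambda>x::'a poly. [:x:]"
    by unfold_locales (auto simp: one_pCons)
  have X: "?X = mat k k (\<lambda>(i,j). hom_pencil A $$ (pick I i, pick J j))"
    using IJ by (intro submatrix_eq_mat) (auto simp: hom_pencil_def)
  have Y: "?Y = mat k k (\<lambda>(i,j). A $$ (pick I i, pick J j))"
    using IJ by (intro submatrix_eq_mat) auto
  have entry: "cone [:[:0, coeff p 0:], [:coeff p 1:]:] = monom 1 1 * [:p:]" if "degree p \<le> 1" for p :: "'a poly"
  proof -
    have "p = [:coeff p 0, coeff p 1:]" using that by (intro poly_eqI) (auto simp: coeff_pCons coeff_eq_0 split: nat.splits)
    then obtain a b where p: "p = [:a, b:]" by blast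
    show ?thesis unfolding p
      by (intro poly_eqI) (auto simp: coeff_cone coeff_monom_mult coeff_pCons split: nat.splits)
  qed
  have "map_mat cone ?X = monom 1 1 \<cdot>\<^sub>m map_mat (\<lambda>x. [:x:]) ?Y"
  proof (rule eq_matI)
    fix i j assume "i < dim_row (monom 1 1 \<cdot>\<^sub>m map_mat (\<lambda>x. [:x:]) ?Y)"
      "j < dim_col (monom 1 1 \<cdot>\<^sub>m map_mat (\<lambda>x. [:x:]) ?Y)"
    then have ij: "i < k" "j < k" by (auto simp: Y)
    have pk: "pick I i < dim_row A" "pick J j < dim_col A"
      using pick_in_set_le[of i I] pick_in_set_le[of j J] ij IJ by auto
    then have "degree (A $$ (pick I i, pick J j)) \<le> 1" using A by (auto simp: matrix_pencil_def)
    moreover have "?X $$ (i,j) = hom_pencil A $$ (pick I i, pick J j)" using ij by (simp add: X)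
    ultimately show "map_mat cone ?X $$ (i,j) = (monom 1 1 \<cdot>\<^sub>m map_mat (\<lambda>x. [:x:]) ?Y) $$ (i,j)"
      using ij pk entry[of "A $$ (pick I i, pick J j)"] by (simp add: X Y) (simp add: hom_pencil_def)
  qed (auto simp: X Y)
  then have "cone (det ?X) = monom 1 1 ^ k * [:det ?Y:]"
    by (simp flip: cone.hom_det add: det_smult) (simp add: Y)
  then show ?thesis by (simp add: monom_power smult_monom)
qed

lemma cone_minors:
  fixes A :: "'a::field poly mat"
  assumes A: "matrix_pencil m n A"
  shows "y \<in> minors k (hom_pencil A) \<Longrightarrow> \<exists>x\<in>minors k A. cone y = monom x k"
    and "x \<in> minors k A \<Longrightarrow> \<exists>y\<in>minors k (hom_pencil A). cone y = monom x k"
proof -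
  have dims: "dim_row (hom_pencil A) = dim_row A" "dim_col (hom_pencil A) = dim_col A"
    by (simp_all add: hom_pencil_def)
  show "\<exists>x\<in>minors k A. cone y = monom x k" if y: "y \<in> minors k (hom_pencil A)"
  proof -
    obtain I J where IJ: "I \<subseteq> {..<dim_row A}" "J \<subseteq> {..<dim_col A}" "card I = k" "card J = k"
      "y = det (submatrix (hom_pencil A) I J)"
      using y unfolding minors_def dims by blast
    then have "det (submatrix A I J) \<in> minors k A" unfolding minors_def by blast
    with cone_minor[OF A IJ(1-4)] IJ(5) show ?thesis by blast
  qed
  show "\<exists>y\<in>minors k (hom_pencil A). cone y = monom x k" if x: "x \<in> minors k A"
  proof -
    obtain I J where IJ: "I \<subseteq> {..<dim_row A}" "J \<subseteq> {..<dim_col A}" "card I = k" "card J = k"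
      "x = det (submatrix A I J)"
      using x unfolding minors_def by blast
    then have "det (submatrix (hom_pencil A) I J) \<in> minors k (hom_pencil A)"
      unfolding minors_def dims by blast
    with cone_minor[OF A IJ(1-4)] IJ(5) show ?thesis by blast
  qed
qed

definition max_minor_degree :: "'a::field poly mat \<Rightarrow> nat \<Rightarrow> nat" where
  "max_minor_degree A k = Max (degree ` minors k A)"

lemma degree_le_max_minor_degree: "x \<in> minors k A \<Longrightarrow> degree x \<le> max_minor_degree A k"
  unfolding max_minor_degree_def by (intro Max_ge finite_imageI finite_minors) auto

lemma max_minor_degree_attained:
  assumes "x0 \<in> minors k A" "x0 \<noteq> 0"
  obtains x where "x \<in> minors k A" "x \<noteq> 0" "degree x = max_minor_degree A k"
proof -
  have "max_minor_degree A k \<in> degree ` minors k A"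
    unfolding max_minor_degree_def using assms by (intro Max_in finite_imageI finite_minors) auto
  then obtain x where x: "x \<in> minors k A" "degree x = max_minor_degree A k" by auto
  show ?thesis
  proof (cases "x = 0")
    \<comment> \<open>The zero minor has degree 0; if the maximum is attained there, it is 0 and
      every nonzero minor attains it.\<close>
    case True
    then show ?thesis using x assms degree_le_max_minor_degree[OF assms(1)] that[of x0] by simp
  qed (use x that in auto)
qed

text \<open>A minor of degree \<open>d\<close> corresponds to a homogeneous minor with exact factor
  \<open>t^(k - d)\<close>; the power common to all of them is decided by the largest
  \<open>d\<close>.\<close>

definition min_pow_t :: "'a::field poly mat \<Rightarrow> nat \<Rightarrow> nat" where
  "min_pow_t A k = k - max_minor_degree A k"

lemma cone_smult_monom [simp]: "cone (smult (monom 1 e) p) = monom 1 e * cone p"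
proof -
  have "cone ([:monom 1 e:] * p) = monom 1 e * cone p" by (simp only: cone.hom_mult cone_const_monom)
  then show ?thesis by simp
qed

text \<open>All comparisons are made after applying \<open>cone\<close>, where a minor becomes
  \<open>x t^k\<close> and \<open>?T\<close> becomes a power of \<open>t\<close> times
  \<open>?D\<close>; injectivity brings the factorizations back.\<close>

lemma hom_det_divisor_eq:
  fixes A :: "'a::field poly mat"
  assumes A: "matrix_pencil m n A" and x0: "x0 \<in> minors k A" "x0 \<noteq> 0"
  shows "hom_det_divisor A k = [:monom 1 (min_pow_t A k):] * homogenize (det_divisor A k)"
    (is "_ = ?T")
proof -
  let ?D = "det_divisor A k" and ?b = "max_minor_degree A k"
  note D = det_divisor_is_gcd[OF x0]
  have D0: "?D \<noteq> 0" using D(2) by auto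
  obtain m0 where m0: "m0 \<in> minors k A" "m0 \<noteq> 0" "degree m0 = ?b"
    using max_minor_degree_attained[OF x0] .
  have bk: "?b \<le> k" using degree_minor_le[OF A m0(1)] m0(3) by simp
  have cone_T: "cone ?T = monom ?D (k - ?b + degree ?D)"
    by (simp add: cone.hom_mult min_pow_t_def mult_monom)
  have "is_gcd_of (minors k (hom_pencil A)) ?T"
    unfolding is_gcd_of_def
  proof (intro conjI ballI allI impI)
    fix y assume "y \<in> minors k (hom_pencil A)"
    then obtain x where x: "x \<in> minors k A" "cone y = monom x k" using cone_minors(1)[OF A] by blast
    then have "?D dvd x" using D(1) by (simp add: is_gcd_of_def)
    then obtain x' where x': "x = ?D * x'" by (elim dvdE)
    show "?T dvd y"
    proof (cases "x = 0")
      case True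
      then have "y = 0" using x(2) cone_inj[of y 0] by simp
      then show ?thesis by simp
    next
      case False
      then have "degree x = degree ?D + degree x'" using x' D0 by (auto simp: degree_mult_eq)
      moreover have "degree x \<le> ?b" using x(1) by (rule degree_le_max_minor_degree)
      ultimately have "cone y = cone (?T * ([:monom 1 (?b - degree x):] * homogenize x'))"
        using bk by (simp add: cone.hom_mult cone_T mult_monom x(2) x' min_pow_t_def)
      then show ?thesis by (metis cone_inj dvd_triv_left)
    qed
  next
    fix e assume e: "\<forall>y\<in>minors k (hom_pencil A). e dvd y"
    \<comment> \<open>A minor of largest degree serves twice: its image is a monomial in
      \<open>t\<close>, hence so is the image of its divisor \<open>e\<close>, and its degree bounds
      the power of \<open>t\<close> in \<open>e\<close>.\<close>
    obtain y0 where y0: "y0 \<in> minors k (hom_pencil A)" "cone y0 = monom m0 k"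
      using cone_minors(2)[OF A m0(1)] by blast
    have "e dvd y0" using e y0(1) by blast
    then obtain f where "y0 = e * f" by (elim dvdE)
    then have "cone e * cone f = monom m0 k" using y0(2) by (simp add: cone.hom_mult)
    then obtain e' f' j where j: "j \<le> k" "cone e = monom e' j" "cone f = monom f' (k - j)" "e' * f' = m0"
      using monom_eq_mult m0(2) by metis
    have "e' dvd x" if x: "x \<in> minors k A" for x
    proof -
      obtain y where y: "y \<in> minors k (hom_pencil A)" "cone y = monom x k"
        using cone_minors(2)[OF A x] by blast
      have "e dvd y" using e y(1) by blast
      then obtain g where "y = e * g" by (elim dvdE)
      then have "coeff (monom x k) k = coeff (monom e' j * cone g) k"
        using y(2) j(2) by (simp add: cone.hom_mult)
      then show ?thesis using j(1) by (simp add: coeff_monom_mult)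
    qed
    then have "e' dvd ?D" using D(1) by (simp add: is_gcd_of_def)
    then obtain c where c: "?D = e' * c" by (elim dvdE)
    then have nz: "e' \<noteq> 0" "c \<noteq> 0" "f' \<noteq> 0" using D0 j(4) m0(2) by auto
    have deg: "degree e' \<le> j" "degree f' \<le> k - j"
      using degree_le_of_cone j(2,3) by blast+
    have "?b = degree e' + degree f'" using m0(3) j(4) nz by (auto simp: degree_mult_eq)
    moreover have "degree ?D = degree e' + degree c" using c nz by (simp add: degree_mult_eq)
    \<comment> \<open>\<open>j - degree e'\<close> is the exponent of \<open>t\<close> in
      \<open>e\<close>. It is at most \<open>k - ?b\<close> because
      \<open>?b - degree e' = degree f' \<le> k - j\<close>.\<close>
    ultimately have "cone ?T = cone (e * ([:monom 1 (k - ?b - (j - degree e')):] * homogenize c))"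
      using deg j(1) by (simp add: cone.hom_mult cone_T mult_monom j(2) min_pow_t_def flip: c)
    then show "e dvd ?T" by (metis cone_inj dvd_triv_left)
  qed
  moreover have "lead_coeff (lead_coeff ?T) = 1"
    using D(2) D0 by (simp add: lead_coeff_mult lead_coeff_homogenize degree_monom_eq)
  ultimately show ?thesis
    unfolding hom_det_divisor_def
    by (intro the_equality) (auto intro: dvd_antisym_lead_coeff2 is_gcd_of_dvd)
qed

section \<open>Products of invariant factors and sums of multiplicities at infinity\<close>

context
  fixes A :: "'a::field poly mat" and n :: nat
  assumes A: "regular_pencil n A"
begin

lemma regular_minor_nonzero: "k \<le> n \<Longrightarrow> \<exists>x\<in>minors k A. x \<noteq> 0"
  using A by (auto simp: regular_pencil_def matrix_pencil_def intro!: minors_nonzero)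

lemma regular_det_divisor:
  assumes "k \<le> n"
  shows "is_gcd_of (minors k A) (det_divisor A k)" "lead_coeff (det_divisor A k) = 1"
  using det_divisor_is_gcd regular_minor_nonzero[OF assms] by blast+

lemma det_divisor_0: "det_divisor A 0 = 1"
  using regular_det_divisor[of 0]
  by (intro dvd_antisym_lead_coeff) (auto simp: is_gcd_of_def minors_0)

lemma det_divisor_Suc_eq:
  assumes "Suc k \<le> n"
  shows "det_divisor A (Suc k) = invariant_factor A (Suc k) * det_divisor A k"
proof -
  have "det_divisor A k dvd x" if "x \<in> minors (Suc k) A" for x
    using minors_Suc_dvd[OF _ that] regular_det_divisor(1)[of k] assms by (auto simp: is_gcd_of_def)
  then have "det_divisor A k dvd det_divisor A (Suc k)"
    using regular_det_divisor(1)[OF assms] by (auto simp: is_gcd_of_def)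
  then show ?thesis by (simp add: invariant_factor_def)
qed

lemma prod_invariant_factor: "k \<le> n \<Longrightarrow> (\<Prod>i=1..k. invariant_factor A i) = det_divisor A k"
  by (induction k) (simp_all add: det_divisor_0 det_divisor_Suc_eq mult.commute)

text \<open>The largest degree of a minor grows by at most one with the order, so its gap to the
  order cannot shrink. This makes the subtraction in \<open>mult_infinity_Suc\<close> a true one and
  lets the sum telescope.\<close>

lemma min_pow_t_mono:
  assumes "Suc k \<le> n"
  shows "min_pow_t A k \<le> min_pow_t A (Suc k)"
proof -
  have P: "matrix_pencil n n A" using A by (simp add: regular_pencil_def)
  obtain x where x: "x \<in> minors (Suc k) A" "degree x = max_minor_degree A (Suc k)"
    using regular_minor_nonzero[OF assms] max_minor_degree_attained by metis
  have "degree x \<le> Suc (max_minor_degree A k)"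
    by (rule minors_Suc_degree[OF P degree_le_max_minor_degree x(1)])
  then show ?thesis using x(2) by (simp add: min_pow_t_def)
qed

lemma mult_infinity_Suc:
  assumes "Suc k \<le> n"
  shows "mult_infinity A (Suc k) = min_pow_t A (Suc k) - min_pow_t A k"
proof -
  have P: "matrix_pencil n n A" using A by (simp add: regular_pencil_def)
  let ?c = "invariant_factor A (Suc k)" and ?D = "det_divisor A k"
  have T: "hom_det_divisor A j = [:monom 1 (min_pow_t A j):] * homogenize (det_divisor A j)" if "j \<le> n" for j
    using regular_minor_nonzero[OF that] hom_det_divisor_eq[OF P] by blast
  have D: "?D \<noteq> 0" "det_divisor A (Suc k) \<noteq> 0"
    using regular_det_divisor(2)[of k] regular_det_divisor(2)[of "Suc k"] assms by auto
  have c0: "?c \<noteq> 0" using D det_divisor_Suc_eq[OF assms] by auto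
  \<comment> \<open>Homogenization is multiplicative, since after \<open>cone\<close> it is a
    product of monomials in \<open>t\<close>.\<close>
  have "cone (homogenize (?c * ?D)) = cone (homogenize ?c * homogenize ?D)"
    using c0 D by (simp add: cone.hom_mult mult_monom degree_mult_eq)
  then have h: "homogenize (det_divisor A (Suc k)) = homogenize ?c * homogenize ?D"
    unfolding det_divisor_Suc_eq[OF assms] by (rule cone_inj)
  have "hom_det_divisor A (Suc k) =
      ([:monom 1 (min_pow_t A (Suc k) - min_pow_t A k):] * homogenize ?c) * hom_det_divisor A k"
    using min_pow_t_mono[OF assms] assms by (simp add: T h mult_monom)
  moreover have "hom_det_divisor A k \<noteq> 0" using T[of k] assms D homogenize_nonzero by auto
  ultimately have G: "hom_invariant_factor A (Suc k) =
      [:monom 1 (min_pow_t A (Suc k) - min_pow_t A k):] * homogenize ?c"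
    unfolding hom_invariant_factor_def diff_Suc_1 by (metis nonzero_mult_div_cancel_right)
  show ?thesis
    unfolding mult_infinity_def G
  proof (rule the_equality)
    fix e assume "[:monom 1 (min_pow_t A (Suc k) - min_pow_t A k):] * homogenize ?c = [:monom 1 e:] * homogenize ?c"
    then have "monom (1::'a) (min_pow_t A (Suc k) - min_pow_t A k) = monom 1 e"
      using homogenize_nonzero[OF c0] by (metis mult_right_cancel pCons_eq_iff)
    then show "e = min_pow_t A (Suc k) - min_pow_t A k" by (simp add: monom_eq_iff')
  qed simp
qed

lemma sum_mult_infinity: "k \<le> n \<Longrightarrow> (\<Sum>i=1..k. mult_infinity A i) = min_pow_t A k"
proof (induction k)
  case 0
  then show ?case by (simp add: min_pow_t_def)
next
  case (Suc k)
  then show ?case using min_pow_t_mono[of k] by (simp add: mult_infinity_Suc)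
qed

end

section \<open>Smith form\<close>

definition unimod_equiv :: "nat \<Rightarrow> 'a::comm_ring_1 mat \<Rightarrow> 'a mat \<Rightarrow> bool" where
  "unimod_equiv n A B \<longleftrightarrow> A \<in> carrier_mat n n \<and> B \<in> carrier_mat n n \<and>
     (\<exists>U U' V V'. U \<in> carrier_mat n n \<and> U' \<in> carrier_mat n n \<and> V \<in> carrier_mat n n \<and> V' \<in> carrier_mat n n \<and>
        U * U' = 1\<^sub>m n \<and> U' * U = 1\<^sub>m n \<and> V * V' = 1\<^sub>m n \<and> V' * V = 1\<^sub>m n \<and> A = U * B * V)"

lemma unimod_equivI:
  assumes "A = U * B * V" "A \<in> carrier_mat n n" "B \<in> carrier_mat n n"
    "U \<in> carrier_mat n n" "U' \<in> carrier_mat n n" "V \<in> carrier_mat n n" "V' \<in> carrier_mat n n"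
    "U * U' = 1\<^sub>m n" "U' * U = 1\<^sub>m n" "V * V' = 1\<^sub>m n" "V' * V = 1\<^sub>m n"
  shows "unimod_equiv n A B"
  using assms unfolding unimod_equiv_def by blast

lemma unimod_equiv_refl: "A \<in> carrier_mat n n \<Longrightarrow> unimod_equiv n A A"
  by (rule unimod_equivI[of A "1\<^sub>m n" A "1\<^sub>m n" n "1\<^sub>m n" "1\<^sub>m n"]) auto

lemma mat_inverse_cancel:
  fixes M :: "'a::comm_ring_1 mat"
  assumes "M \<in> carrier_mat n n" "M' \<in> carrier_mat n n" "M * M' = 1\<^sub>m n" "N \<in> carrier_mat n m"
  shows "M * (M' * N) = N"
  using assms assoc_mult_mat[OF assms(1,2,4)] by simp

lemma unimod_equiv_left:
  assumes "unimod_equiv n A B" and E: "E \<in> carrier_mat n n" "E' \<in> carrier_mat n n" "E * E' = 1\<^sub>m n" "E' * E = 1\<^sub>m n"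
  shows "unimod_equiv n A (E * B)"
proof -
  obtain U U' V V' where A: "A \<in> carrier_mat n n" and B: "B \<in> carrier_mat n n"
    and c: "U \<in> carrier_mat n n" "U' \<in> carrier_mat n n" "V \<in> carrier_mat n n" "V' \<in> carrier_mat n n"
    and i: "U * U' = 1\<^sub>m n" "U' * U = 1\<^sub>m n" "V * V' = 1\<^sub>m n" "V' * V = 1\<^sub>m n" and e: "A = U * B * V"
    using assms(1) unfolding unimod_equiv_def by blast
  have 1: "U * E' * (E * U') = 1\<^sub>m n"
    using c E i by (simp add: assoc_mult_mat[of _ n n _ n _ n] mat_inverse_cancel[of _ n])
  have 2: "E * U' * (U * E') = 1\<^sub>m n"
    using c E i by (simp add: assoc_mult_mat[of _ n n _ n _ n] mat_inverse_cancel[of _ n])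
  have 3: "A = U * E' * (E * B) * V"
    using c E B e by (simp add: assoc_mult_mat[of _ n n _ n _ n] mat_inverse_cancel[of _ n])
  show ?thesis
    by (rule unimod_equivI[OF 3 A, of "E * U'" V']) (use 1 2 B E c i in simp_all)
qed

lemma unimod_equiv_right:
  assumes "unimod_equiv n A B" and E: "E \<in> carrier_mat n n" "E' \<in> carrier_mat n n" "E * E' = 1\<^sub>m n" "E' * E = 1\<^sub>m n"
  shows "unimod_equiv n A (B * E)"
proof -
  obtain U U' V V' where A: "A \<in> carrier_mat n n" and B: "B \<in> carrier_mat n n"
    and c: "U \<in> carrier_mat n n" "U' \<in> carrier_mat n n" "V \<in> carrier_mat n n" "V' \<in> carrier_mat n n"
    and i: "U * U' = 1\<^sub>m n" "U' * U = 1\<^sub>m n" "V * V' = 1\<^sub>m n" "V' * V = 1\<^sub>m n" and e: "A = U * B * V"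
    using assms(1) unfolding unimod_equiv_def by blast
  have 1: "E' * V * (V' * E) = 1\<^sub>m n"
    using c E i by (simp add: assoc_mult_mat[of _ n n _ n _ n] mat_inverse_cancel[of _ n])
  have 2: "V' * E * (E' * V) = 1\<^sub>m n"
    using c E i by (simp add: assoc_mult_mat[of _ n n _ n _ n] mat_inverse_cancel[of _ n])
  have 3: "A = U * (B * E) * (E' * V)"
    using c E B e by (simp add: assoc_mult_mat[of _ n n _ n _ n] mat_inverse_cancel[of _ n])
  show ?thesis
    by (rule unimod_equivI[OF 3 A, of U' "V' * E"]) (use 1 2 B E c i in simp_all)
qed

lemma unimod_equiv_carrier: "unimod_equiv n A B \<Longrightarrow> B \<in> carrier_mat n n"
  by (simp add: unimod_equiv_def)

lemma unimod_equiv_addrow: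
  assumes "unimod_equiv n A B" "k < n" "l < n" "k \<noteq> l"
  shows "unimod_equiv n A (addrow a k l B)"
  using unimod_equiv_left[OF assms(1), of "addrow_mat n a k l" "addrow_mat n (-a) k l"]
    addrow_mat_inv[OF assms(2-4), of a] addrow_mat_inv[OF assms(2-4), of "-a"]
    addrow_mat[OF unimod_equiv_carrier[OF assms(1)] assms(3), of a k] by simp

lemma unimod_equiv_addcol:
  assumes "unimod_equiv n A B" "k < n" "l < n" "k \<noteq> l"
  shows "unimod_equiv n A (addcol a k l B)"
  using unimod_equiv_right[OF assms(1), of "addrow_mat n a l k" "addrow_mat n (-a) l k"]
    addrow_mat_inv[OF assms(3,2) assms(4)[symmetric], of a] addrow_mat_inv[OF assms(3,2) assms(4)[symmetric], of "-a"]
    addcol_mat[OF unimod_equiv_carrier[OF assms(1)] assms(3), of a k] by simp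

lemma unimod_equiv_swaprows:
  assumes "unimod_equiv n A B" "k < n" "l < n"
  shows "unimod_equiv n A (swaprows k l B)"
  using unimod_equiv_left[OF assms(1), of "swaprows_mat n k l" "swaprows_mat n k l"]
    swaprows_mat_inv[OF assms(2,3)] swaprows_mat[OF unimod_equiv_carrier[OF assms(1)] assms(2,3)] by simp

lemma unimod_equiv_swapcols:
  assumes "unimod_equiv n A B" "k < n" "l < n"
  shows "unimod_equiv n A (swapcols k l B)"
  using unimod_equiv_right[OF assms(1), of "swaprows_mat n k l" "swaprows_mat n k l"]
    swaprows_mat_inv[OF assms(2,3)] swapcols_mat[OF unimod_equiv_carrier[OF assms(1)] assms(2,3)] by simp

text \<open>A diagonal entry has to divide the whole block to its lower right, not just the next
  diagonal entry: in this form row and column operations inside the remaining block preserve the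
  condition.\<close>

definition smith_upto :: "nat \<Rightarrow> nat \<Rightarrow> 'a::comm_ring_1 mat \<Rightarrow> bool" where
  "smith_upto n k B \<longleftrightarrow> (\<forall>i<k. \<forall>j<n. j \<noteq> i \<longrightarrow> B $$ (i,j) = 0 \<and> B $$ (j,i) = 0) \<and>
     (\<forall>i<k. \<forall>a b. i \<le> a \<longrightarrow> a < n \<longrightarrow> i \<le> b \<longrightarrow> b < n \<longrightarrow> B $$ (i,i) dvd B $$ (a,b))"

lemma smith_uptoD:
  assumes "smith_upto n k B" "i < k"
  shows "j < n \<Longrightarrow> j \<noteq> i \<Longrightarrow> B $$ (i,j) = 0" "j < n \<Longrightarrow> j \<noteq> i \<Longrightarrow> B $$ (j,i) = 0"
    "i \<le> a \<Longrightarrow> a < n \<Longrightarrow> i \<le> b \<Longrightarrow> b < n \<Longrightarrow> B $$ (i,i) dvd B $$ (a,b)"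
  using assms unfolding smith_upto_def by blast+

lemma smith_uptoI:
  assumes "\<And>i j. i < k \<Longrightarrow> j < n \<Longrightarrow> j \<noteq> i \<Longrightarrow> B $$ (i,j) = 0 \<and> B $$ (j,i) = 0"
    "\<And>i a b. i < k \<Longrightarrow> i \<le> a \<Longrightarrow> a < n \<Longrightarrow> i \<le> b \<Longrightarrow> b < n \<Longrightarrow> B $$ (i,i) dvd B $$ (a,b)"
  shows "smith_upto n k B"
  using assms unfolding smith_upto_def by blast

lemma smith_upto_ops:
  assumes B: "B \<in> carrier_mat n n" and s: "smith_upto n k B" and pq: "k \<le> p" "p < n" "k \<le> q" "q < n"
  shows "p \<noteq> q \<Longrightarrow> smith_upto n k (addrow c p q B)" "p \<noteq> q \<Longrightarrow> smith_upto n k (addcol c p q B)"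
    "smith_upto n k (swaprows p q B)" "smith_upto n k (swapcols p q B)"
  by (rule smith_uptoI; use B pq smith_uptoD[OF s] in \<open>auto intro!: dvd_add dvd_mult\<close>)+

text \<open>Instead of running the Euclidean algorithm, one takes a nonzero entry \<open>d\<close>
  of least degree in the trailing blocks of all matrices with the invariant \<open>T\<close>. A
  remainder modulo \<open>d\<close> occurs again in such a block, so it must be zero.\<close>

lemma smith_step:
  fixes B :: "'a::field poly mat"
  assumes eB: "unimod_equiv n A B" and sB: "smith_upto n k B" and k: "k < n"
  shows "\<exists>C. unimod_equiv n A C \<and> smith_upto n (Suc k) C"
proof -
  define T where "T C \<longleftrightarrow> unimod_equiv n A C \<and> smith_upto n k C" for C
  have TB: "T B" using eB sB by (simp add: T_def)
  have TC: "C \<in> carrier_mat n n" if "T C" for C using that by (auto simp: T_def unimod_equiv_def)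
  have Top: "T (addrow c p q C)" "T (addcol c p q C)" if "T C" "k \<le> p" "p < n" "k \<le> q" "q < n" "p \<noteq> q" for C c p q
    using that TC[OF that(1)] by (auto simp: T_def intro: unimod_equiv_addrow unimod_equiv_addcol smith_upto_ops)
  have Tsw: "T (swaprows p q C)" "T (swapcols p q C)" if "T C" "k \<le> p" "p < n" "k \<le> q" "q < n" for C p q
    using that TC[OF that(1)] by (auto simp: T_def intro: unimod_equiv_swaprows unimod_equiv_swapcols smith_upto_ops)
  show ?thesis
  proof (cases "\<exists>a b. k \<le> a \<and> a < n \<and> k \<le> b \<and> b < n \<and> B $$ (a,b) \<noteq> 0")
    case False
    then have 0: "B $$ (a,b) = 0" if "k \<le> a" "a < n" "k \<le> b" "b < n" for a b using that by blast
    have "smith_upto n (Suc k) B"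
    proof (rule smith_uptoI)
      show "B $$ (i,j) = 0 \<and> B $$ (j,i) = 0" if "i < Suc k" "j < n" "j \<noteq> i" for i j
        using that k smith_uptoD(1,2)[OF sB, of i j] smith_uptoD(1,2)[OF sB, of j i] 0[of i j] 0[of j i]
        by (cases "i < k"; cases "j < k") auto
      show "B $$ (i,i) dvd B $$ (a,b)" if "i < Suc k" "i \<le> a" "a < n" "i \<le> b" "b < n" for i a b
        using that smith_uptoD(3)[OF sB, of i a b] 0[of a b] by (cases "i < k") auto
    qed
    then show ?thesis using eB by blast
  next
    case True
    define P where "P m \<longleftrightarrow> (\<exists>C a b. T C \<and> k \<le> a \<and> a < n \<and> k \<le> b \<and> b < n \<and> C $$ (a,b) \<noteq> 0 \<and> degree (C $$ (a,b)) = m)" for m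
    define m where "m = (LEAST m. P m)"
    have "\<exists>m. P m" using True TB unfolding P_def by blast
    then have "P m" unfolding m_def by (rule LeastI_ex)
    then obtain C0 a b where C0: "T C0" "k \<le> a" "a < n" "k \<le> b" "b < n" "C0 $$ (a,b) \<noteq> 0" "degree (C0 $$ (a,b)) = m"
      unfolding P_def by blast
    have least: "m \<le> degree (C $$ (i,j))" if "T C" "k \<le> i" "i < n" "k \<le> j" "j < n" "C $$ (i,j) \<noteq> 0" for C i j
      unfolding m_def by (rule Least_le) (use that in \<open>auto simp: P_def\<close>)
    define C1 where "C1 = swapcols k b (swaprows k a C0)"
    have C1: "T C1" unfolding C1_def using C0 k by (intro Tsw) auto
    define d where "d = C0 $$ (a,b)"
    have d: "d \<noteq> 0" "degree d = m" using C0 by (auto simp: d_def)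
    have C1d: "C1 $$ (k,k) = d" using C0 k TC[OF C0(1)] by (auto simp: C1_def d_def)
    have rem: "x = 0" if "x = (y::'a poly) mod d" "x \<noteq> 0 \<Longrightarrow> m \<le> degree x" for x y
      using degree_mod_less[OF d(1), of y] that d(2) by (metis leD)
    have dvd_col: "d dvd C $$ (i,k)" if C: "T C" "C $$ (k,k) = d" and i: "k < i" "i < n" for C i
    proof -
      let ?C = "addrow (- (C $$ (i,k) div d)) i k C"
      have "T ?C" using C i k by (intro Top) auto
      then have "?C $$ (i,k) \<noteq> 0 \<Longrightarrow> m \<le> degree (?C $$ (i,k))" using i k by (intro least) auto
      moreover have "?C $$ (i,k) = C $$ (i,k) mod d"
        using TC[OF C(1)] C(2) i k by (simp add: minus_div_mult_eq_mod[symmetric])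
      ultimately show ?thesis using rem by (metis mod_eq_0_iff_dvd)
    qed
    have dvd_row: "d dvd C $$ (k,j)" if C: "T C" "C $$ (k,k) = d" and j: "k < j" "j < n" for C j
    proof -
      let ?C = "addcol (- (C $$ (k,j) div d)) j k C"
      have "T ?C" using C j k by (intro Top) auto
      then have "?C $$ (k,j) \<noteq> 0 \<Longrightarrow> m \<le> degree (?C $$ (k,j))" using j k by (intro least) auto
      moreover have "?C $$ (k,j) = C $$ (k,j) mod d"
        using TC[OF C(1)] C(2) j k by (simp add: minus_div_mult_eq_mod[symmetric])
      ultimately show ?thesis using rem by (metis mod_eq_0_iff_dvd)
    qed
    have "\<exists>C. T C \<and> C $$ (k,k) = d \<and> (\<forall>i. k < i \<longrightarrow> i < j \<longrightarrow> C $$ (i,k) = 0)" if "j \<le> n" for j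
      using that
    proof (induction j)
      case 0
      then show ?case using C1 C1d by auto
    next
      case (Suc j)
      then obtain C where C: "T C" "C $$ (k,k) = d" "\<And>i. k < i \<Longrightarrow> i < j \<Longrightarrow> C $$ (i,k) = 0" by auto
      show ?case
      proof (cases "k < j")
        case False
        then show ?thesis using C by (intro exI[of _ C]) auto
      next
        case True
        have "d dvd C $$ (j,k)" using dvd_col[OF C(1,2) True] Suc.prems by simp
        then have "addrow (- (C $$ (j,k) div d)) j k C $$ (j,k) = 0"
          using TC[OF C(1)] C(2) True Suc.prems k by simp
        then show ?thesis using C TC[OF C(1)] True Suc.prems k
          by (intro exI[of _ "addrow (- (C $$ (j,k) div d)) j k C"]) (auto simp: less_Suc_eq intro!: Top)
      qed
    qed
    then obtain C2 where C2: "T C2" "C2 $$ (k,k) = d" "\<And>i. k < i \<Longrightarrow> i < n \<Longrightarrow> C2 $$ (i,k) = 0" by blast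
    have "\<exists>C. T C \<and> C $$ (k,k) = d \<and> (\<forall>i. k < i \<longrightarrow> i < n \<longrightarrow> C $$ (i,k) = 0) \<and>
        (\<forall>i. k < i \<longrightarrow> i < j \<longrightarrow> C $$ (k,i) = 0)" if "j \<le> n" for j
      using that
    proof (induction j)
      case 0
      then show ?case using C2 by auto
    next
      case (Suc j)
      then obtain C where C: "T C" "C $$ (k,k) = d" "\<And>i. k < i \<Longrightarrow> i < n \<Longrightarrow> C $$ (i,k) = 0"
        "\<And>i. k < i \<Longrightarrow> i < j \<Longrightarrow> C $$ (k,i) = 0" by auto
      show ?case
      proof (cases "k < j")
        case False
        then show ?thesis using C by (intro exI[of _ C]) auto
      next
        case True
        have "d dvd C $$ (k,j)" using dvd_row[OF C(1,2) True] Suc.prems by simp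
        then have "addcol (- (C $$ (k,j) div d)) j k C $$ (k,j) = 0"
          using TC[OF C(1)] C(2) True Suc.prems k by simp
        then show ?thesis using C TC[OF C(1)] True Suc.prems k
          by (intro exI[of _ "addcol (- (C $$ (k,j) div d)) j k C"]) (auto simp: less_Suc_eq intro!: Top)
      qed
    qed
    then obtain C where C: "T C" "C $$ (k,k) = d" "\<And>i. k < i \<Longrightarrow> i < n \<Longrightarrow> C $$ (i,k) = 0"
      "\<And>i. k < i \<Longrightarrow> i < n \<Longrightarrow> C $$ (k,i) = 0" by blast
    have dvd: "d dvd C $$ (i,j)" if ij: "k < i" "i < n" "k < j" "j < n" for i j
    proof -
      \<comment> \<open>Adding row \<open>i\<close> to row \<open>k\<close> keeps \<open>d\<close>
        in place because column \<open>k\<close> is cleared, and it brings the entry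
        \<open>(i,j)\<close> into row \<open>k\<close>, where \<open>dvd_row\<close>
        applies.\<close>
      have "T (addrow 1 k i C)" using C(1) ij by (intro Top) auto
      moreover have "addrow 1 k i C $$ (k,k) = d" using C ij TC[OF C(1)] k by simp
      ultimately have "d dvd addrow 1 k i C $$ (k,j)" using ij by (intro dvd_row)
      then show ?thesis using C ij TC[OF C(1)] k by simp
    qed
    have sC: "smith_upto n k C" using C(1) by (simp add: T_def)
    have "smith_upto n (Suc k) C"
    proof (rule smith_uptoI)
      show "C $$ (i,j) = 0 \<and> C $$ (j,i) = 0" if "i < Suc k" "j < n" "j \<noteq> i" for i j
        using that k smith_uptoD(1,2)[OF sC, of i j] smith_uptoD(1,2)[OF sC, of j i] C(3,4)[of j]
        by (cases "i < k"; cases "j < k") (auto simp: less_Suc_eq)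
      show "C $$ (i,i) dvd C $$ (a,b)" if "i < Suc k" "i \<le> a" "a < n" "i \<le> b" "b < n" for i a b
      proof (cases "i < k")
        case True
        then show ?thesis using that smith_uptoD(3)[OF sC True] by blast
      next
        case False
        then have "i = k" using that by simp
        then show ?thesis using that C(2-4) dvd[of a b] by (cases "a = k"; cases "b = k") auto
      qed
    qed
    then show ?thesis using C(1) by (auto simp: T_def)
  qed
qed

lemma smith_form:
  fixes A :: "'a::field poly mat"
  assumes "A \<in> carrier_mat n n"
  obtains D where "unimod_equiv n A D" "smith_upto n n D"
proof -
  have "\<exists>C. unimod_equiv n A C \<and> smith_upto n k C" if "k \<le> n" for k
    using that
  proof (induction k)
    case 0
    then show ?case using unimod_equiv_refl[OF assms] by (auto simp: smith_upto_def)
  next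
    case (Suc k)
    then show ?case using smith_step by (metis Suc_le_eq less_imp_le)
  qed
  then show ?thesis using that by blast
qed

section \<open>Minors of products and of Smith forms\<close>

text \<open>A weak form of Cauchy-Binet: the rows of \<open>U * C\<close> are combinations of rows
  of \<open>C\<close>, and multilinear expansion leaves multiples of determinants built from rows of
  \<open>C\<close>.\<close>

lemma det_mult_rows_dvd:
  fixes U :: "'a::comm_ring_1 mat"
  assumes U: "U \<in> carrier_mat m l" and C: "C \<in> carrier_mat l p"
    and d: "\<And>x. x \<in> minors k C \<Longrightarrow> d dvd x"
    and f: "\<And>i. i < k \<Longrightarrow> f i < m" and g: "\<And>j. j < k \<Longrightarrow> g j < p"
  shows "d dvd det (mat k k (\<lambda>(i,j). (U * C) $$ (f i, g j)))"
proof -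
  let ?a = "\<lambda>i c. U $$ (f i, c) \<cdot>\<^sub>v vec k (\<lambda>j. C $$ (c, g j))"
  have rows: "mat k k (\<lambda>(i,j). (U * C) $$ (f i, g j)) = mat\<^sub>r k k (\<lambda>i. finsum_vec TYPE('a) k (?a i) {0..<l})"
    using U C f g by (intro eq_matI) (auto simp: index_finsum_vec scalar_prod_def)
  have expand: "det (mat\<^sub>r k k (\<lambda>i. finsum_vec TYPE('a) k (?a i) {0..<l})) = (\<Sum>h | (\<forall>i\<in>{0..<k}. h i \<in> {0..<l}) \<and> (\<forall>i. i \<notin> {0..<k} \<longrightarrow> h i = i).
      det (mat\<^sub>r k k (\<lambda>i. ?a i (h i))))"
    by (rule det_linear_rows_sum) auto
  show ?thesis
    unfolding rows expand
  proof (rule dvd_sum)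
    fix h assume "h \<in> {h. (\<forall>i\<in>{0..<k}. h i \<in> {0..<l}) \<and> (\<forall>i. i \<notin> {0..<k} \<longrightarrow> h i = i)}"
    then have "\<forall>i\<in>{0..<k}. h i \<in> {0..<l}" by blast
    then have h: "\<And>i. i < k \<Longrightarrow> h i < l" by simp
    have "det (mat\<^sub>r k k (\<lambda>i. ?a i (h i))) =
        prod (\<lambda>i. U $$ (f i, h i)) {0..<k} * det (mat\<^sub>r k k (\<lambda>i. vec k (\<lambda>j. C $$ (h i, g j))))"
      by (rule det_rows_mul[of "\<lambda>i. vec k (\<lambda>j. C $$ (h i, g j))" k "\<lambda>i. U $$ (f i, h i)"]) auto
    moreover have "mat\<^sub>r k k (\<lambda>i. vec k (\<lambda>j. C $$ (h i, g j))) = mat k k (\<lambda>(i,j). C $$ (h i, g j))"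
      by (rule eq_matI) auto
    moreover have "d dvd det (mat k k (\<lambda>(i,j). C $$ (h i, g j)))"
      by (rule det_select_minor[where Q = "\<lambda>x. d dvd x"]) (use h g C d in auto)
    ultimately show "d dvd det (mat\<^sub>r k k (\<lambda>i. ?a i (h i)))" by simp
  qed
qed

lemma minors_mult_left_dvd:
  fixes U :: "'a::comm_ring_1 mat"
  assumes "U \<in> carrier_mat m l" "C \<in> carrier_mat l p"
    "\<And>x. x \<in> minors k C \<Longrightarrow> d dvd x" "x \<in> minors k (U * C)"
  shows "d dvd x"
proof -
  obtain I J where "x = det (mat k k (\<lambda>(i,j). (U * C) $$ (pick I i, pick J j)))"
    "I \<subseteq> {..<m}" "J \<subseteq> {..<p}" "card I = k" "card J = k"
    using assms(1,2,4) by (auto simp: minors_def submatrix_eq_mat)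
  moreover have "pick I i < b" if "I \<subseteq> {..<b}" "i < card I" for I i b
    using pick_in_set_le[OF that(2)] that(1) by auto
  ultimately show ?thesis using det_mult_rows_dvd[OF assms(1-3)] by simp
qed

lemma minors_transpose: "minors k (M\<^sup>T) = minors k (M :: 'a::comm_ring_1 mat)"
proof -
  have *: "det (submatrix M\<^sup>T J I) = det (submatrix M I J)"
    if "I \<subseteq> {..<dim_row M}" "J \<subseteq> {..<dim_col M}" "card I = k" "card J = k" for I J and M :: "'a mat"
  proof -
    have p: "pick I i < b" if "I \<subseteq> {..<b}" "i < card I" for I i b
      using pick_in_set_le[OF that(2)] that(1) by auto
    have "submatrix M I J = mat k k (\<lambda>(i,j). M $$ (pick I i, pick J j))"
      using that by (rule submatrix_eq_mat)
    moreover have "submatrix M\<^sup>T J I = mat k k (\<lambda>(i,j). M\<^sup>T $$ (pick J i, pick I j))"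
      using that by (intro submatrix_eq_mat) auto
    moreover have "mat k k (\<lambda>(i,j). M\<^sup>T $$ (pick J i, pick I j)) = mat k k (\<lambda>(i,j). M $$ (pick I j, pick J i))"
      using that p by (intro eq_matI) auto
    ultimately show ?thesis
      using det_mat_flip[of k "\<lambda>i j. M $$ (i,j)" "pick I" "pick J"] by simp
  qed
  have "minors k M\<^sup>T \<subseteq> minors k M" for M :: "'a mat"
  proof
    fix x assume "x \<in> minors k M\<^sup>T"
    then obtain I J where IJ: "I \<subseteq> {..<dim_row M}" "J \<subseteq> {..<dim_col M}" "card I = k" "card J = k"
      "x = det (submatrix M\<^sup>T J I)" unfolding minors_def by auto
    then show "x \<in> minors k M" unfolding *[OF IJ(1-4)] minors_def by blast
  qed
  from this[of M] this[of "M\<^sup>T"] show ?thesis by simp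
qed

lemma minors_mult_right_dvd:
  fixes V :: "'a::comm_ring_1 mat"
  assumes C: "C \<in> carrier_mat m l" and V: "V \<in> carrier_mat l p"
    and "\<And>x. x \<in> minors k C \<Longrightarrow> d dvd x" "x \<in> minors k (C * V)"
  shows "d dvd x"
proof (rule minors_mult_left_dvd[of "V\<^sup>T" p l "C\<^sup>T" m k])
  show "x \<in> minors k (V\<^sup>T * C\<^sup>T)"
    using assms(4) minors_transpose[of k "C * V"] transpose_mult[OF C V] by simp
qed (use assms(1-3) minors_transpose[of k C] in auto)

text \<open>The \<open>j\<close>-th smallest element of \<open>I\<close> is at least \<open>j\<close>.\<close>

lemma prod_chain_dvd:
  fixes h :: "nat \<Rightarrow> 'a::comm_ring_1"
  assumes "\<And>i j. i \<le> j \<Longrightarrow> j < n \<Longrightarrow> h i dvd h j" "finite I" "I \<subseteq> {..<n}"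
  shows "prod h {..<card I} dvd prod h I"
  using assms(2,3)
proof (induction "card I" arbitrary: I)
  case (Suc k)
  then have "I \<noteq> {}" by auto
  define x where "x = Max I"
  have x: "x \<in> I" "\<And>y. y \<in> I \<Longrightarrow> y \<le> x" using \<open>I \<noteq> {}\<close> Suc.prems by (auto simp: x_def)
  have "I \<subseteq> {..x}" using x by auto
  then have "card I \<le> Suc x" using card_mono[of "{..x}" I] by simp
  then have "k \<le> x" using Suc.hyps(2) by simp
  then have "h k dvd h x" using x(1) Suc.prems assms(1) by auto
  moreover have "prod h {..<card (I - {x})} dvd prod h (I - {x})"
    using Suc.hyps Suc.prems x(1) by (intro Suc.hyps(1)) auto
  moreover have "card (I - {x}) = k" using Suc.hyps(2) Suc.prems x(1) by simp
  moreover have "prod h I = h x * prod h (I - {x})" using Suc.prems x(1) by (simp add: prod.remove)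
  ultimately show ?case unfolding Suc.hyps(2)[symmetric]
    by (simp add: mult_dvd_mono mult.commute)
qed simp

text \<open>A Leibniz term survives only if every factor sits on the diagonal of \<open>D\<close>;
  it is then the product of the diagonal entries over \<open>I\<close>, to which
  \<open>prod_chain_dvd\<close> applies.\<close>

lemma smith_minors_dvd:
  fixes D :: "'a::comm_ring_1 mat"
  assumes D: "D \<in> carrier_mat n n" "smith_upto n n D" and x: "x \<in> minors k D"
  shows "(\<Prod>i<k. D $$ (i,i)) dvd x"
proof -
  obtain I J where IJ: "I \<subseteq> {..<n}" "J \<subseteq> {..<n}" "card I = k" "card J = k" and
    xd: "x = det (submatrix D I J)"
    using x D(1) by (auto simp: minors_def)
  have sub: "submatrix D I J = mat k k (\<lambda>(i,j). D $$ (pick I i, pick J j))"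
    using IJ D(1) by (intro submatrix_eq_mat) auto
  have p: "pick S i \<in> S" if "i < card S" for S i
    using pick_in_set_le[OF that] .
  have fin: "finite I" using IJ finite_subset by blast
  have "(\<Prod>i<k. D $$ (i,i)) dvd (\<Sum>s | s permutes {0..<k}. signof s * (\<Prod>i = 0..<k. submatrix D I J $$ (i, s i)))"
  proof (intro dvd_sum dvd_mult)
    fix s assume "s \<in> {s. s permutes {0..<k}}"
    then have s: "s i < k" if "i < k" for i using that permutes_in_image[of s "{0..<k}" i] by simp
    show "(\<Prod>i<k. D $$ (i,i)) dvd (\<Prod>i = 0..<k. submatrix D I J $$ (i, s i))"
    proof (cases "\<exists>i<k. pick I i \<noteq> pick J (s i)")
      case True
      then obtain i where i: "i < k" "pick I i \<noteq> pick J (s i)" by blast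
      have "submatrix D I J $$ (i, s i) = 0"
        using i s[OF i(1)] p[of i I] p[of "s i" J] IJ smith_uptoD(1)[OF D(2), of "pick I i" "pick J (s i)"]
        by (auto simp: sub)
      then have "(\<Prod>i = 0..<k. submatrix D I J $$ (i, s i)) = 0"
        using i(1) by (intro prod_zero) auto
      then show ?thesis by simp
    next
      case False
      have "(\<Prod>i = 0..<k. submatrix D I J $$ (i, s i)) = (\<Prod>i\<in>{0..<k}. D $$ (pick I i, pick I i))"
        using False s by (intro prod.cong) (auto simp: sub)
      also have "\<dots> = (\<Prod>i\<in>I. D $$ (i,i))"
      proof -
        have inj: "inj_on (pick I) {0..<k}"
          by (rule inj_onI) (use pick_mono_le[of _ I] IJ in \<open>metis atLeastLessThan_iff linorder_neqE_nat less_irrefl\<close>)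
        moreover have "pick I ` {0..<k} = I"
          using inj IJ fin p[of _ I] by (intro card_subset_eq) (auto simp: card_image)
        ultimately show ?thesis using prod.reindex[OF inj, of "\<lambda>i. D $$ (i,i)"] by simp
      qed
      finally show ?thesis
        using prod_chain_dvd[of n "\<lambda>i. D $$ (i,i)" I] smith_uptoD(3)[OF D(2)] IJ fin by auto
    qed
  qed
  then show ?thesis unfolding xd using det_def'[of "submatrix D I J" k] sub by simp
qed

section \<open>Raising the normal rank of a perturbation\<close>

lemma (in vec_space) rank_le_sum_outer:
  assumes "finite E" "M \<in> carrier_mat n nc"
    and "\<And>i j. i < n \<Longrightarrow> j < nc \<Longrightarrow> M $$ (i,j) = (\<Sum>e\<in>E. f e i * g e j)"
  shows "rank M \<le> card E"
  using assms
proof (induction E arbitrary: M rule: finite_induct)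
  case empty
  then have "M = 0\<^sub>m n nc" by (intro eq_matI) auto
  then show ?case by (simp add: rank_0I)
next
  case (insert e E)
  let ?M1 = "mat n nc (\<lambda>(i,j). \<Sum>e\<in>E. f e i * g e j)" and ?M2 = "mat n nc (\<lambda>(i,j). f e i * g e j)"
  have "M = ?M2 + ?M1" using insert by (intro eq_matI) auto
  moreover have "rank ?M1 \<le> card E" by (rule insert.IH) auto
  moreover have "rank ?M2 \<le> 1" by (rule rank_le_1_product_entries[of _ nc "f e" "g e"]) auto
  ultimately show ?case using rank_subadditive[of ?M2 nc ?M1] insert.hyps by auto
qed

lemma outer_mult_vec:
  fixes v x z :: "'a::comm_ring_1 vec"
  assumes "z \<in> carrier_vec n" "x \<in> carrier_vec n" "v \<in> carrier_vec n"
  shows "mat n n (\<lambda>(i,j). x $ i * v $ j) *\<^sub>v z = (v \<bullet> z) \<cdot>\<^sub>v x"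
  using assms by (intro eq_vecI) (auto simp: scalar_prod_def sum_distrib_left sum_distrib_right mult_ac)

text \<open>The new column space contains \<open>x\<close>, as the image of a multiple of
  \<open>w\<close>, and it contains the columns of \<open>P\<close>, after correcting unit vectors
  by multiples of \<open>w\<close>. The vector \<open>y\<close> separates \<open>x\<close> from the
  column space of \<open>P\<close>.\<close>

lemma (in vec_space) rank_add_outer:
  assumes P: "P \<in> carrier_mat n n" and w: "w \<in> carrier_vec n" "P *\<^sub>v w = 0\<^sub>v n"
    and y: "y \<in> carrier_vec n" "P\<^sup>T *\<^sub>v y = 0\<^sub>v n"
    and v: "v \<in> carrier_vec n" "v \<bullet> w \<noteq> 0" and x: "x \<in> carrier_vec n" "y \<bullet> x \<noteq> 0"
  shows "rank (P + mat n n (\<lambda>(i,j). x $ i * v $ j)) = Suc (rank P)"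
proof (rule antisym)
  let ?O = "mat n n (\<lambda>(i,j). x $ i * v $ j)"
  have "rank ?O \<le> 1" by (rule rank_le_1_product_entries[of _ n "\<lambda>i. x $ i" "\<lambda>j. v $ j"]) auto
  then show "rank (P + ?O) \<le> Suc (rank P)" using rank_subadditive[OF P, of ?O] by auto
  let ?W = "span (set (cols (P + ?O)))"
  have O: "?O \<in> carrier_mat n n" and PO: "P + ?O \<in> carrier_mat n n" using P by auto
  have POz: "(P + ?O) *\<^sub>v z = P *\<^sub>v z + (v \<bullet> z) \<cdot>\<^sub>v x" if "z \<in> carrier_vec n" for z
    using add_mult_distrib_mat_vec[OF P O that] outer_mult_vec[OF that x(1) v(1)] by simp
  have W: "?W = {y \<in> carrier_vec n. \<exists>z\<in>carrier_vec n. (P + ?O) *\<^sub>v z = y}"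
    using col_space_eq[OF PO] unfolding col_space_def carrier_matD[OF PO] .
  have Wc: "(P + ?O) *\<^sub>v z \<in> ?W" if "z \<in> carrier_vec n" for z
    unfolding W using that mult_mat_vec_carrier[OF PO that] by blast
  have xW: "x \<in> ?W"
  proof -
    have "(P + ?O) *\<^sub>v ((1 / (v \<bullet> w)) \<cdot>\<^sub>v w) = x"
      using POz[of "(1 / (v \<bullet> w)) \<cdot>\<^sub>v w"] w x(1) v P by (simp add: mult_mat_vec)
    then show ?thesis using Wc[of "(1 / (v \<bullet> w)) \<cdot>\<^sub>v w"] w by simp
  qed
  have PW: "set (cols P) \<subseteq> ?W"
  proof
    fix c assume "c \<in> set (cols P)"
    then obtain j where j: "j < n" "c = col P j"
      using P by (auto simp: in_set_conv_nth cols_nth)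
    \<comment> \<open>The multiple of \<open>w\<close> makes \<open>?z\<close> orthogonal to
      \<open>v\<close> and does not change its image under \<open>P\<close>.\<close>
    let ?z = "unit_vec n j - (v $ j / (v \<bullet> w)) \<cdot>\<^sub>v w"
    have z: "?z \<in> carrier_vec n" using w by simp
    have "P *\<^sub>v ?z = P *\<^sub>v unit_vec n j - P *\<^sub>v ((v $ j / (v \<bullet> w)) \<cdot>\<^sub>v w)"
      using P w by (intro mult_minus_distrib_mat_vec) auto
    also have "\<dots> = c"
    proof -
      have "P *\<^sub>v unit_vec n j = c" using P j by (intro eq_vecI) (auto simp: scalar_prod_right_unit)
      moreover have "P *\<^sub>v ((v $ j / (v \<bullet> w)) \<cdot>\<^sub>v w) = 0\<^sub>v n"
        using P w by (simp add: mult_mat_vec)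
      ultimately show ?thesis using P j by simp
    qed
    finally have "P *\<^sub>v ?z = c" .
    moreover have "v \<bullet> ?z = 0"
      using v w j(1) by (simp add: scalar_prod_minus_distrib[of _ n])
    ultimately have "(P + ?O) *\<^sub>v ?z = c" using POz[OF z] x(1) j P by simp
    then show "c \<in> ?W" using Wc[OF z] by simp
  qed
  have carr: "set (cols P) \<subseteq> carrier_vec n" using P cols_dim by blast
  have xn: "x \<notin> span (set (cols P))"
  proof
    assume "x \<in> span (set (cols P))"
    then obtain z where z: "z \<in> carrier_vec n" "P *\<^sub>v z = x"
      using col_space_eq[OF P] P unfolding col_space_def by auto
    have "y \<bullet> (P *\<^sub>v z) = (P\<^sup>T *\<^sub>v y) \<bullet> z"
      using transpose_vec_mult_scalar[OF P z(1) y(1)] P y z by (simp add: comm_scalar_prod[of _ n])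
    with z y x show False by simp
  qed
  obtain U where U: "maximal U (\<lambda>T. T \<subseteq> set (cols P) \<and> lin_indpt T)"
    using maximal_exists[of "(\<lambda>T. T \<subseteq> set (cols P) \<and> lin_indpt T)" "card (set (cols P))" "{}"]
    by (meson List.finite_set card_mono empty_iff empty_subsetI finite_lin_indpt2 rev_finite_subset)
  then have Uc: "U \<subseteq> set (cols P)" and Ul: "lin_indpt U" by (auto simp: maximal_def)
  have rk: "rank P = card U" by (rule rank_card_indpt[OF P U])
  have xU: "x \<notin> span U" using xn span_is_monotone[OF Uc] by blast
  have U_car: "U \<subseteq> carrier_vec n" using Uc carr by blast
  then have xU': "x \<notin> U" using xU in_own_span[of U] by auto
  have "lin_indpt (U \<union> {x})"
    using lin_dep_iff_in_span[OF _ Ul _ xU'] U_car x(1) xU by simp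
  moreover have sub: "U \<union> {x} \<subseteq> ?W" using xW PW Uc by blast
  moreover have POcar: "set (cols (P + ?O)) \<subseteq> carrier_vec n"
    using cols_dim[of "P + ?O"] unfolding carrier_matD[OF PO] .
  moreover have subm: "submodule class_ring ?W V" using POcar by (intro span_is_submodule) auto
  ultimately have li: "LinearCombinations.module.lin_indpt class_ring (vs ?W) (U \<union> {x})"
    using span_li_not_depend(2)[OF sub subm] by simp
  interpret W: vectorspace class_ring "vs ?W"
    using subspace_is_vs span_is_subspace POcar by auto
  have "card (U \<union> {x}) \<le> W.dim"
    by (rule W.li_le_dim(2)[OF fin_dim_span_cols[OF PO] _ li]) (use sub in auto)
  then show "Suc (rank P) \<le> rank (P + ?O)"
    using rk xU' finite_subset[OF Uc] by (simp add: rank_def)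
qed

lemma normal_rank_eq: "G \<in> carrier_mat n m \<Longrightarrow> normal_rank G = vec_space.rank n (map_mat to_fract G)"
  by (simp add: normal_rank_def mat_rank_def)

lemma normal_rank_add_outer:
  fixes A B B' :: "'a::field poly mat"
  assumes c: "A \<in> carrier_mat n n" "B \<in> carrier_mat n n" "B' \<in> carrier_mat n n"
    and w: "w \<in> carrier_vec n" "map_mat to_fract (B - A) *\<^sub>v w = 0\<^sub>v n"
    and y: "y \<in> carrier_vec n" "(map_mat to_fract (B - A))\<^sup>T *\<^sub>v y = 0\<^sub>v n"
    and v: "v \<in> carrier_vec n" "v \<bullet> w \<noteq> 0" and x: "x \<in> carrier_vec n" "y \<bullet> x \<noteq> 0"
    and B': "\<And>i j. i < n \<Longrightarrow> j < n \<Longrightarrow> to_fract (B' $$ (i,j)) = to_fract (B $$ (i,j)) + x $ i * v $ j"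
  shows "normal_rank (B' - A) = Suc (normal_rank (B - A))"
proof -
  have "map_mat to_fract (B' - A) = map_mat to_fract (B - A) + mat n n (\<lambda>(i,j). x $ i * v $ j)"
    using c by (intro eq_matI) (auto simp: B' to_fract_diff)
  moreover have d: "B' - A \<in> carrier_mat n n" "B - A \<in> carrier_mat n n"
    using c(1) by (rule minus_carrier_mat)+
  moreover have P: "map_mat to_fract (B - A) \<in> carrier_mat n n" using d by simp
  ultimately show ?thesis
    using vec_space.rank_add_outer[OF P w y v x] by (simp add: normal_rank_eq)
qed

lemma addcol_carrier: "A \<in> carrier_mat n m \<Longrightarrow> addcol a k l A \<in> carrier_mat n m"
  by (intro carrier_matI) auto

text \<open>
  Multiplying \<open>B\<close> on the right by \<open>1 + u v\<^sup>T\<close> with \<open>v \<bullet> u = 0\<close> keeps the determinant and adds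
  \<open>(B u) v\<^sup>T\<close> to \<open>B - A\<close>. The rank goes up if \<open>v\<close> does not vanish on the kernel vector \<open>w\<close> and
  \<open>B u\<close> is not annihilated by the left kernel vector \<open>y\<close>. If \<open>u = e\<^sub>i\<close>, \<open>v = e\<^sub>j\<close> with \<open>i \<noteq> j\<close> is not
  possible, then \<open>u = e\<^sub>i + e\<^sub>k\<close>, \<open>v = e\<^sub>i - e\<^sub>k\<close> is.
\<close>

lemma raise_normal_rank:
  fixes A B :: "'a::field poly mat"
  assumes n: "n \<ge> 2" and A: "matrix_pencil n n A" and B: "matrix_pencil n n B" and dB: "det B \<noteq> 0"
    and rk: "normal_rank (B - A) < n"
  shows "\<exists>B'. matrix_pencil n n B' \<and> det B' = det B \<and> normal_rank (B' - A) = Suc (normal_rank (B - A))"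
proof -
  interpret h: inj_comm_ring_hom "to_fract :: 'a poly \<Rightarrow> 'a poly fract" by (unfold_locales, auto)
  let ?Bf = "map_mat to_fract B" and ?P = "map_mat to_fract (B - A)"
  have Ac: "A \<in> carrier_mat n n" and Bc: "B \<in> carrier_mat n n" using A B by (auto simp: matrix_pencil_def)
  then have P: "?P \<in> carrier_mat n n" and PT: "?P\<^sup>T \<in> carrier_mat n n" by auto
  have "det ?P = 0"
    using rk vec_space.det_rank_iff[OF P] normal_rank_eq[OF minus_carrier_mat[OF Ac]] by auto
  then obtain w where w: "w \<in> carrier_vec n" "w \<noteq> 0\<^sub>v n" "?P *\<^sub>v w = 0\<^sub>v n"
    using det_0_iff_vec_prod_zero_field[OF P] by blast
  have "det ?P\<^sup>T = 0" using \<open>det ?P = 0\<close> det_transpose[OF P] by simp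
  then obtain y where y: "y \<in> carrier_vec n" "y \<noteq> 0\<^sub>v n" "?P\<^sup>T *\<^sub>v y = 0\<^sub>v n"
    using det_0_iff_vec_prod_zero_field[OF PT] by blast
  have Bfc: "?Bf \<in> carrier_mat n n" using Bc by simp
  then have BfT: "?Bf\<^sup>T \<in> carrier_mat n n" by simp
  have "det ?Bf\<^sup>T \<noteq> 0" using det_transpose[OF Bfc] dB by simp
  then have "?Bf\<^sup>T *\<^sub>v y \<noteq> 0\<^sub>v n" using det_0_iff_vec_prod_zero_field[OF BfT] y by blast
  then obtain i where i: "i < n" "(?Bf\<^sup>T *\<^sub>v y) $ i \<noteq> 0" using BfT by (metis dim_mult_mat_vec carrier_matD(1) eq_vecI index_zero_vec)
  have yB: "(?Bf\<^sup>T *\<^sub>v y) $ k = y \<bullet> col ?Bf k" if "k < n" for k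
    using that Bc y(1) by (simp add: comm_scalar_prod[of _ n])
  obtain j where j: "j < n" "w $ j \<noteq> 0" using w by (metis carrier_vecD eq_vecI index_zero_vec)
  have colc: "col ?Bf k \<in> carrier_vec n" if "k < n" for k using that Bc by auto
  have deg: "degree (B $$ (a,b)) \<le> 1" if "a < n" "b < n" for a b using B that by (simp add: matrix_pencil_def)
  show ?thesis
  proof (cases "\<exists>i j. i < n \<and> j < n \<and> i \<noteq> j \<and> y \<bullet> col ?Bf i \<noteq> 0 \<and> w $ j \<noteq> 0")
    case True
    then obtain i j where ij: "i < n" "j < n" "i \<noteq> j" "y \<bullet> col ?Bf i \<noteq> 0" "w $ j \<noteq> 0" by blast
    let ?B' = "addcol 1 j i B"
    have B'c: "?B' \<in> carrier_mat n n" using Bc by (intro carrier_matI) auto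
    have "normal_rank (?B' - A) = Suc (normal_rank (B - A))"
      by (rule normal_rank_add_outer[OF Ac Bc B'c w(1,3) y(1,3), of "unit_vec n j" "col ?Bf i"])
        (use ij w Bc colc in \<open>auto simp: to_fract_add\<close>)
    moreover have "det ?B' = det B" using ij Bc by (simp add: det_addcol)
    moreover have "matrix_pencil n n ?B'"
      using B'c Bc deg ij by (auto simp: matrix_pencil_def intro!: degree_add_le)
    ultimately show ?thesis by blast
  next
    case False
    then have yk: "y \<bullet> col ?Bf k = 0" if "k < n" "k \<noteq> j" for k using that j by blast
    \<comment> \<open>Failure of the first case leaves a single index at which
      \<open>y\<^sup>T B\<close> and \<open>w\<close> do not vanish.\<close>
    have "i = j" using i yB[OF i(1)] yk[OF i(1)] by auto
    have wk: "w $ k = 0" if "k < n" "k \<noteq> i" for k using that False i yB[OF i(1)] by auto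
    obtain k where k: "k < n" "k \<noteq> i" using n by (metis One_nat_def Suc_1 Suc_le_eq less_trans zero_less_one_class.zero_less_one zero_neq_one)
    \<comment> \<open>Three elementary column operations, each of determinant one, whose product is
      \<open>1 + (e_i + e_k) (e_i - e_k)\<^sup>T\<close>.\<close>
    let ?B' = "addcol (-1) i k (addcol (-1) k i (addcol 1 i k B))"
    have B'c: "?B' \<in> carrier_mat n n" using Bc by (intro carrier_matI) auto
    have ent: "?B' $$ (a,b) = B $$ (a,b) + (B $$ (a,i) + B $$ (a,k)) * (if b = i then 1 else if b = k then -1 else 0)"
      if "a < n" "b < n" for a b
      using that Bc i(1) k by (auto simp: algebra_simps)
    have "normal_rank (?B' - A) = Suc (normal_rank (B - A))"
    proof (rule normal_rank_add_outer[OF Ac Bc B'c w(1,3) y(1,3), of "unit_vec n i - unit_vec n k" "col ?Bf i + col ?Bf k"])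
      show "(unit_vec n i - unit_vec n k) \<bullet> w \<noteq> 0"
        using w i(1) k wk[OF k] j \<open>i = j\<close> by (simp add: minus_scalar_prod_distrib[of _ n])
      show "y \<bullet> (col ?Bf i + col ?Bf k) \<noteq> 0"
        using y i k yB[OF i(1)] yk[OF k(1)] \<open>i = j\<close> colc by (simp add: scalar_prod_add_distrib[of _ n])
      show "to_fract (?B' $$ (a,b)) = to_fract (B $$ (a,b)) + (col ?Bf i + col ?Bf k) $ a * (unit_vec n i - unit_vec n k) $ b"
        if "a < n" "b < n" for a b
        unfolding ent[OF that] using that Bc i(1) k by (auto simp: to_fract_add to_fract_uminus to_fract_mult)
    qed (use colc i k in auto)
    moreover have "det ?B' = det B"
      using i(1) k Bc det_addcol[of _ n] by (simp add: addcol_carrier)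
    moreover have "matrix_pencil n n ?B'"
      unfolding matrix_pencil_def
    proof (intro conjI allI impI B'c)
      fix a b assume ab: "a < n" "b < n"
      show "degree (?B' $$ (a,b)) \<le> 1"
        unfolding ent[OF ab]
      proof (intro degree_add_le deg ab)
        have scale: "degree (p * (if b = i then 1 else if b = k then -1 else 0)) \<le> 1"
          if "degree p \<le> 1" for p :: "'a poly" using that by auto
        show "degree ((B $$ (a,i) + B $$ (a,k)) * (if b = i then 1 else if b = k then -1 else 0)) \<le> 1"
          by (intro scale degree_add_le deg ab i(1) k(1))
      qed
    qed
    ultimately show ?thesis by blast
  qed
qed

lemma attain_normal_rank:
  fixes A B :: "'a::field poly mat"
  assumes n: "n \<ge> 2" and A: "matrix_pencil n n A" and B: "matrix_pencil n n B" and dB: "det B \<noteq> 0"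
    and r: "normal_rank (B - A) \<le> r" "r \<le> n"
  shows "\<exists>B'. matrix_pencil n n B' \<and> det B' = det B \<and> normal_rank (B' - A) = r"
  using r
proof (induction rule: dec_induct)
  case base
  then show ?case using B by blast
next
  case (step m)
  then obtain B' where B': "matrix_pencil n n B'" "det B' = det B" "normal_rank (B' - A) = m" by auto
  then show ?case using raise_normal_rank[OF n A B'(1)] dB step.prems by auto
qed

section \<open>Pole assignment\<close>

definition inverse_pair :: "nat \<Rightarrow> 'a::semiring_1 mat \<Rightarrow> 'a mat \<Rightarrow> bool" where
  "inverse_pair n S S' \<longleftrightarrow> S \<in> carrier_mat n n \<and> S' \<in> carrier_mat n n \<and> S * S' = 1\<^sub>m n \<and> S' * S = 1\<^sub>m n"

lemma inverse_pair_one: "inverse_pair n (1\<^sub>m n) (1\<^sub>m n)"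
  by (simp add: inverse_pair_def)

lemma inverse_pair_mult:
  fixes S :: "'a::comm_ring_1 mat"
  assumes "inverse_pair n S S'" "inverse_pair n G G'"
  shows "inverse_pair n (S * G) (G' * S')"
  using assms unfolding inverse_pair_def
  by (auto simp: assoc_mult_mat[of _ n n _ n _ n] mat_inverse_cancel[of _ n])

text \<open>Membership in the span of the first \<open>m\<close> unit vectors, the form that
  \<open>K\<close> takes in an adapted basis.\<close>

definition supp_below :: "nat \<Rightarrow> nat \<Rightarrow> 'a::zero vec \<Rightarrow> bool" where
  "supp_below n m z \<longleftrightarrow> z \<in> carrier_vec n \<and> (\<forall>a. m \<le> a \<longrightarrow> a < n \<longrightarrow> z $ a = 0)"

lemma supp_below_mono: "supp_below n m z \<Longrightarrow> m \<le> m' \<Longrightarrow> supp_below n m' z"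
  by (auto simp: supp_below_def)

lemma supp_below_unit: "j < m \<Longrightarrow> supp_below n m (unit_vec n j :: 'a::zero_neq_one vec)"
  by (auto simp: supp_below_def unit_vec_def)

lemma mult_unit_vec: "(A :: 'a::semiring_1 mat) \<in> carrier_mat n m \<Longrightarrow> j < m \<Longrightarrow> A *\<^sub>v unit_vec m j = col A j"
  by (intro eq_vecI) (auto simp: scalar_prod_right_unit)

text \<open>\<open>H\<close> is the identity with column \<open>m\<close> replaced by
  \<open>y\<close>; the nonzero pivot \<open>y $ m\<close> makes it invertible.\<close>

lemma basis_exchange_pivot:
  fixes y :: "'a::field vec"
  assumes y: "y \<in> carrier_vec n" and m: "m < n" "y $ m \<noteq> 0"
  shows "\<exists>H H'. inverse_pair n H H' \<and> (\<forall>z. supp_below n m z \<longrightarrow> H *\<^sub>v z = z) \<and> H *\<^sub>v unit_vec n m = y"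
proof -
  define H where "H = mat n n (\<lambda>(a,b). if b = m then y $ a else if a = b then 1 else 0)"
  define H' where "H' = mat n n (\<lambda>(a,b). if b = m then (if a = m then 1 / y $ m else - y $ a / y $ m) else if a = b then 1 else (0::'a))"
  have Hc: "H \<in> carrier_mat n n" "H' \<in> carrier_mat n n" by (simp_all add: H_def H'_def)
  have two: "(\<Sum>c = 0..<n. h c) = h m + (if a = m then 0 else h a)"
    if "a < n" "\<And>c. c < n \<Longrightarrow> c \<noteq> m \<Longrightarrow> c \<noteq> a \<Longrightarrow> h c = 0" for a and h :: "nat \<Rightarrow> 'a"
  proof -
    have "(\<Sum>c = 0..<n. h c) = (\<Sum>c\<in>{m,a}. h c)"
      using that m by (intro sum.mono_neutral_right) auto
    then show ?thesis by auto
  qed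
  have "H * H' = 1\<^sub>m n"
  proof (rule eq_matI)
    fix a b assume "a < dim_row (1\<^sub>m n :: 'a mat)" "b < dim_col (1\<^sub>m n :: 'a mat)"
    then have ab: "a < n" "b < n" by auto
    have "(H * H') $$ (a,b) = (\<Sum>c = 0..<n. H $$ (a,c) * H' $$ (c,b))"
      using Hc ab by (simp add: scalar_prod_def)
    also have "\<dots> = H $$ (a,m) * H' $$ (m,b) + (if a = m then 0 else H $$ (a,a) * H' $$ (a,b))"
      by (rule two) (use ab in \<open>auto simp: H_def\<close>)
    also have "\<dots> = 1\<^sub>m n $$ (a,b)"
      using ab m by (auto simp: H_def H'_def)
    finally show "(H * H') $$ (a,b) = 1\<^sub>m n $$ (a,b)" .
  qed (use Hc in auto)
  moreover have "H' * H = 1\<^sub>m n"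
    by (rule mat_mult_left_right_inverse[OF Hc \<open>H * H' = 1\<^sub>m n\<close>])
  moreover have "H *\<^sub>v z = z" if "supp_below n m z" for z
  proof (rule eq_vecI)
    have z: "z \<in> carrier_vec n" "z $ m = 0" using that m by (auto simp: supp_below_def)
    fix a assume "a < dim_vec z"
    then have a: "a < n" using z by simp
    have "(H *\<^sub>v z) $ a = (\<Sum>c = 0..<n. H $$ (a,c) * z $ c)"
      using Hc a z by (simp add: scalar_prod_def)
    also have "\<dots> = H $$ (a,m) * z $ m + (if a = m then 0 else H $$ (a,a) * z $ a)"
      by (rule two) (use a in \<open>auto simp: H_def\<close>)
    finally show "(H *\<^sub>v z) $ a = z $ a" using z a by (auto simp: H_def)
  qed (use that Hc in \<open>auto simp: supp_below_def\<close>)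
  moreover have "H *\<^sub>v unit_vec n m = y"
    using y m by (simp add: mult_unit_vec[OF Hc(1)]) (auto simp: H_def intro!: eq_vecI)
  ultimately show ?thesis using Hc unfolding inverse_pair_def by blast
qed

text \<open>A swap of two coordinates, both at least \<open>m\<close>, first brings a nonzero entry
  of \<open>y\<close> to position \<open>m\<close>. Such a swap fixes the span of the first
  \<open>m\<close> unit vectors.\<close>

lemma basis_exchange:
  fixes y :: "'a::field vec"
  assumes y: "y \<in> carrier_vec n" and ns: "\<not> supp_below n m y"
  shows "\<exists>G G'. inverse_pair n G G' \<and> (\<forall>z. supp_below n m z \<longrightarrow> G *\<^sub>v z = z \<and> G' *\<^sub>v z = z) \<and>
     G' *\<^sub>v y = unit_vec n m \<and> m < n"
proof -
  obtain i where i: "m \<le> i" "i < n" "y $ i \<noteq> 0" using assms by (auto simp: supp_below_def)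
  let ?W = "swaprows_mat n m i :: 'a mat"
  have m: "m < n" using i by simp
  have Wp: "inverse_pair n ?W ?W" using swaprows_mat_inv[OF m i(2)] by (simp add: inverse_pair_def)
  have Wz: "?W *\<^sub>v z = vec n (\<lambda>a. z $ (if a = m then i else if a = i then m else a))" if "z \<in> carrier_vec n" for z
  proof (rule eq_vecI)
    fix a assume "a < dim_vec (vec n (\<lambda>a. z $ (if a = m then i else if a = i then m else a)))"
    then have a: "a < n" by simp
    have "row ?W a = unit_vec n (if a = m then i else if a = i then m else a)"
      using a m i by (intro eq_vecI) (auto simp: swaprows_mat_def)
    then show "(?W *\<^sub>v z) $ a = vec n (\<lambda>a. z $ (if a = m then i else if a = i then m else a)) $ a"
      using a m i that by (auto simp: scalar_prod_left_unit)
  qed (simp add: swaprows_mat_def)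
  have Wy: "?W *\<^sub>v y \<in> carrier_vec n" "(?W *\<^sub>v y) $ m \<noteq> 0" using Wz[OF y] m i by auto
  obtain H H' where H: "inverse_pair n H H'" "\<And>z. supp_below n m z \<Longrightarrow> H *\<^sub>v z = z" "H *\<^sub>v unit_vec n m = ?W *\<^sub>v y"
    using basis_exchange_pivot[OF Wy(1) m Wy(2)] by blast
  have P: "inverse_pair n (?W * H) (H' * ?W)" by (rule inverse_pair_mult[OF Wp H(1)])
  have c: "?W \<in> carrier_mat n n" "H \<in> carrier_mat n n" "H' \<in> carrier_mat n n"
    using H(1) Wp by (auto simp: inverse_pair_def)
  have cancel: "(H' * ?W) *\<^sub>v ((?W * H) *\<^sub>v z) = z" if "z \<in> carrier_vec n" for z
  proof -
    have "((H' * ?W) * (?W * H)) *\<^sub>v z = (H' * ?W) *\<^sub>v ((?W * H) *\<^sub>v z)"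
      by (rule assoc_mult_mat_vec[of _ n n _ n]) (use c that in auto)
    then show ?thesis using P that by (simp add: inverse_pair_def)
  qed
  have WH: "(?W * H) *\<^sub>v z = ?W *\<^sub>v (H *\<^sub>v z)" if "z \<in> carrier_vec n" for z
    by (rule assoc_mult_mat_vec[of _ n n _ n]) (use c that in auto)
  have fixd: "(?W * H) *\<^sub>v z = z" if z: "supp_below n m z" for z
  proof -
    have zc: "z \<in> carrier_vec n" using z by (simp add: supp_below_def)
    show ?thesis
      unfolding WH[OF zc] H(2)[OF z] Wz[OF zc]
      using z i m by (intro eq_vecI) (auto simp: supp_below_def)
  qed
  have "(?W * H) *\<^sub>v unit_vec n m = ?W *\<^sub>v (?W *\<^sub>v y)" using H(3) WH by simp
  also have "\<dots> = (?W * ?W) *\<^sub>v y" by (rule assoc_mult_mat_vec[symmetric, of _ n n _ n]) (use c y in auto)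
  also have "\<dots> = y" using Wp y by (simp add: inverse_pair_def)
  finally have Gm: "(?W * H) *\<^sub>v unit_vec n m = y" .
  have "(H' * ?W) *\<^sub>v y = unit_vec n m" using cancel[of "unit_vec n m"] Gm by simp
  moreover have "(H' * ?W) *\<^sub>v z = z" if "supp_below n m z" for z
    using cancel[of z] fixd[OF that] that by (simp add: supp_below_def)
  ultimately show ?thesis using P fixd m by blast
qed

text \<open>
  The first \<open>m\<close> unit vectors form shift chains, and \<open>E\<close> marks the ends of the chains. A
  perturbation of the columns in \<open>E\<close> can link the chains to a single one.
\<close>

definition flag :: "nat \<Rightarrow> 'a::field mat \<Rightarrow> nat \<Rightarrow> nat set \<Rightarrow> bool" where
  "flag n T m E \<longleftrightarrow> m \<le> n \<and> E \<subseteq> {..<m} \<and>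
     (\<forall>j<m. if j \<in> E then supp_below n m (T *\<^sub>v unit_vec n j)
            else Suc j < m \<and> T *\<^sub>v unit_vec n j = unit_vec n (Suc j))"

text \<open>The last chain is still growing: nothing is required of the image of the unit vector
  \<open>m - 1\<close>.\<close>

definition open_flag :: "nat \<Rightarrow> 'a::field mat \<Rightarrow> nat \<Rightarrow> nat set \<Rightarrow> bool" where
  "open_flag n T m E \<longleftrightarrow> 0 < m \<and> m \<le> n \<and> E \<subseteq> {..<m - 1} \<and>
     (\<forall>j<m - 1. if j \<in> E then supp_below n m (T *\<^sub>v unit_vec n j)
            else T *\<^sub>v unit_vec n j = unit_vec n (Suc j))"

lemma conj_mult_unit_vec:
  fixes T :: "'a::field mat"
  assumes "inverse_pair n G G'" "T \<in> carrier_mat n n" "\<And>z. supp_below n m z \<Longrightarrow> G *\<^sub>v z = z" "j < m"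
  shows "(G' * T * G) *\<^sub>v unit_vec n j = G' *\<^sub>v (T *\<^sub>v unit_vec n j)"
proof -
  have c: "G \<in> carrier_mat n n" "G' \<in> carrier_mat n n" using assms(1) by (auto simp: inverse_pair_def)
  have "(G' * T * G) *\<^sub>v unit_vec n j = (G' * T) *\<^sub>v (G *\<^sub>v unit_vec n j)"
    by (rule assoc_mult_mat_vec[of _ n n _ n]) (use c assms(2) in auto)
  also have "G *\<^sub>v unit_vec n j = unit_vec n j" using assms(3,4) supp_below_unit by blast
  also have "(G' * T) *\<^sub>v unit_vec n j = G' *\<^sub>v (T *\<^sub>v unit_vec n j)"
    by (rule assoc_mult_mat_vec[of _ n n _ n]) (use c assms(2) in auto)
  finally show ?thesis .
qed

text \<open>As long as the image of the last vector leaves the span, a change of basis fixing the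
  span makes it the next unit vector, and \<open>n - m\<close> decreases. Once the image falls into
  the span, the chain is closed at the cost of one more element of \<open>E\<close>.\<close>

lemma close_flag:
  fixes T :: "'a::field mat"
  assumes "T \<in> carrier_mat n n" "open_flag n T m E"
  shows "\<exists>G G' m' E'. inverse_pair n G G' \<and> flag n (G' * T * G) m' E' \<and> m \<le> m' \<and> card E' \<le> Suc (card E) \<and>
     (\<forall>z. supp_below n m z \<longrightarrow> G' *\<^sub>v z = z)"
  using assms
proof (induction "n - m" arbitrary: T m rule: less_induct)
  case less
  note T = \<open>T \<in> carrier_mat n n\<close> and fl = \<open>open_flag n T m E\<close>
  have m: "0 < m" "m \<le> n" "E \<subseteq> {..<m - 1}" using fl by (auto simp: open_flag_def)
  then have fin: "finite E" using finite_subset by blast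
  define y where "y = T *\<^sub>v unit_vec n (m - 1)"
  have yc: "y \<in> carrier_vec n" using T by (simp add: y_def mult_mat_vec_carrier[of _ n n])
  show ?case
  proof (cases "supp_below n m y")
    case True
    have "flag n T m (insert (m - 1) E)"
      unfolding flag_def
    proof (intro conjI allI impI)
      fix j assume "j < m"
      then show "if j \<in> insert (m - 1) E then supp_below n m (T *\<^sub>v unit_vec n j)
            else Suc j < m \<and> T *\<^sub>v unit_vec n j = unit_vec n (Suc j)"
        using fl True by (cases "j = m - 1") (auto simp: y_def open_flag_def)
    qed (use m in auto)
    moreover have "card (insert (m - 1) E) \<le> Suc (card E)" by (rule card_insert_le_m1) auto
    ultimately show ?thesis
      using T inverse_pair_one[of n]
      by (intro exI[of _ "1\<^sub>m n"] exI[of _ m] exI[of _ "insert (m - 1) E"]) (auto simp: supp_below_def)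
  next
    case False
    obtain G G' where G: "inverse_pair n G G'" "\<And>z. supp_below n m z \<Longrightarrow> G *\<^sub>v z = z"
      "\<And>z. supp_below n m z \<Longrightarrow> G' *\<^sub>v z = z" "G' *\<^sub>v y = unit_vec n m" "m < n"
      using basis_exchange[OF yc False] by blast
    have c: "G \<in> carrier_mat n n" "G' \<in> carrier_mat n n" using G(1) by (auto simp: inverse_pair_def)
    let ?T = "G' * T * G"
    have Tc: "?T \<in> carrier_mat n n" using c T by simp
    have ofl: "open_flag n ?T (Suc m) E"
      unfolding open_flag_def
    proof (intro conjI allI impI)
      fix j assume "j < Suc m - 1"
      then have j: "j < m" by simp
      have conj: "?T *\<^sub>v unit_vec n j = G' *\<^sub>v (T *\<^sub>v unit_vec n j)"
        by (rule conj_mult_unit_vec[OF G(1) T G(2) j])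
      show "if j \<in> E then supp_below n (Suc m) (?T *\<^sub>v unit_vec n j)
            else ?T *\<^sub>v unit_vec n j = unit_vec n (Suc j)"
      proof (cases "j = m - 1")
        case True
        then have "?T *\<^sub>v unit_vec n j = unit_vec n (Suc j)" using conj G(4) m(1) by (simp add: y_def)
        then show ?thesis using True m by auto
      next
        case False
        then have j': "j < m - 1" using j by simp
        have "supp_below n m (T *\<^sub>v unit_vec n j)"
        proof (cases "j \<in> E")
          case False
          have "Suc j < m" using j' by simp
          then show ?thesis using False fl j' supp_below_unit[of "Suc j" m n] by (auto simp: open_flag_def)
        qed (use fl j' in \<open>auto simp: open_flag_def\<close>)
        then have "?T *\<^sub>v unit_vec n j = T *\<^sub>v unit_vec n j"
          "supp_below n (Suc m) (T *\<^sub>v unit_vec n j)"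
          using conj G(3) supp_below_mono[of n m _ "Suc m"] by auto
        then show ?thesis using fl j' by (auto simp: open_flag_def)
      qed
    qed (use m G(5) in auto)
    have "n - Suc m < n - m" using G(5) by simp
    from less.hyps[OF this Tc ofl]
    obtain K K' m' E' where K: "inverse_pair n K K'" "flag n (K' * ?T * K) m' E'" "Suc m \<le> m'"
      "card E' \<le> Suc (card E)" "\<And>z. supp_below n (Suc m) z \<Longrightarrow> K' *\<^sub>v z = z"
      by blast
    have kc: "K \<in> carrier_mat n n" "K' \<in> carrier_mat n n" using K(1) by (auto simp: inverse_pair_def)
    have "K' * ?T * K = (K' * G') * T * (G * K)"
      using c kc T by (simp add: assoc_mult_mat[of _ n n _ n _ n])
    moreover have "(K' * G') *\<^sub>v z = z" if "supp_below n m z" for z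
    proof -
      have "(K' * G') *\<^sub>v z = K' *\<^sub>v (G' *\<^sub>v z)"
        by (rule assoc_mult_mat_vec[of _ n n _ n]) (use c kc that in \<open>auto simp: supp_below_def\<close>)
      then show ?thesis using G(3)[OF that] K(5) supp_below_mono[OF that] by simp
    qed
    ultimately show ?thesis
      using inverse_pair_mult[OF G(1) K(1)] K(2-4)
      by (intro exI[of _ "G * K"] exI[of _ "K' * G'"] exI[of _ m'] exI[of _ E']) auto
  qed
qed

text \<open>A vector outside the span becomes the unit vector \<open>m\<close> and starts a new
  chain, which \<open>close_flag\<close> completes.\<close>

lemma extend_flag:
  fixes T :: "'a::field mat"
  assumes T: "T \<in> carrier_mat n n" and fl: "flag n T m E" and x: "x \<in> carrier_vec n"
  shows "\<exists>G G' m' E'. inverse_pair n G G' \<and> flag n (G' * T * G) m' E' \<and> m \<le> m' \<and> card E' \<le> Suc (card E) \<and>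
     supp_below n m' (G' *\<^sub>v x) \<and> (\<forall>z. supp_below n m z \<longrightarrow> G' *\<^sub>v z = z)"
proof (cases "supp_below n m x")
  case True
  then show ?thesis
    using T fl x inverse_pair_one[of n]
    by (intro exI[of _ "1\<^sub>m n"] exI[of _ m] exI[of _ E]) (auto simp: supp_below_def)
next
  case False
  obtain G G' where G: "inverse_pair n G G'" "\<And>z. supp_below n m z \<Longrightarrow> G *\<^sub>v z = z"
    "\<And>z. supp_below n m z \<Longrightarrow> G' *\<^sub>v z = z" "G' *\<^sub>v x = unit_vec n m" "m < n"
    using basis_exchange[OF x False] by blast
  have c: "G \<in> carrier_mat n n" "G' \<in> carrier_mat n n" using G(1) by (auto simp: inverse_pair_def)
  let ?T = "G' * T * G"
  have Tc: "?T \<in> carrier_mat n n" using c T by simp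
  have "open_flag n ?T (Suc m) E"
    unfolding open_flag_def
  proof (intro conjI allI impI)
    fix j assume "j < Suc m - 1"
    then have j: "j < m" by simp
    have conj: "?T *\<^sub>v unit_vec n j = G' *\<^sub>v (T *\<^sub>v unit_vec n j)"
      by (rule conj_mult_unit_vec[OF G(1) T G(2) j])
    have "supp_below n m (T *\<^sub>v unit_vec n j)"
    proof (cases "j \<in> E")
      case False
      then show ?thesis using fl j supp_below_unit[of "Suc j" m n] by (auto simp: flag_def)
    qed (use fl j in \<open>auto simp: flag_def\<close>)
    then have "?T *\<^sub>v unit_vec n j = T *\<^sub>v unit_vec n j"
      "supp_below n (Suc m) (T *\<^sub>v unit_vec n j)"
      using conj G(3) supp_below_mono[of n m _ "Suc m"] by auto
    then show "if j \<in> E then supp_below n (Suc m) (?T *\<^sub>v unit_vec n j)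
          else ?T *\<^sub>v unit_vec n j = unit_vec n (Suc j)"
      using fl j by (auto simp: flag_def)
  qed (use fl G(5) in \<open>auto simp: flag_def\<close>)
  then obtain K K' m' E' where K: "inverse_pair n K K'" "flag n (K' * ?T * K) m' E'" "Suc m \<le> m'"
    "card E' \<le> Suc (card E)" "\<And>z. supp_below n (Suc m) z \<Longrightarrow> K' *\<^sub>v z = z"
    using close_flag[OF Tc] by blast
  have kc: "K \<in> carrier_mat n n" "K' \<in> carrier_mat n n" using K(1) by (auto simp: inverse_pair_def)
  have eq: "K' * ?T * K = (K' * G') * T * (G * K)"
    using c kc T by (simp add: assoc_mult_mat[of _ n n _ n _ n])
  have KG: "(K' * G') *\<^sub>v z = K' *\<^sub>v (G' *\<^sub>v z)" if "z \<in> carrier_vec n" for z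
    by (rule assoc_mult_mat_vec[of _ n n _ n]) (use c kc that in auto)
  have "(K' * G') *\<^sub>v z = z" if "supp_below n m z" for z
  proof -
    have "z \<in> carrier_vec n" using that by (simp add: supp_below_def)
    then show ?thesis using KG[of z] G(3)[OF that] K(5)[OF supp_below_mono[OF that]] by simp
  qed
  moreover have "supp_below n m' ((K' * G') *\<^sub>v x)"
    using KG[OF x] G(4) K(5)[OF supp_below_unit[of m "Suc m"]] K(3) supp_below_unit[of m m' n] by simp
  ultimately show ?thesis
    using inverse_pair_mult[OF G(1) K(1)] K(2-4) eq
    by (intro exI[of _ "G * K"] exI[of _ "K' * G'"] exI[of _ m'] exI[of _ E']) auto
qed

text \<open>Each vector opens at most one chain, whence \<open>card E \<le> r\<close>. In the new
  basis the first \<open>m\<close> unit vectors span the space \<open>K\<close>, which is invariant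
  and contains all \<open>x i\<close>.\<close>

lemma exists_flag:
  fixes M :: "'a::field mat"
  assumes M: "M \<in> carrier_mat n n" and x: "\<And>i. i < r \<Longrightarrow> x i \<in> carrier_vec n"
  shows "\<exists>S S' m E. inverse_pair n S S' \<and> flag n (S' * M * S) m E \<and> card E \<le> r \<and>
     (\<forall>i<r. supp_below n m (S' *\<^sub>v x i))"
  using x
proof (induction r)
  case 0
  show ?case
    using M inverse_pair_one[of n]
    by (intro exI[of _ "1\<^sub>m n"] exI[of _ 0] exI[of _ "{}"]) (auto simp: flag_def)
next
  case (Suc r)
  then obtain S S' m E where S: "inverse_pair n S S'" "flag n (S' * M * S) m E" "card E \<le> r"
    "\<And>i. i < r \<Longrightarrow> supp_below n m (S' *\<^sub>v x i)" by auto
  have c: "S \<in> carrier_mat n n" "S' \<in> carrier_mat n n" using S(1) by (auto simp: inverse_pair_def)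
  have xr: "S' *\<^sub>v x r \<in> carrier_vec n" using c(2) Suc.prems by (intro mult_mat_vec_carrier[of _ n n]) auto
  have "S' * M * S \<in> carrier_mat n n" using c M by simp
  from extend_flag[OF this S(2) xr] obtain G G' m' E' where G: "inverse_pair n G G'"
    "flag n (G' * (S' * M * S) * G) m' E'" "m \<le> m'" "card E' \<le> Suc (card E)"
    "supp_below n m' (G' *\<^sub>v (S' *\<^sub>v x r))" "\<And>z. supp_below n m z \<Longrightarrow> G' *\<^sub>v z = z" by blast
  have gc: "G \<in> carrier_mat n n" "G' \<in> carrier_mat n n" using G(1) by (auto simp: inverse_pair_def)
  have eq: "G' * (S' * M * S) * G = (G' * S') * M * (S * G)"
    using c gc M by (simp add: assoc_mult_mat[of _ n n _ n _ n])
  have GS: "(G' * S') *\<^sub>v x i = G' *\<^sub>v (S' *\<^sub>v x i)" if "i < Suc r" for i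
    by (rule assoc_mult_mat_vec[of _ n n _ n]) (use c gc Suc.prems[OF that] in auto)
  have "supp_below n m' ((G' * S') *\<^sub>v x i)" if "i < Suc r" for i
  proof (cases "i = r")
    case False
    then have "i < r" using that by simp
    then show ?thesis using GS[OF that] S(4) G(6) supp_below_mono[OF S(4) G(3)] by simp
  qed (use GS[OF that] G(5) in simp)
  then show ?case
    using inverse_pair_mult[OF S(1) G(1)] G(2,4) S(3) eq
    by (intro exI[of _ "S * G"] exI[of _ "G' * S'"] exI[of _ m'] exI[of _ E']) auto
qed

section \<open>Conjugation of and division by \<open>s - M\<close>\<close>

interpretation const_poly: comm_ring_hom "\<lambda>a::'a::comm_ring_1. [:a:]"
  by unfold_locales (auto simp: one_pCons)

abbreviation lift_mat :: "'a::comm_ring_1 mat \<Rightarrow> 'a poly mat" where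
  "lift_mat \<equiv> map_mat (\<lambda>a. [:a:])"

lemma inverse_pair_lift:
  assumes "inverse_pair n S S'"
  shows "inverse_pair n (lift_mat S) (lift_mat S')"
  using assms const_poly.mat_hom_mult[of S n n S' n] const_poly.mat_hom_mult[of S' n n S n]
  by (auto simp: inverse_pair_def const_poly.mat_hom_one)

lemma char_poly_matrix_eq:
  "M \<in> carrier_mat n n \<Longrightarrow> char_poly_matrix M = [:0,1:] \<cdot>\<^sub>m 1\<^sub>m n - lift_mat M"
  by (rule eq_matI) (auto simp: char_poly_matrix_def)

lemma char_poly_matrix_conj:
  fixes M :: "'a::comm_ring_1 mat"
  assumes S: "inverse_pair n S S'" and M: "M \<in> carrier_mat n n"
  shows "char_poly_matrix (S' * M * S) * lift_mat S' = lift_mat S' * char_poly_matrix M"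
proof -
  have c: "S \<in> carrier_mat n n" "S' \<in> carrier_mat n n" using S by (auto simp: inverse_pair_def)
  have lc: "lift_mat S' \<in> carrier_mat n n" "lift_mat M \<in> carrier_mat n n" using c M by auto
  have T: "S' * M * S \<in> carrier_mat n n" "lift_mat (S' * M * S) \<in> carrier_mat n n" using c M by auto
  have I: "[:0,1:] \<cdot>\<^sub>m 1\<^sub>m n \<in> carrier_mat n n" by simp
  have "char_poly_matrix (S' * M * S) * lift_mat S' =
      ([:0,1:] \<cdot>\<^sub>m 1\<^sub>m n) * lift_mat S' - lift_mat (S' * M * S) * lift_mat S'"
    unfolding char_poly_matrix_eq[OF T(1)] by (rule minus_mult_distrib_mat[OF I T(2) lc(1)])
  moreover have "lift_mat (S' * M * S) * lift_mat S' = lift_mat ((S' * M * S) * S')"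
    by (rule const_poly.mat_hom_mult[symmetric, OF T(1) c(2)])
  moreover have "(S' * M * S) * S' = S' * M"
    using S c M by (simp add: inverse_pair_def assoc_mult_mat[of _ n n _ n _ n])
  moreover have "lift_mat (S' * M) = lift_mat S' * lift_mat M" by (rule const_poly.mat_hom_mult[OF c(2) M])
  moreover have "lift_mat S' * char_poly_matrix M =
      lift_mat S' * ([:0,1:] \<cdot>\<^sub>m 1\<^sub>m n) - lift_mat S' * lift_mat M"
    unfolding char_poly_matrix_eq[OF M] by (rule mult_minus_distrib_mat[OF lc(1) I lc(2)])
  moreover have "([:0,1:] \<cdot>\<^sub>m 1\<^sub>m n) * lift_mat S' = [:0,1:] \<cdot>\<^sub>m lift_mat S'"
    using mult_smult_assoc_mat[of "1\<^sub>m n" n n "lift_mat S'" n "[:0,1:]"] lc by simp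
  moreover have "lift_mat S' * ([:0,1:] \<cdot>\<^sub>m 1\<^sub>m n) = [:0,1:] \<cdot>\<^sub>m lift_mat S'"
    using mult_smult_distrib[of "lift_mat S'" n n "1\<^sub>m n" n "[:0,1:]"] lc by simp
  ultimately show ?thesis by simp
qed

text \<open>Division with remainder by \<open>s - M\<close>, which identifies \<open>F[s]^n\<close>
  modulo the columns of \<open>s - M\<close> with \<open>F^n\<close>. The induction is Horner's
  scheme for \<open>U = U0 + s U1\<close>; on remainders, \<open>s\<close> acts as
  \<open>M\<close>.\<close>

lemma mod_char_poly_matrix:
  fixes M :: "'a::comm_ring_1 mat" and U :: "'a poly mat"
  assumes M: "M \<in> carrier_mat n n" and U: "U \<in> carrier_mat n m"
  shows "\<exists>Q Y. Q \<in> carrier_mat n m \<and> Y \<in> carrier_mat n m \<and> U = char_poly_matrix M * Q + lift_mat Y"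
proof -
  let ?C = "char_poly_matrix M"
  have C: "?C \<in> carrier_mat n n" using M by simp
  have "\<exists>Q Y. Q \<in> carrier_mat n m \<and> Y \<in> carrier_mat n m \<and> U = ?C * Q + lift_mat Y"
    if "U \<in> carrier_mat n m" "\<And>i j l. i < n \<Longrightarrow> j < m \<Longrightarrow> N \<le> l \<Longrightarrow> coeff (U $$ (i,j)) l = 0" for N and U :: "'a poly mat"
    using that
  proof (induction N arbitrary: U)
    case 0
    have "U = ?C * 0\<^sub>m n m + lift_mat (0\<^sub>m n m)"
      using 0 C by (intro eq_matI) (auto intro!: poly_eqI)
    then show ?case by (intro exI[of _ "0\<^sub>m n m"]) auto
  next
    case (Suc N)
    define U0 where "U0 = map_mat (\<lambda>p. coeff p 0) U"
    define U1 where "U1 = map_mat (poly_shift 1) U"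
    have "U1 \<in> carrier_mat n m" using Suc.prems(1) by (simp add: U1_def)
    moreover have "coeff (U1 $$ (i,j)) l = 0" if "i < n" "j < m" "N \<le> l" for i j l
      using that Suc.prems by (simp add: U1_def coeff_poly_shift)
    ultimately obtain Q1 Y1 where 1: "Q1 \<in> carrier_mat n m" "Y1 \<in> carrier_mat n m" "U1 = ?C * Q1 + lift_mat Y1"
      using Suc.IH by blast
    \<comment> \<open>From \<open>s Y1 = (s - M) Y1 + M Y1\<close>: the summand \<open>Y1\<close>
      joins the quotient, and \<open>M * Y1\<close> the remainder.\<close>
    let ?Q = "[:0,1:] \<cdot>\<^sub>m Q1 + lift_mat Y1" and ?Y = "U0 + M * Y1"
    have "?C * ?Q = ?C * ([:0,1:] \<cdot>\<^sub>m Q1) + ?C * lift_mat Y1"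
      using C 1 by (intro mult_add_distrib_mat[of _ n n _ m]) auto
    moreover have "?C * ([:0,1:] \<cdot>\<^sub>m Q1) = [:0,1:] \<cdot>\<^sub>m (?C * Q1)"
      by (rule mult_smult_distrib[OF C 1(1)])
    moreover have "?C * lift_mat Y1 = ([:0,1:] \<cdot>\<^sub>m 1\<^sub>m n) * lift_mat Y1 - lift_mat M * lift_mat Y1"
      unfolding char_poly_matrix_eq[OF M] using M 1 by (intro minus_mult_distrib_mat[of _ n n _ _ m]) auto
    moreover have "([:0,1:] \<cdot>\<^sub>m 1\<^sub>m n) * lift_mat Y1 = [:0,1:] \<cdot>\<^sub>m lift_mat Y1"
      using mult_smult_assoc_mat[of "1\<^sub>m n" n n "lift_mat Y1" m "[:0,1:]"] 1 by simp
    moreover have "lift_mat M * lift_mat Y1 = lift_mat (M * Y1)"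
      by (rule const_poly.mat_hom_mult[symmetric, OF M 1(2)])
    ultimately have CQ: "?C * ?Q = [:0,1:] \<cdot>\<^sub>m (?C * Q1) + ([:0,1:] \<cdot>\<^sub>m lift_mat Y1 - lift_mat (M * Y1))" by simp
    have "U = ?C * ?Q + lift_mat ?Y"
    proof (rule eq_matI)
      fix i j assume "i < dim_row (?C * ?Q + lift_mat ?Y)" "j < dim_col (?C * ?Q + lift_mat ?Y)"
      then have ij: "i < n" "j < m" using 1 M Suc.prems(1) by (auto simp: U0_def)
      define y where "y = (?C * Q1) $$ (i,j)"
      define z where "z = (M * Y1) $$ (i,j)"
      have CQ1: "?C * Q1 \<in> carrier_mat n m" and MY: "M * Y1 \<in> carrier_mat n m"
        by (rule mult_carrier_mat[OF C 1(1)], rule mult_carrier_mat[OF M 1(2)])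
      have "U1 $$ (i,j) = y + [:Y1 $$ (i,j):]"
        unfolding y_def using 1(1,2) ij carrier_matD[OF C] by (subst 1(3)) (simp del: index_mult_mat(1))
      moreover have "U $$ (i,j) = [:U0 $$ (i,j):] + [:0,1:] * U1 $$ (i,j)"
        using ij Suc.prems(1) by (intro poly_eqI) (auto simp: U0_def U1_def coeff_pCons coeff_poly_shift split: nat.splits)
      moreover have "(?C * ?Q + lift_mat ?Y) $$ (i,j) =
          [:0,1:] * y + ([:0,1:] * [:Y1 $$ (i,j):] - [:z:]) + [:U0 $$ (i,j) + z:]"
        unfolding CQ using ij M carrier_matD[OF C] 1(1,2) Suc.prems(1) by (simp add: y_def z_def U0_def del: index_mult_mat(1))
      ultimately show "U $$ (i,j) = (?C * ?Q + lift_mat ?Y) $$ (i,j)" by (simp add: algebra_simps)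
    qed (use 1 M Suc.prems(1) in \<open>auto simp: U0_def\<close>)
    then show ?case using 1 M Suc.prems(1) by (intro exI[of _ ?Q] exI[of _ ?Y]) (auto simp: U0_def)
  qed
  moreover obtain N where "\<And>i j. i < n \<Longrightarrow> j < m \<Longrightarrow> degree (U $$ (i,j)) < N"
  proof -
    let ?S = "(\<lambda>(i,j). degree (U $$ (i,j))) ` ({..<n} \<times> {..<m})"
    have "degree (U $$ (i,j)) < Suc (Max ?S)" if "i < n" "j < m" for i j
      using that by (intro le_imp_less_Suc Max_ge) auto
    then show ?thesis using that by blast
  qed
  ultimately show ?thesis using U by (metis coeff_eq_0 less_le_trans)
qed

section \<open>Companion blocks and the quotient by the invariant subspace\<close>

lemma prod_pm_one:
  fixes f :: "'b \<Rightarrow> 'a::comm_ring_1"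
  assumes "\<And>i. i \<in> S \<Longrightarrow> f i = 1 \<or> f i = -1"
  shows "prod f S = 1 \<or> prod f S = -1"
  using assms
proof (induction S rule: infinite_finite_induct)
  case (insert x S)
  then have "f x = 1 \<or> f x = -1" "prod f S = 1 \<or> prod f S = -1" by auto
  then show ?case using insert.hyps by auto
qed auto

text \<open>
  Adding \<open>s\<close>, \<open>s\<^sup>2\<close>, \dots times the other rows to row \<open>0\<close> turns it into \<open>(0, \<dots>, 0, b, *, \<dots>, *)\<close>.
  Moving that row below the other rows of the companion block gives an upper triangular matrix.
\<close>

lemma det_companion_block:
  fixes b :: "'a::field poly"
  assumes D: "0 < D" "D \<le> n" and b: "degree b = D" "lead_coeff b = 1" and Y: "Y \<in> carrier_mat n n"
    and Y1: "\<And>i j. i < D \<Longrightarrow> Suc j < D \<Longrightarrow> Y $$ (i,j) = (if i = j then [:0,1:] else if i = Suc j then -1 else 0)"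
    and Y2: "\<And>i. i < D \<Longrightarrow> Y $$ (i,D - 1) = (if i = D - 1 then [:0,1:] else 0) + [:coeff b i:]"
    and Y3: "\<And>i j. D \<le> i \<Longrightarrow> i < n \<Longrightarrow> j < n \<Longrightarrow> Y $$ (i,j) = (if i = j then 1 else 0)"
  shows "\<exists>e. (e = 1 \<or> e = -1) \<and> det Y = e * b"
proof -
  define L :: "'a poly mat" where
    "L = mat n n (\<lambda>(i,j). if i = 0 then (if j < D then monom 1 j else 0) else if i = j then 1 else 0)"
  have L: "L \<in> carrier_mat n n" by (simp add: L_def)
  have "det L = prod_list (diag_mat L)"
    by (rule det_upper_triangular[OF _ L]) (auto simp: upper_triangular_def L_def)
  also have "\<dots> = 1"
    unfolding prod_list_diag_prod by (rule prod.neutral) (use D in \<open>auto simp: L_def\<close>)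
  finally have detL: "det L = 1" .
  have LY: "L * Y \<in> carrier_mat n n" using L Y by simp
  have LY0: "(L * Y) $$ (0,j) = (\<Sum>l<D. monom 1 l * Y $$ (l,j))" if "j < n" for j
  proof -
    have "(L * Y) $$ (0,j) = (\<Sum>l = 0..<n. L $$ (0,l) * Y $$ (l,j))"
      using L Y D that by (simp add: scalar_prod_def)
    also have "\<dots> = (\<Sum>l = 0..<n. if l \<in> {..<D} then monom 1 l * Y $$ (l,j) else 0)"
      using D by (intro sum.cong) (auto simp: L_def)
    also have "\<dots> = (\<Sum>l\<in>{0..<n} \<inter> {..<D}. monom 1 l * Y $$ (l,j))"
      by (rule sum.inter_restrict[symmetric]) simp
    also have "{0..<n} \<inter> {..<D} = {..<D}" using D by auto
    finally show ?thesis .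
  qed
  have LYi: "(L * Y) $$ (i,j) = Y $$ (i,j)" if "0 < i" "i < n" "j < n" for i j
  proof -
    have "(L * Y) $$ (i,j) = (\<Sum>l = 0..<n. L $$ (i,l) * Y $$ (l,j))"
      using L Y that by (simp add: scalar_prod_def)
    also have "\<dots> = (\<Sum>l = 0..<n. if l = i then Y $$ (i,j) else 0)"
      using that by (intro sum.cong) (auto simp: L_def)
    finally show ?thesis using that by simp
  qed
  have first: "(L * Y) $$ (0,j) = 0" if j: "Suc j < D" for j
  proof -
    have "(L * Y) $$ (0,j) = (\<Sum>l<D. monom 1 l * Y $$ (l,j))" using j D by (intro LY0) auto
    also have "\<dots> = (\<Sum>l\<in>{j,Suc j}. monom 1 l * Y $$ (l,j))"
      using j by (intro sum.mono_neutral_right) (auto simp: Y1)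
    also have "\<dots> = monom 1 j * [:0,1:] - monom 1 (Suc j)" using j by (simp add: Y1)
    also have "\<dots> = 0" by (simp add: monom_Suc)
    finally show ?thesis .
  qed
  have pivot: "(L * Y) $$ (0,D - 1) = b"
  proof -
    have "(L * Y) $$ (0,D - 1) = (\<Sum>l<D. monom 1 l * Y $$ (l,D - 1))" using D by (intro LY0) auto
    also have "\<dots> = (\<Sum>l<D. (if l = D - 1 then monom 1 l * [:0,1:] else 0) + monom (coeff b l) l)"
      by (intro sum.cong refl, subst Y2) (simp_all add: distrib_left smult_monom)
    also have "\<dots> = monom 1 (D - 1) * [:0,1:] + (\<Sum>l<D. monom (coeff b l) l)"
      using D by (simp add: sum.distrib)
    also have "monom (1::'a) (D - 1) * [:0,1:] = monom (coeff b D) D"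
      using D b by (cases D) (simp_all add: monom_Suc)
    also have "monom (coeff b D) D + (\<Sum>l<D. monom (coeff b l) l) = (\<Sum>l\<le>D. monom (coeff b l) l)"
      by (simp add: lessThan_Suc_atMost[symmetric])
    also have "\<dots> = b" using poly_as_sum_of_monoms[of b] b by simp
    finally show ?thesis .
  qed
  define p where "p i = (if Suc i < D then Suc i else if Suc i = D then 0 else i)" for i
  have p: "p permutes {0..<n}"
  proof (rule bij_imp_permutes)
    have "inj_on p {0..<n}" by (auto simp: inj_on_def p_def split: if_splits)
    moreover have "p ` {0..<n} \<subseteq> {0..<n}" using D by (auto simp: p_def)
    ultimately show "bij_betw p {0..<n} {0..<n}" by (simp add: bij_betw_def endo_inj_surj)
  qed (use D in \<open>auto simp: p_def\<close>)
  define Y' where "Y' = mat n n (\<lambda>(i,j). (L * Y) $$ (p i, j))"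
  have Y': "Y' \<in> carrier_mat n n" by (simp add: Y'_def)
  have ent: "Y' $$ (i,j) = (if Suc i < D then Y $$ (Suc i,j) else if Suc i = D then (L * Y) $$ (0,j) else Y $$ (i,j))"
    if "i < n" "j < n" for i j
    using that D LYi[of "Suc i" j] LYi[of i j] by (auto simp: Y'_def p_def simp del: index_mult_mat(1))
  have "upper_triangular Y'"
    unfolding upper_triangular_def
  proof (intro allI impI)
    fix i j assume "i < dim_row Y'" "j < i"
    then have ij: "i < n" "j < i" "j < n" by (auto simp: Y'_def)
    show "Y' $$ (i,j) = 0"
      unfolding ent[OF ij(1,3)] using ij Y1[of "Suc i" j] first[of j] Y3[of i j] by auto
  qed
  then have "det Y' = (\<Prod>i = 0..<n. Y' $$ (i,i))"
    using det_upper_triangular[OF _ Y'] Y' by (simp add: prod_list_diag_prod)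
  also have "\<dots> = b * (\<Prod>i\<in>{0..<n} - {D - 1}. Y' $$ (i,i))"
    using D ent[of "D - 1" "D - 1"] pivot by (subst prod.remove[of _ "D - 1"]) auto
  finally have detY': "det Y' = b * (\<Prod>i\<in>{0..<n} - {D - 1}. Y' $$ (i,i))" .
  have "Y' $$ (i,i) = 1 \<or> Y' $$ (i,i) = -1" if "i \<in> {0..<n} - {D - 1}" for i
    using that ent[of i i] Y1[of "Suc i" i] Y3[of i i] D by auto
  then have e1: "(\<Prod>i\<in>{0..<n} - {D - 1}. Y' $$ (i,i)) = 1 \<or> (\<Prod>i\<in>{0..<n} - {D - 1}. Y' $$ (i,i)) = -1"
    by (rule prod_pm_one)
  have "det Y' = signof p * det (L * Y)" unfolding Y'_def by (rule det_permute_rows[OF LY p])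
  also have "det (L * Y) = det Y" using det_mult[OF L Y] detL by simp
  finally have "signof p * det Y = b * (\<Prod>i\<in>{0..<n} - {D - 1}. Y' $$ (i,i))" using detY' by simp
  moreover have "signof p = (1::'a poly) \<or> signof p = (-1::'a poly)" by (simp add: sign_def)
  ultimately have "det Y = b \<or> det Y = - b" using e1 by auto
  then show ?thesis by (metis mult_1 mult_minus1)
qed

lemma index_mult_sum:
  "A \<in> carrier_mat n l \<Longrightarrow> B \<in> carrier_mat l m \<Longrightarrow> i < n \<Longrightarrow> j < m \<Longrightarrow>
    (A * B) $$ (i,j) = (\<Sum>k = 0..<l. A $$ (i,k) * B $$ (k,j))"
  by (auto simp: scalar_prod_def)

lemma index_add_lift:
  "A \<in> carrier_mat n m \<Longrightarrow> B \<in> carrier_mat n m \<Longrightarrow> i < n \<Longrightarrow> j < m \<Longrightarrow>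
    (A + lift_mat B) $$ (i,j) = A $$ (i,j) + [:B $$ (i,j):]"
  by auto

text \<open>\<open>det ?Z\<close> is the characteristic polynomial on the quotient by the first
  \<open>D\<close> unit vectors. Multiplying the first \<open>k\<close> columns of \<open>U1\<close>
  by their diagonal entries gives \<open>L\<close>, whose determinant is \<open>?g\<close> up to a
  unit. From row \<open>D\<close> on, \<open>L\<close> agrees with \<open>(s - T) Y1\<close>: for
  the first \<open>k\<close> columns because \<open>U1 Dg = (s - T) W\<close>, for the others
  because their remainders \<open>S' * Y\<close> vanish in these rows. The zero block of
  \<open>T\<close> then lets \<open>L\<close> factor through \<open>?Z\<close>.\<close>

lemma flag_block_dvd:
  fixes M S S' Y :: "'a::field mat" and U U' V V' Dg Q :: "'a poly mat"
  assumes M: "M \<in> carrier_mat n n" and S: "inverse_pair n S S'"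
    and low: "\<And>i j. D \<le> i \<Longrightarrow> i < n \<Longrightarrow> j < D \<Longrightarrow> (S' * M * S) $$ (i,j) = 0"
    and UV: "inverse_pair n U U'" "inverse_pair n V V'"
    and Dg: "Dg \<in> carrier_mat n n" "\<And>i j. i < n \<Longrightarrow> j < n \<Longrightarrow> i \<noteq> j \<Longrightarrow> Dg $$ (i,j) = 0"
    and smith: "char_poly_matrix M = U * Dg * V"
    and Q: "Q \<in> carrier_mat n n" and Y: "Y \<in> carrier_mat n n" and UQ: "U = char_poly_matrix M * Q + lift_mat Y"
    and Y0: "\<And>i j. D \<le> i \<Longrightarrow> i < n \<Longrightarrow> k \<le> j \<Longrightarrow> j < n \<Longrightarrow> (S' * Y) $$ (i,j) = 0"
    and k: "k \<le> n"
  shows "det (mat n n (\<lambda>(i,j). if i < D then (if i = j then 1 else 0) else char_poly_matrix (S' * M * S) $$ (i,j)))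
    dvd (\<Prod>i<k. Dg $$ (i,i))" (is "det ?Z dvd ?g")
proof -
  define T where "T = S' * M * S"
  let ?C = "char_poly_matrix M" and ?CT = "char_poly_matrix T" and ?lS = "lift_mat S" and ?lS' = "lift_mat S'"
  have c: "S \<in> carrier_mat n n" "S' \<in> carrier_mat n n" using S by (auto simp: inverse_pair_def)
  have T: "T \<in> carrier_mat n n" using c M by (simp add: T_def)
  have lc: "?lS' \<in> carrier_mat n n" "?C \<in> carrier_mat n n" "?CT \<in> carrier_mat n n" using c M T by auto
  have uc: "U \<in> carrier_mat n n" "U' \<in> carrier_mat n n" "V \<in> carrier_mat n n" "V' \<in> carrier_mat n n"
    using UV by (auto simp: inverse_pair_def)
  have conj: "?CT * ?lS' = ?lS' * ?C" unfolding T_def by (rule char_poly_matrix_conj[OF S M])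
  define U1 where "U1 = ?lS' * U"
  define W where "W = ?lS' * V'"
  define Q1 where "Q1 = ?lS' * Q"
  have U1: "U1 \<in> carrier_mat n n" and W: "W \<in> carrier_mat n n" and Q1: "Q1 \<in> carrier_mat n n"
    using lc uc Q by (auto simp: U1_def W_def Q1_def)
  have CW: "?CT * W = U1 * Dg"
  proof -
    have "?CT * W = (?CT * ?lS') * V'" unfolding W_def using lc uc by (simp add: assoc_mult_mat[of _ n n _ n _ n])
    also have "\<dots> = ?lS' * (U * Dg * V) * V'" unfolding conj smith ..
    also have "\<dots> = U1 * Dg"
      using UV lc uc Dg(1) by (simp add: U1_def inverse_pair_def assoc_mult_mat[of _ n n _ n _ n])
    finally show ?thesis .
  qed
  have CQ: "U1 = ?CT * Q1 + lift_mat (S' * Y)"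
  proof -
    have "U1 = ?lS' * (?C * Q) + ?lS' * lift_mat Y"
      unfolding U1_def by (subst UQ) (rule mult_add_distrib_mat[of _ n n _ n], use lc Q Y in auto)
    also have "?lS' * (?C * Q) = ?CT * Q1"
      unfolding Q1_def assoc_mult_mat[OF lc(1,2) Q, symmetric] conj[symmetric]
      by (rule assoc_mult_mat[OF lc(3,1) Q])
    also have "?lS' * lift_mat Y = lift_mat (S' * Y)" by (rule const_poly.mat_hom_mult[symmetric, OF c(2) Y])
    finally show ?thesis .
  qed
  define Y1 where "Y1 = mat n n (\<lambda>(l,j). if j < k then W $$ (l,j) else Q1 $$ (l,j))"
  define L where "L = mat n n (\<lambda>(i,j). if j < k then U1 $$ (i,j) * Dg $$ (j,j) else U1 $$ (i,j))"
  \<comment> \<open>Above row \<open>D\<close>, where \<open>?Z\<close> is the identity,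
    \<open>R\<close> copies \<open>L\<close>. The rows of \<open>?Z\<close> from \<open>D\<close> on
    have zeros in the first \<open>D\<close> columns and meet only the rows taken from
    \<open>Y1\<close>.\<close>
  define R where "R = mat n n (\<lambda>(l,j). if l < D then L $$ (l,j) else Y1 $$ (l,j))"
  have CT0: "?CT $$ (i,l) = 0" if "D \<le> i" "i < n" "l < D" for i l
    using that low[OF that] T unfolding T_def[symmetric] by (simp add: char_poly_matrix_def)
  have low_row: "(\<Sum>l = 0..<n. ?CT $$ (i,l) * Y1 $$ (l,j)) = L $$ (i,j)" if i: "D \<le> i" "i < n" and j: "j < n" for i j
  proof (cases "j < k")
    case True
    have "(\<Sum>l = 0..<n. ?CT $$ (i,l) * Y1 $$ (l,j)) = (?CT * W) $$ (i,j)"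
      unfolding index_mult_sum[OF lc(3) W i(2) j] using True j by (intro sum.cong) (auto simp: Y1_def)
    also have "\<dots> = (\<Sum>l = 0..<n. U1 $$ (i,l) * Dg $$ (l,j))"
      unfolding CW by (rule index_mult_sum[OF U1 Dg(1) i(2) j])
    also have "\<dots> = (\<Sum>l = 0..<n. if l = j then U1 $$ (i,j) * Dg $$ (j,j) else 0)"
      using j Dg(2) by (intro sum.cong) auto
    finally show ?thesis using True i j by (simp add: L_def)
  next
    case False
    have "(\<Sum>l = 0..<n. ?CT $$ (i,l) * Y1 $$ (l,j)) = (?CT * Q1) $$ (i,j)"
      unfolding index_mult_sum[OF lc(3) Q1 i(2) j] using False j by (intro sum.cong) (auto simp: Y1_def)
    also have "\<dots> = U1 $$ (i,j)"
    proof -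
      have CQ1: "?CT * Q1 \<in> carrier_mat n n" by (rule mult_carrier_mat[OF lc(3) Q1])
      have SY: "S' * Y \<in> carrier_mat n n" by (rule mult_carrier_mat[OF c(2) Y])
      have "U1 $$ (i,j) = (?CT * Q1) $$ (i,j) + [:(S' * Y) $$ (i,j):]"
        by (subst CQ) (rule index_add_lift[OF CQ1 SY i(2) j])
      then show ?thesis using Y0[OF i _ j] False by simp
    qed
    finally show ?thesis using False i j by (simp add: L_def)
  qed
  have Zc: "?Z \<in> carrier_mat n n" and R: "R \<in> carrier_mat n n" by (auto simp: R_def)
  have "L = ?Z * R"
  proof (rule eq_matI)
    fix i j assume "i < dim_row (?Z * R)" "j < dim_col (?Z * R)"
    then have ij: "i < n" "j < n" by (auto simp: R_def)
    have prod: "(?Z * R) $$ (i,j) = (\<Sum>l = 0..<n. ?Z $$ (i,l) * R $$ (l,j))"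
      by (rule index_mult_sum[OF Zc R ij])
    show "L $$ (i,j) = (?Z * R) $$ (i,j)"
    proof (cases "i < D")
      case True
      have "(\<Sum>l = 0..<n. ?Z $$ (i,l) * R $$ (l,j)) = (\<Sum>l = 0..<n. if l = i then R $$ (i,j) else 0)"
        using True ij by (intro sum.cong) auto
      then show ?thesis unfolding prod using True ij by (simp add: R_def)
    next
      case False
      have "(\<Sum>l = 0..<n. ?Z $$ (i,l) * R $$ (l,j)) = (\<Sum>l = 0..<n. ?CT $$ (i,l) * Y1 $$ (l,j))"
        using False ij CT0[of i] by (intro sum.cong) (auto simp: R_def T_def[symmetric])
      then show ?thesis unfolding prod using low_row[of i j] False ij by simp
    qed
  qed (auto simp: L_def R_def)
  then have detL: "det L = det ?Z * det R" using det_mult[OF Zc R] by simp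
  define G where "G = mat n n (\<lambda>(i,j). if i = j then (if i < k then Dg $$ (i,i) else 1) else 0)"
  have Gc: "G \<in> carrier_mat n n" by (simp add: G_def)
  have "L = U1 * G"
  proof (rule eq_matI)
    fix i j assume "i < dim_row (U1 * G)" "j < dim_col (U1 * G)"
    then have ij: "i < n" "j < n" using U1 by (auto simp: G_def)
    have "(U1 * G) $$ (i,j) = (\<Sum>l = 0..<n. U1 $$ (i,l) * G $$ (l,j))"
      by (rule index_mult_sum[OF U1 Gc ij])
    also have "\<dots> = (\<Sum>l = 0..<n. if l = j then L $$ (i,j) else 0)"
      using ij by (intro sum.cong) (auto simp: G_def L_def)
    finally show "L $$ (i,j) = (U1 * G) $$ (i,j)" using ij by simp
  qed (use U1 in \<open>auto simp: G_def L_def\<close>)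
  then have dL: "det L = det U1 * det G" using det_mult[OF U1 Gc] by simp
  have dG: "det G = ?g"
  proof -
    have "det G = prod_list (diag_mat G)"
      by (rule det_upper_triangular[OF _ Gc]) (auto simp: upper_triangular_def G_def)
    also have "\<dots> = (\<Prod>i = 0..<n. if i \<in> {..<k} then Dg $$ (i,i) else 1)"
      unfolding prod_list_diag_prod by (intro prod.cong) (auto simp: G_def)
    also have "\<dots> = (\<Prod>i\<in>{0..<n} \<inter> {..<k}. Dg $$ (i,i))" by (rule prod.inter_restrict[symmetric]) simp
    also have "{0..<n} \<inter> {..<k} = {..<k}" using k by auto
    finally show ?thesis .
  qed
  \<comment> \<open>\<open>U1\<close> is invertible over the polynomial ring, so its determinant is
    a unit.\<close>
  have dU: "det (U' * ?lS) * det U1 = 1"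
  proof -
    have P: "inverse_pair n (?lS' * U) (U' * ?lS)"
    proof (rule inverse_pair_mult[OF _ UV(1)])
      show "inverse_pair n ?lS' ?lS" using inverse_pair_lift[OF S] by (auto simp: inverse_pair_def)
    qed
    then have "det ((U' * ?lS) * (?lS' * U)) = 1" by (simp add: inverse_pair_def)
    then show ?thesis using P det_mult[of "U' * ?lS" n "?lS' * U"] by (simp add: U1_def inverse_pair_def)
  qed
  have "?g = det (U' * ?lS) * det U1 * det G" unfolding dU dG by simp
  also have "\<dots> = det (U' * ?lS) * (det ?Z * det R)" unfolding mult.assoc dL[symmetric] detL ..
  also have "\<dots> = det ?Z * (det (U' * ?lS) * det R)" by (rule mult.left_commute)
  finally show ?thesis by (rule dvdI)
qed

lemma const_minus_one: "[:- 1:] = (- 1 :: 'a::comm_ring_1 poly)"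
  by (rule poly_eqI) (simp add: coeff_pCons split: nat.splits)

text \<open>The zero block splits the new characteristic matrix as \<open>?Z * Y\<close>:
  \<open>?Z\<close> sees only the quotient, while \<open>Y\<close> has the companion block of
  \<open>b\<close> in its first \<open>D\<close> rows and is the identity below. The sign comes from
  permuting rows in \<open>det_companion_block\<close>.\<close>

lemma char_poly_replace_block:
  fixes T :: "'a::field mat" and b :: "'a poly"
  assumes T: "T \<in> carrier_mat n n" and D: "D \<le> n"
    and low: "\<And>i j. D \<le> i \<Longrightarrow> i < n \<Longrightarrow> j < D \<Longrightarrow> T $$ (i,j) = 0"
    and b: "degree b = D" "lead_coeff b = 1"
  shows "\<exists>e. (e = 1 \<or> e = -1) \<and>
    char_poly (mat n n (\<lambda>(i,j). if j < D then (if Suc j < D then (if i = Suc j then 1 else 0)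
                                              else (if i < D then - coeff b i else 0)) else T $$ (i,j))) =
    e * (det (mat n n (\<lambda>(i,j). if i < D then (if i = j then 1 else 0) else char_poly_matrix T $$ (i,j))) * b)"
    (is "\<exists>e. _ \<and> char_poly ?T = e * (det ?Z * b)")
proof (cases "D = 0")
  case True
  then have "?T = T" "?Z = char_poly_matrix T" using T by (auto intro!: eq_matI simp: char_poly_matrix_def)
  moreover have "b = 1" using b True by (metis degree_eq_zeroE coeff_pCons_0 one_pCons)
  ultimately show ?thesis by (intro exI[of _ 1]) (simp add: char_poly_def)
next
  case False
  define Y where "Y = mat n n (\<lambda>(i,j). if i < D then char_poly_matrix ?T $$ (i,j) else if i = j then 1 else 0)"
  have Tc: "?T \<in> carrier_mat n n" by simp
  have Yc: "Y \<in> carrier_mat n n" and Zc: "?Z \<in> carrier_mat n n" by (auto simp: Y_def)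
  have cT: "char_poly_matrix ?T $$ (i,j) = (if i = j then [:0,1:] else 0) + [:- (?T $$ (i,j)):]" if "i < n" "j < n" for i j
    using that by (simp add: char_poly_matrix_def)
  have cT': "char_poly_matrix T $$ (i,j) = (if i = j then [:0,1:] else 0) + [:- (T $$ (i,j)):]" if "i < n" "j < n" for i j
    using that T by (simp add: char_poly_matrix_def)
  have "char_poly_matrix ?T = ?Z * Y"
  proof (rule eq_matI)
    fix i j assume "i < dim_row (?Z * Y)" "j < dim_col (?Z * Y)"
    then have ij: "i < n" "j < n" by (auto simp: Y_def)
    have prod: "(?Z * Y) $$ (i,j) = (\<Sum>l = 0..<n. ?Z $$ (i,l) * Y $$ (l,j))"
      by (rule index_mult_sum[OF Zc Yc ij])
    show "char_poly_matrix ?T $$ (i,j) = (?Z * Y) $$ (i,j)"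
    proof (cases "i < D")
      case True
      have "(\<Sum>l = 0..<n. ?Z $$ (i,l) * Y $$ (l,j)) = (\<Sum>l = 0..<n. if l = i then Y $$ (i,j) else 0)"
        using True ij by (intro sum.cong) auto
      then show ?thesis unfolding prod using True ij by (simp add: Y_def)
    next
      case iD: False
      have "(\<Sum>l = 0..<n. ?Z $$ (i,l) * Y $$ (l,j)) =
          (\<Sum>l = 0..<n. if l = j then (if j < D then 0 else char_poly_matrix T $$ (i,j)) else 0)"
      proof (intro sum.cong refl)
        fix l assume l: "l \<in> {0..<n}"
        have "char_poly_matrix T $$ (i,l) = 0" if "l < D"
          using that iD ij low[of i l] cT'[of i l] l by auto
        then show "?Z $$ (i,l) * Y $$ (l,j) = (if l = j then (if j < D then 0 else char_poly_matrix T $$ (i,j)) else 0)"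
          using iD ij l by (auto simp: Y_def)
      qed
      also have "\<dots> = (if j < D then 0 else char_poly_matrix T $$ (i,j))" using ij by simp
      also have "\<dots> = char_poly_matrix ?T $$ (i,j)"
        unfolding cT[OF ij] using iD ij cT'[OF ij] by auto
      finally show ?thesis unfolding prod by simp
    qed
  qed (auto simp: Y_def char_poly_matrix_def)
  then have cp: "char_poly ?T = det ?Z * det Y" using det_mult[OF Zc Yc] by (simp add: char_poly_def)
  have "\<exists>e. (e = 1 \<or> e = -1) \<and> det Y = e * b"
  proof (rule det_companion_block[OF _ D b Yc])
    show "Y $$ (i,j) = (if i = j then [:0,1:] else if i = Suc j then -1 else 0)" if "i < D" "Suc j < D" for i j
    proof -
      have ij: "i < n" "j < n" using that D by auto
      have "Y $$ (i,j) = char_poly_matrix ?T $$ (i,j)" using that ij by (simp add: Y_def)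
      also have "\<dots> = (if i = j then [:0,1:] else if i = Suc j then -1 else 0)"
        unfolding cT[OF ij] using that ij by (auto simp: const_minus_one)
      finally show ?thesis .
    qed
    show "Y $$ (i,D - 1) = (if i = D - 1 then [:0,1:] else 0) + [:coeff b i:]" if "i < D" for i
    proof -
      have ij: "i < n" "D - 1 < n" using that D by auto
      have "Y $$ (i,D - 1) = char_poly_matrix ?T $$ (i,D - 1)" using that ij by (simp add: Y_def)
      also have "\<dots> = (if i = D - 1 then [:0,1:] else 0) + [:coeff b i:]"
        unfolding cT[OF ij] using that ij by auto
      finally show ?thesis .
    qed
    show "Y $$ (i,j) = (if i = j then 1 else 0)" if "D \<le> i" "i < n" "j < n" for i j
      using that by (simp add: Y_def)
  qed (use False in simp)
  then obtain e where e: "e = 1 \<or> e = -1" "det Y = e * b" by blast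
  have "char_poly ?T = e * (det ?Z * b)" unfolding cp e(2) by (rule mult.left_commute)
  then show ?thesis using e(1) by blast
qed

lemma flag_entries:
  fixes T :: "'a::field mat"
  assumes fl: "flag n T D E" and T: "T \<in> carrier_mat n n" and j: "j < D"
  shows "D \<le> i \<Longrightarrow> i < n \<Longrightarrow> T $$ (i,j) = 0"
    and "j \<notin> E \<Longrightarrow> Suc j < D" and "j \<notin> E \<Longrightarrow> i < n \<Longrightarrow> T $$ (i,j) = (if i = Suc j then 1 else 0)"
proof -
  have D: "D \<le> n" using fl by (simp add: flag_def)
  have col: "(T *\<^sub>v unit_vec n j) $ i = T $$ (i,j)" if "i < n" for i
    using that j D T by (simp add: mult_unit_vec[OF T])
  have *: "if j \<in> E then supp_below n D (T *\<^sub>v unit_vec n j)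
            else Suc j < D \<and> T *\<^sub>v unit_vec n j = unit_vec n (Suc j)"
    using fl j by (simp add: flag_def)
  show "T $$ (i,j) = 0" if i: "D \<le> i" "i < n"
  proof (cases "j \<in> E")
    case True
    then show ?thesis using * col[OF i(2)] i by (simp add: supp_below_def)
  next
    case False
    then show ?thesis using * col[OF i(2)] i by (simp add: unit_vec_def)
  qed
  show "Suc j < D" if "j \<notin> E" using * that by simp
  show "T $$ (i,j) = (if i = Suc j then 1 else 0)" if "j \<notin> E" "i < n"
    using * that col[OF that(2)] by (simp add: unit_vec_def)
qed

text \<open>\<open>K\<close> is built from the remainders of the last \<open>r\<close> columns of
  \<open>U\<close>, which belong to the diagonal entries outside the product. The characteristic
  polynomial on the quotient then divides \<open>q\<close>, and the cofactor is prescribed on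
  \<open>K\<close>.\<close>

lemma assign_char_poly:
  fixes M :: "'a::field mat" and q :: "'a poly"
  assumes M: "M \<in> carrier_mat n n" and kr: "k + r = n"
    and UV: "inverse_pair n U U'" "inverse_pair n V V'"
    and Dg: "Dg \<in> carrier_mat n n" "\<And>i j. i < n \<Longrightarrow> j < n \<Longrightarrow> i \<noteq> j \<Longrightarrow> Dg $$ (i,j) = 0"
    and smith: "char_poly_matrix M = U * Dg * V"
    and q: "degree q = n" "q \<noteq> 0" "(\<Prod>i<k. Dg $$ (i,i)) dvd q"
  shows "\<exists>M' E f h c. M' \<in> carrier_mat n n \<and> finite (E :: nat set) \<and> card E \<le> r \<and>
    (\<forall>i<n. \<forall>j<n. M' $$ (i,j) = M $$ (i,j) + (\<Sum>e\<in>E. f e i * h e j)) \<and> c \<noteq> 0 \<and> char_poly M' = smult c q"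
proof -
  have uc: "U \<in> carrier_mat n n" using UV by (auto simp: inverse_pair_def)
  obtain Q Y where Q: "Q \<in> carrier_mat n n" and Y: "Y \<in> carrier_mat n n"
    and UQ: "U = char_poly_matrix M * Q + lift_mat Y"
    using mod_char_poly_matrix[OF M uc] by blast
  have "col Y (k + i) \<in> carrier_vec n" for i using Y by (simp add: carrier_vecI)
  then obtain S S' D E where S: "inverse_pair n S S'" and fl: "flag n (S' * M * S) D E" and E: "card E \<le> r"
    and Yk: "\<And>i. i < r \<Longrightarrow> supp_below n D (S' *\<^sub>v col Y (k + i))"
    using exists_flag[OF M, of r "\<lambda>i. col Y (k + i)"] by blast
  define T where "T = S' * M * S"
  have c: "S \<in> carrier_mat n n" "S' \<in> carrier_mat n n" using S by (auto simp: inverse_pair_def)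
  have T: "T \<in> carrier_mat n n" using c M by (simp add: T_def)
  note fl = fl[folded T_def]
  have D: "D \<le> n" "E \<subseteq> {..<D}" using fl by (auto simp: flag_def)
  have low: "T $$ (i,j) = 0" if "D \<le> i" "i < n" "j < D" for i j
    using flag_entries(1)[OF fl T] that by blast
  let ?Z = "mat n n (\<lambda>(i,j). if i < D then (if i = j then 1 else 0) else char_poly_matrix T $$ (i,j))"
  have "det ?Z dvd (\<Prod>i<k. Dg $$ (i,i))"
    unfolding T_def
  proof (rule flag_block_dvd[OF M S _ UV Dg smith Q Y UQ])
    show "(S' * M * S) $$ (i,j) = 0" if "D \<le> i" "i < n" "j < D" for i j using low[OF that] by (simp add: T_def)
    show "(S' * Y) $$ (i,j) = 0" if "D \<le> i" "i < n" "k \<le> j" "j < n" for i j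
    proof -
      have "(S' *\<^sub>v col Y (k + (j - k))) $ i = 0"
        using Yk[of "j - k"] that kr unfolding supp_below_def by auto
      then show ?thesis using that c Y by simp
    qed
  qed (use kr in auto)
  then have "det ?Z dvd q" using q(3) by (rule dvd_trans)
  then obtain b0 where b0: "q = det ?Z * b0" by (elim dvdE)
  then have nz: "det ?Z \<noteq> 0" "b0 \<noteq> 0" using q(2) by auto
  define N where "N b = mat n n (\<lambda>(i,j). if j < D then (if Suc j < D then (if i = Suc j then 1 else 0)
      else (if i < D then - coeff b i else 0)) else T $$ (i,j))" for b :: "'a poly"
  have Nc: "N b \<in> carrier_mat n n" for b by (simp add: N_def)
  have rep: "\<exists>e. (e = 1 \<or> e = -1) \<and> char_poly (N b) = e * (det ?Z * b)"
    if "degree b = D" "lead_coeff b = 1" for b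
    unfolding N_def by (rule char_poly_replace_block[OF T D(1) low that])
  \<comment> \<open>The degree of \<open>det ?Z\<close> is read off from the block replacement with
    \<open>b = s^D\<close>, since a characteristic polynomial of order \<open>n\<close> has degree
    \<open>n\<close>.\<close>
  have degZ: "degree (det ?Z) + D = n"
  proof -
    let ?m = "monom (1::'a) D"
    have m: "degree ?m = D" "lead_coeff ?m = 1" by (simp_all add: degree_monom_eq)
    obtain e where e: "e = 1 \<or> e = -1" "char_poly (N ?m) = e * (det ?Z * ?m)" using rep[OF m] by blast
    have "degree (char_poly (N ?m)) = n" using degree_monic_char_poly[OF Nc] by simp
    moreover have "degree (char_poly (N ?m)) = degree (det ?Z * ?m)" using e by auto
    ultimately show ?thesis using nz(1) m(1) by (simp add: degree_mult_eq)
  qed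
  \<comment> \<open>The companion block needs a monic polynomial; the leading coefficient goes into
    the constant \<open>cc\<close>.\<close>
  define b where "b = smult (inverse (lead_coeff b0)) b0"
  have "degree q = degree (det ?Z) + degree b0" using b0 nz by (simp add: degree_mult_eq)
  then have "degree b0 = D" using degZ q(1) by simp
  then have b: "degree b = D" "lead_coeff b = 1" using nz by (auto simp: b_def)
  obtain e where e: "e = 1 \<or> e = -1" "char_poly (N b) = e * (det ?Z * b)" using rep[OF b] by blast
  have "det ?Z * b = smult (inverse (lead_coeff b0)) q" by (simp add: b_def b0)
  then have "\<exists>c. c \<noteq> 0 \<and> char_poly (N b) = smult c q"
    using e nz by (intro exI[of _ "if e = 1 then inverse (lead_coeff b0) else - inverse (lead_coeff b0)"]) auto
  then obtain cc where cc: "cc \<noteq> 0" "char_poly (N b) = smult cc q" by blast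
  define M' where "M' = S * N b * S'"
  have M'c: "M' \<in> carrier_mat n n"
    unfolding M'_def by (rule mult_carrier_mat[OF mult_carrier_mat[OF c(1) Nc] c(2)])
  have "similar_mat M' (N b)"
    by (rule similar_matI[of _ _ S S' n]) (use S c Nc M'c in \<open>auto simp: M'_def inverse_pair_def\<close>)
  then have cp: "char_poly M' = smult cc q" using char_poly_similar[of M' "N b"] cc(2) by simp
  \<comment> \<open>\<open>S (N b - T) S'\<close> is a sum of columns times rows, in which only the
    indices in \<open>E\<close> contribute.\<close>
  define f where "f e i = (S * (N b - T)) $$ (i,e)" for e i
  define h where "h e j = S' $$ (e,j)" for e j
  have ent: "M' $$ (i,j) = M $$ (i,j) + (\<Sum>e\<in>E. (S * (N b - T)) $$ (i,e) * S' $$ (e,j))" if ij: "i < n" "j < n" for i j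
  proof -
    let ?K = "N b - T"
    have K: "?K \<in> carrier_mat n n" by (rule minus_carrier_mat[OF T])
    have SK: "S * ?K \<in> carrier_mat n n" by (rule mult_carrier_mat[OF c(1) K])
    \<comment> \<open>Off \<open>E\<close>, a column of \<open>T\<close> with index less than
      \<open>D\<close> already is a companion column; from \<open>D\<close> on, \<open>N b\<close>
      copies \<open>T\<close>.\<close>
    have K0: "?K $$ (i,e) = 0" if "e \<notin> E" "e < n" "i < n" for i e
      using that flag_entries(2,3)[OF fl T, of e] T by (cases "e < D") (auto simp: N_def)
    have "S * T * S' = M"
      using S c M unfolding T_def inverse_pair_def
      by (simp add: assoc_mult_mat[of _ n n _ n _ n] mat_inverse_cancel[of _ n])
    moreover have "S * ?K * S' = S * N b * S' - S * T * S'"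
    proof -
      have "S * ?K = S * N b - S * T" by (rule mult_minus_distrib_mat[OF c(1) Nc T])
      then show ?thesis
        using minus_mult_distrib_mat[OF mult_carrier_mat[OF c(1) Nc] mult_carrier_mat[OF c(1) T] c(2)] by simp
    qed
    ultimately have "M' $$ (i,j) = M $$ (i,j) + (S * ?K * S') $$ (i,j)"
      using ij M M'c by (simp add: M'_def del: index_mult_mat(1))
    also have "(S * ?K * S') $$ (i,j) = (\<Sum>e = 0..<n. (S * ?K) $$ (i,e) * S' $$ (e,j))"
      by (rule index_mult_sum[OF SK c(2) ij])
    also have "\<dots> = (\<Sum>e\<in>E. (S * ?K) $$ (i,e) * S' $$ (e,j))"
    proof (intro sum.mono_neutral_right ballI)
      fix e assume "e \<in> {0..<n} - E"
      then have "(S * ?K) $$ (i,e) = 0"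
        using ij K0 D by (subst index_mult_sum[OF c(1) K]) auto
      then show "(S * ?K) $$ (i,e) * S' $$ (e,j) = 0" by simp
    qed (use D in auto)
    finally show ?thesis .
  qed
  have "\<forall>i<n. \<forall>j<n. M' $$ (i,j) = M $$ (i,j) + (\<Sum>e\<in>E. f e i * h e j)"
    unfolding f_def h_def using ent by blast
  then show ?thesis
    using M'c E cc(1) cp finite_subset[OF D(2) finite_lessThan] by blast
qed

section \<open>Reversal of polynomials\<close>

text \<open>Meaningful only for \<open>degree p \<le> k\<close>, since the subtraction truncates.\<close>

definition rev_poly :: "nat \<Rightarrow> 'a::field poly \<Rightarrow> 'a poly" where
  "rev_poly k p = monom 1 (k - degree p) * reflect_poly p"

lemma coeff_rev_poly:
  "degree p \<le> k \<Longrightarrow> coeff (rev_poly k p) i = (if i \<le> k then coeff p (k - i) else 0)"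
  by (auto simp: rev_poly_def coeff_monom_mult coeff_reflect_poly coeff_eq_0)

lemma degree_rev_poly_le: "degree p \<le> k \<Longrightarrow> degree (rev_poly k p) \<le> k"
  by (rule degree_le) (simp add: coeff_rev_poly)

lemma rev_poly_rev_poly: "degree p \<le> k \<Longrightarrow> rev_poly k (rev_poly k p) = p"
  by (rule poly_eqI) (auto simp: coeff_rev_poly degree_rev_poly_le coeff_eq_0)

lemma rev_poly_add:
  "degree p \<le> k \<Longrightarrow> degree q \<le> k \<Longrightarrow> rev_poly k (p + q) = rev_poly k p + rev_poly k q"
  by (rule poly_eqI) (simp add: coeff_rev_poly degree_add_le)

lemma rev_poly_smult: "rev_poly k (smult c p) = smult c (rev_poly k p)"
  by (cases "c = 0") (simp_all add: rev_poly_def reflect_poly_smult)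

lemma rev_poly_sum:
  "(\<And>x. x \<in> S \<Longrightarrow> degree (f x) \<le> k) \<Longrightarrow> rev_poly k (sum f S) = (\<Sum>x\<in>S. rev_poly k (f x))"
proof (induction S rule: infinite_finite_induct)
  case (insert x F)
  then show ?case by (simp add: rev_poly_add degree_sum_le)
qed (simp_all add: rev_poly_def)

lemma rev_poly_mult:
  assumes "degree p \<le> k" "degree q \<le> l"
  shows "rev_poly (k + l) (p * q) = rev_poly k p * rev_poly l q"
proof (cases "p = 0 \<or> q = 0")
  case False
  then have "monom (1::'a) (k + l - degree (p * q)) = monom 1 (k - degree p) * monom 1 (l - degree q)"
    using assms by (simp add: mult_monom degree_mult_eq)
  then show ?thesis by (simp add: rev_poly_def reflect_poly_mult)
qed (auto simp: rev_poly_def)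

lemma degree_prod_le_card:
  fixes f :: "nat \<Rightarrow> 'a::field poly"
  shows "finite S \<Longrightarrow> (\<And>i. i \<in> S \<Longrightarrow> degree (f i) \<le> 1) \<Longrightarrow> degree (prod f S) \<le> card S"
proof (induction S rule: finite_induct)
  case (insert x F)
  have "degree (f x * prod f F) \<le> degree (f x) + degree (prod f F)" by (rule degree_mult_le)
  then show ?case using insert by fastforce
qed simp

lemma rev_poly_prod:
  fixes f :: "nat \<Rightarrow> 'a::field poly"
  assumes "finite S" "\<And>i. i \<in> S \<Longrightarrow> degree (f i) \<le> 1"
  shows "rev_poly (card S) (prod f S) = (\<Prod>i\<in>S. rev_poly 1 (f i))"
  using assms
proof (induction S rule: finite_induct)
  case (insert x F)
  have "degree (prod f F) \<le> card F" using insert by (intro degree_prod_le_card) auto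
  then have "rev_poly (1 + card F) (f x * prod f F) = rev_poly 1 (f x) * rev_poly (card F) (prod f F)"
    using insert.prems by (intro rev_poly_mult) auto
  then show ?case using insert by simp
qed (simp add: rev_poly_def)

text \<open>A Leibniz term has \<open>k\<close> factors of degree at most one, so its reversal at
  order \<open>k\<close> is the product of the reversals at order one.\<close>

lemma rev_poly_det:
  fixes B :: "'a::field poly mat"
  assumes B: "matrix_pencil k k B"
  shows "rev_poly k (det B) = det (map_mat (rev_poly 1) B)"
proof -
  have Bc: "B \<in> carrier_mat k k" using B by (simp add: matrix_pencil_def)
  let ?t = "\<lambda>p. \<Prod>i = 0..<k. B $$ (i, p i)"
  have entry: "degree (B $$ (i, p i)) \<le> 1" if "p permutes {0..<k}" "i < k" for p i
    using B that permutes_in_image[OF that(1), of i] by (simp add: matrix_pencil_def)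
  have dt: "degree (?t p) \<le> k" if "p permutes {0..<k}" for p
    using degree_prod_le_card[of "{0..<k}" "\<lambda>i. B $$ (i, p i)"] entry[OF that] by simp
  have sgn: "signof p * q = smult (of_int (sign p)) q" for p and q :: "'a poly"
    by (simp add: sign_def)
  have rt: "rev_poly k (?t p) = (\<Prod>i = 0..<k. map_mat (rev_poly 1) B $$ (i, p i))" if "p permutes {0..<k}" for p
  proof -
    have "rev_poly k (?t p) = (\<Prod>i = 0..<k. rev_poly 1 (B $$ (i, p i)))"
      using rev_poly_prod[of "{0..<k}" "\<lambda>i. B $$ (i, p i)"] entry[OF that] by simp
    also have "\<dots> = (\<Prod>i = 0..<k. map_mat (rev_poly 1) B $$ (i, p i))"
      using Bc permutes_in_image[OF that] by (intro prod.cong) auto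
    finally show ?thesis .
  qed
  have "rev_poly k (det B) = (\<Sum>p | p permutes {0..<k}. rev_poly k (smult (of_int (sign p)) (?t p)))"
    unfolding det_def'[OF Bc] sgn
    by (rule rev_poly_sum) (use dt degree_smult_le order_trans in \<open>blast\<close>)
  also have "\<dots> = (\<Sum>p | p permutes {0..<k}. signof p * (\<Prod>i = 0..<k. map_mat (rev_poly 1) B $$ (i, p i)))"
    by (intro sum.cong refl) (simp add: rev_poly_smult rt sgn)
  also have "\<dots> = det (map_mat (rev_poly 1) B)"
    using Bc by (intro det_def'[symmetric]) auto
  finally show ?thesis .
qed

lemma matrix_pencil_rev: "matrix_pencil m n A \<Longrightarrow> matrix_pencil m n (map_mat (rev_poly 1) A)"
  unfolding matrix_pencil_def
  by (intro conjI allI impI) (auto intro!: degree_rev_poly_le simp del: One_nat_def)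

lemma minors_rev:
  fixes A :: "'a::field poly mat"
  assumes A: "matrix_pencil m n A" and x: "x \<in> minors k A"
  shows "rev_poly k x \<in> minors k (map_mat (rev_poly 1) A)"
proof -
  let ?R = "map_mat (rev_poly 1) A"
  obtain I J where IJ: "I \<subseteq> {..<dim_row A}" "J \<subseteq> {..<dim_col A}" "card I = k" "card J = k"
    "x = det (submatrix A I J)" using x unfolding minors_def by blast
  have pk: "pick I i < dim_row A" "pick J i < dim_col A" if "i < k" for i
    using pick_in_set_le[of i I] pick_in_set_le[of i J] that IJ by auto
  have sub: "submatrix A I J = mat k k (\<lambda>(i,j). A $$ (pick I i, pick J j))"
    using IJ by (intro submatrix_eq_mat) auto
  have subR: "submatrix ?R I J = mat k k (\<lambda>(i,j). ?R $$ (pick I i, pick J j))"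
    using IJ by (intro submatrix_eq_mat) auto
  have "submatrix ?R I J = map_mat (rev_poly 1) (submatrix A I J)"
    unfolding sub subR using pk by (intro eq_matI) auto
  moreover have "matrix_pencil k k (submatrix A I J)"
    using A pk by (auto simp: sub matrix_pencil_def)
  ultimately have "rev_poly k x = det (submatrix ?R I J)"
    using rev_poly_det IJ(5) by metis
  then show ?thesis using IJ(1-4) unfolding minors_def by auto
qed

lemma rev_poly_1: "rev_poly 1 p = [:coeff p 1, coeff p 0:]" if "degree p \<le> 1"
  using that by (intro poly_eqI) (auto simp: coeff_rev_poly coeff_pCons split: nat.splits)

lemma poly_split_monom:
  fixes p :: "'a::field poly"
  assumes "p \<noteq> 0"
  obtains a p' where "p = monom 1 a * p'" "coeff p' 0 \<noteq> 0"
proof -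
  define a where "a = (LEAST i. coeff p i \<noteq> 0)"
  have "coeff p (degree p) \<noteq> 0" using assms by simp
  then have a: "coeff p a \<noteq> 0" unfolding a_def by (rule LeastI)
  have "coeff p i = 0" if "i < a" for i using not_less_Least[OF that[unfolded a_def]] by simp
  then have "monom 1 a dvd p" by (simp add: monom_1_dvd_iff')
  then obtain p' where "p = monom 1 a * p'" by (elim dvdE)
  moreover from this have "coeff p' 0 \<noteq> 0" using a by (simp add: coeff_monom_mult)
  ultimately show ?thesis by (rule that)
qed

text \<open>\<open>reflect_poly\<close> reverses from the actual degree, so a power of the variable
  leaves no trace.\<close>

lemma reflect_poly_monom_mult:
  fixes p :: "'a::field poly"
  shows "reflect_poly (monom 1 a * p) = reflect_poly p"
proof -
  have "reflect_poly (monom 1 a) = (1 :: 'a poly)"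
    by (rule poly_eqI) (auto simp: coeff_reflect_poly degree_monom_eq)
  then show ?thesis by (simp add: reflect_poly_mult)
qed

text \<open>
  Away from the prime \<open>w\<close> reversal preserves divisibility; the power of \<open>w\<close> dividing all
  reversed minors is controlled by a minor of large degree.
\<close>

lemma dvd_rev_poly:
  fixes q :: "'a::field poly"
  assumes gcd: "\<And>d. (\<And>x. x \<in> S \<Longrightarrow> d dvd x) \<Longrightarrow> d dvd q"
    and x0: "x0 \<in> S" "x0 \<noteq> 0" "degree q \<le> n - k + degree x0" and k: "k \<le> n"
    and d: "\<And>x. x \<in> S \<Longrightarrow> d dvd rev_poly k x"
  shows "d dvd rev_poly n q"
proof -
  have d0: "d dvd monom 1 (k - degree x0) * reflect_poly x0" using d[OF x0(1)] by (simp add: rev_poly_def)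
  then have "d \<noteq> 0" using x0(2) by auto
  then obtain a d' where d': "d = monom 1 a * d'" "coeff d' 0 \<noteq> 0" by (rule poly_split_monom)
  have "reflect_poly d' dvd x" if x: "x \<in> S" for x
  proof (cases "x = 0")
    case False
    then obtain b x' where x': "x = monom 1 b * x'" "coeff x' 0 \<noteq> 0" by (rule poly_split_monom)
    obtain e where "rev_poly k x = d' * e" using d[OF x] d'(1) by (metis dvdE mult.assoc mult.commute)
    then have "reflect_poly (rev_poly k x) = reflect_poly d' * reflect_poly e" by (simp add: reflect_poly_mult)
    moreover have "reflect_poly (rev_poly k x) = x'"
      using x' by (simp add: rev_poly_def reflect_poly_monom_mult)
    ultimately show ?thesis using x'(1) by (metis dvd_mult dvd_triv_left)
  qed simp
  then have "reflect_poly d' dvd q" by (rule gcd)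
  then have "d' dvd reflect_poly q"
    using d'(2) by (metis dvdE dvdI reflect_poly_mult reflect_poly_reflect_poly)
  \<comment> \<open>The reflected \<open>x0\<close> has a nonzero constant term, so
    \<open>k - degree x0\<close> is the exact power of the variable in its reversal.\<close>
  moreover have "monom (1::'a) a dvd monom 1 (n - degree q)"
  proof -
    have "monom 1 a dvd monom 1 (k - degree x0) * reflect_poly x0"
      using d0 d'(1) by (metis dvd_mult_left)
    then have "coeff (monom 1 (k - degree x0) * reflect_poly x0) i = 0" if "i < a" for i
      using that by (simp add: monom_1_dvd_iff')
    moreover have "coeff (monom 1 (k - degree x0) * reflect_poly x0) (k - degree x0) \<noteq> 0"
      using x0(2) by (simp add: coeff_monom_mult)
    ultimately have "a \<le> k - degree x0" by (meson not_le_imp_less)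
    also have "\<dots> \<le> n - degree q" using x0(3) k by simp
    finally show ?thesis by (simp add: monom_1_dvd_iff' coeff_monom)
  qed
  ultimately show ?thesis unfolding d'(1) rev_poly_def by (intro mult_dvd_mono)
qed

section \<open>Construction of the perturbation\<close>

lemma inverse_pair_exists:
  fixes A :: "'a::field mat"
  assumes A: "A \<in> carrier_mat n n" and d: "det A \<noteq> 0"
  obtains A' where "inverse_pair n A A'"
proof -
  have "A \<in> Units (ring_mat TYPE('a) n undefined)" by (rule det_non_zero_imp_unit[OF A d])
  then obtain A' where "A' \<in> carrier_mat n n" "A' * A = 1\<^sub>m n" "A * A' = 1\<^sub>m n"
    unfolding Units_def ring_mat_def by auto
  then show ?thesis using A that by (simp add: inverse_pair_def)
qed

text \<open>With an invertible leading matrix the pencil is \<open>A1 (s - M)\<close>. The factor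
  \<open>A1\<close> keeps common divisors of the minors and changes the determinant by a constant
  only.\<close>

lemma perturb_leading_regular:
  fixes A :: "'a::field poly mat" and q :: "'a poly"
  assumes A: "matrix_pencil n n A" and dA: "det (map_mat (\<lambda>p. coeff p 1) A) \<noteq> 0"
    and q: "degree q = n" "q \<noteq> 0" and kr: "k + r = n"
    and gcd: "\<And>d. (\<And>x. x \<in> minors k A \<Longrightarrow> d dvd x) \<Longrightarrow> d dvd q"
  shows "\<exists>E f h c. finite (E :: nat set) \<and> card E \<le> r \<and> c \<noteq> 0 \<and>
    det (A + mat n n (\<lambda>(i,j). [:\<Sum>e\<in>E. f e i * h e j:])) = smult c q"
proof -
  define A1 where "A1 = map_mat (\<lambda>p. coeff p 1) A"
  \<comment> \<open>The sign is chosen so that \<open>A = s A1 - A0\<close>, hence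
    \<open>M = A1' * A0\<close>.\<close>
  define A0 where "A0 = map_mat (\<lambda>p. - coeff p 0) A"
  have Ac: "A \<in> carrier_mat n n" using A by (simp add: matrix_pencil_def)
  have A1: "A1 \<in> carrier_mat n n" and A0: "A0 \<in> carrier_mat n n" using Ac by (auto simp: A1_def A0_def)
  obtain A1' where inv: "inverse_pair n A1 A1'" using inverse_pair_exists[OF A1] dA by (auto simp: A1_def)
  have A1': "A1' \<in> carrier_mat n n" using inv by (simp add: inverse_pair_def)
  define M where "M = A1' * A0"
  have M: "M \<in> carrier_mat n n" using A1' A0 by (simp add: M_def)
  have A1M: "A1 * M = A0"
    unfolding M_def using inv A0 by (intro mat_inverse_cancel[of _ n]) (auto simp: inverse_pair_def)
  have lA1: "lift_mat A1 \<in> carrier_mat n n" using A1 by simp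
  have CM: "char_poly_matrix M \<in> carrier_mat n n" using M by simp
  have A_eq: "A = lift_mat A1 * char_poly_matrix M"
  proof -
    have "lift_mat A1 * char_poly_matrix M =
        lift_mat A1 * ([:0,1:] \<cdot>\<^sub>m 1\<^sub>m n) - lift_mat A1 * lift_mat M"
      unfolding char_poly_matrix_eq[OF M] by (rule mult_minus_distrib_mat[OF lA1]) (use M in auto)
    also have "lift_mat A1 * ([:0,1:] \<cdot>\<^sub>m 1\<^sub>m n) = [:0,1:] \<cdot>\<^sub>m lift_mat A1"
      using mult_smult_distrib[OF lA1, of "1\<^sub>m n" n "[:0,1:]"] lA1 by simp
    also have "lift_mat A1 * lift_mat M = lift_mat A0"
      using const_poly.mat_hom_mult[OF A1 M] A1M by simp
    also have "[:0,1:] \<cdot>\<^sub>m lift_mat A1 - lift_mat A0 = A"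
    proof (rule eq_matI)
      fix i j assume "i < dim_row A" "j < dim_col A"
      then have ij: "i < n" "j < n" using Ac by auto
      then have "degree (A $$ (i,j)) \<le> 1" using A by (simp add: matrix_pencil_def)
      then have "A $$ (i,j) = [:coeff (A $$ (i,j)) 0, coeff (A $$ (i,j)) 1:]"
        by (intro poly_eqI) (auto simp: coeff_pCons coeff_eq_0 split: nat.splits)
      then show "([:0,1:] \<cdot>\<^sub>m lift_mat A1 - lift_mat A0) $$ (i,j) = A $$ (i,j)"
        using ij Ac by (simp add: A1_def A0_def)
    qed (use A1 A0 Ac in auto)
    finally show ?thesis ..
  qed
  obtain Dg where Dg: "unimod_equiv n (char_poly_matrix M) Dg" "smith_upto n n Dg"
    using smith_form[OF CM] .
  then obtain U U' V V' where UV: "inverse_pair n U U'" "inverse_pair n V V'" and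
    smith: "char_poly_matrix M = U * Dg * V" and Dgc: "Dg \<in> carrier_mat n n"
    unfolding unimod_equiv_def inverse_pair_def by blast
  have uc: "U \<in> carrier_mat n n" "V \<in> carrier_mat n n" using UV by (auto simp: inverse_pair_def)
  let ?g = "\<Prod>i<k. Dg $$ (i,i)"
  have "?g dvd x" if "x \<in> minors k (Dg * V)" for x
    using minors_mult_right_dvd[OF Dgc uc(2) smith_minors_dvd[OF Dgc Dg(2)] that] by blast
  moreover have DV: "Dg * V \<in> carrier_mat n n" using Dgc uc by simp
  ultimately have "?g dvd x" if "x \<in> minors k (U * (Dg * V))" for x
    using minors_mult_left_dvd[OF uc(1) DV _ that] by blast
  then have "?g dvd x" if "x \<in> minors k (char_poly_matrix M)" for x
    using that smith assoc_mult_mat[OF uc(1) Dgc uc(2)] by simp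
  then have "?g dvd x" if "x \<in> minors k A" for x
    using that unfolding A_eq using minors_mult_left_dvd[OF lA1 CM] by blast
  then have gq: "?g dvd q" by (rule gcd)
  have Dg0: "Dg $$ (i,j) = 0" if "i < n" "j < n" "i \<noteq> j" for i j
    using smith_uptoD(1)[OF Dg(2)] that by metis
  obtain M' E f h c where M': "M' \<in> carrier_mat n n" and E: "finite (E :: nat set)" "card E \<le> r"
    and ent: "\<And>i j. i < n \<Longrightarrow> j < n \<Longrightarrow> M' $$ (i,j) = M $$ (i,j) + (\<Sum>e\<in>E. f e i * h e j)"
    and c: "c \<noteq> 0" "char_poly M' = smult c q"
    using assign_char_poly[OF M kr UV Dgc Dg0 smith q gq] by blast
  \<comment> \<open>The minus sign comes from \<open>s - M' = (s - M) - (M' - M)\<close>; left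
    multiplication by \<open>A1\<close> affects the column vectors only.\<close>
  define f' where "f' e i = - (\<Sum>l = 0..<n. A1 $$ (i,l) * f e l)" for e i
  let ?P = "mat n n (\<lambda>(i,j). [:\<Sum>e\<in>E. f' e i * h e j:])"
  have CM': "char_poly_matrix M' \<in> carrier_mat n n" using M' by simp
  have "lift_mat A1 * char_poly_matrix M' = A + ?P"
  proof (rule eq_matI)
    fix i j assume "i < dim_row (A + ?P)" "j < dim_col (A + ?P)"
    then have ij: "i < n" "j < n" by auto
    have diff: "char_poly_matrix M' $$ (l,j) = char_poly_matrix M $$ (l,j) - [:\<Sum>e\<in>E. f e l * h e j:]" if "l < n" for l
      using that ij M M' ent[of l j] by (simp add: char_poly_matrix_def)
    have "(lift_mat A1 * char_poly_matrix M') $$ (i,j) =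
        (\<Sum>l = 0..<n. lift_mat A1 $$ (i,l) * char_poly_matrix M' $$ (l,j))"
      by (rule index_mult_sum[OF lA1 CM' ij])
    also have "\<dots> = (\<Sum>l = 0..<n. lift_mat A1 $$ (i,l) * char_poly_matrix M $$ (l,j)) -
        (\<Sum>l = 0..<n. [:A1 $$ (i,l) * (\<Sum>e\<in>E. f e l * h e j):])"
      unfolding sum_subtractf[symmetric]
      by (intro sum.cong refl) (use ij A1 in \<open>simp add: diff right_diff_distrib\<close>)
    also have "(\<Sum>l = 0..<n. lift_mat A1 $$ (i,l) * char_poly_matrix M $$ (l,j)) = A $$ (i,j)"
      unfolding A_eq by (rule index_mult_sum[OF lA1 CM ij, symmetric])
    also have "(\<Sum>l = 0..<n. [:A1 $$ (i,l) * (\<Sum>e\<in>E. f e l * h e j):]) =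
        [:\<Sum>l = 0..<n. A1 $$ (i,l) * (\<Sum>e\<in>E. f e l * h e j):]"
      by (rule const_poly.hom_sum[symmetric])
    also have "(\<Sum>l = 0..<n. A1 $$ (i,l) * (\<Sum>e\<in>E. f e l * h e j)) = - (\<Sum>e\<in>E. f' e i * h e j)"
    proof -
      have "(\<Sum>l = 0..<n. A1 $$ (i,l) * (\<Sum>e\<in>E. f e l * h e j)) =
          (\<Sum>e\<in>E. \<Sum>l = 0..<n. A1 $$ (i,l) * (f e l * h e j))"
        unfolding sum_distrib_left by (rule sum.swap)
      also have "\<dots> = (\<Sum>e\<in>E. - (f' e i * h e j))"
        by (intro sum.cong refl) (simp add: f'_def sum_distrib_right mult.assoc)
      finally show ?thesis by (simp add: sum_negf)
    qed
    finally show "(lift_mat A1 * char_poly_matrix M') $$ (i,j) = (A + ?P) $$ (i,j)"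
      using ij by simp
  qed (use A1 carrier_matD[OF CM'] in auto)
  then have "det (A + ?P) = det (lift_mat A1) * char_poly M'"
    using det_mult[OF lA1 CM'] by (simp add: char_poly_def)
  also have "\<dots> = smult (det A1 * c) q" by (simp add: c(2) mult.commute)
  finally show ?thesis using E c(1) dA by (intro exI[of _ E] exI[of _ f'] exI[of _ h] exI[of _ "det A1 * c"]) (auto simp: A1_def)
qed

text \<open>Reversal exchanges zero and infinity: the constant matrix becomes the leading one, and
  \<open>coeff q 0 \<noteq> 0\<close> gives the reversed \<open>q\<close> degree exactly
  \<open>n\<close>. A constant perturbation comes back as a multiple of \<open>s\<close>.\<close>

lemma perturb_at_zero:
  fixes A :: "'a::field poly mat" and q :: "'a poly"
  assumes A: "matrix_pencil n n A" and dA: "det (map_mat (\<lambda>p. coeff p 0) A) \<noteq> 0"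
    and q: "degree q \<le> n" "coeff q 0 \<noteq> 0" and kr: "k + r = n"
    and gcd: "\<And>d. (\<And>x. x \<in> minors k A \<Longrightarrow> d dvd x) \<Longrightarrow> d dvd q"
    and x0: "x0 \<in> minors k A" "x0 \<noteq> 0" "degree q \<le> r + degree x0"
  shows "\<exists>E f h c. finite (E :: nat set) \<and> card E \<le> r \<and> c \<noteq> 0 \<and>
    det (A + mat n n (\<lambda>(i,j). [:0, \<Sum>e\<in>E. f e i * h e j:])) = smult c q"
proof -
  let ?A = "map_mat (rev_poly 1) A" and ?q = "rev_poly n q"
  have Ac: "A \<in> carrier_mat n n" using A by (simp add: matrix_pencil_def)
  have deg: "degree (A $$ (i,j)) \<le> 1" if "i < n" "j < n" for i j using A that by (simp add: matrix_pencil_def)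
  have RA: "matrix_pencil n n ?A" by (rule matrix_pencil_rev[OF A])
  have "map_mat (\<lambda>p. coeff p 1) ?A = map_mat (\<lambda>p. coeff p 0) A"
    using Ac deg by (intro eq_matI) (auto simp: coeff_rev_poly simp del: One_nat_def)
  then have dRA: "det (map_mat (\<lambda>p. coeff p 1) ?A) \<noteq> 0" using dA by simp
  have "coeff ?q n = coeff q 0" using q by (simp add: coeff_rev_poly)
  then have Rq: "degree ?q = n" "?q \<noteq> 0"
    using q degree_rev_poly_le[OF q(1)] le_degree[of ?q n] by auto
  have "d dvd ?q" if "\<And>x. x \<in> minors k ?A \<Longrightarrow> d dvd x" for d
    by (rule dvd_rev_poly[OF gcd x0(1,2), of n k]) (use x0(3) kr that minors_rev[OF A] in auto)
  from perturb_leading_regular[OF RA dRA Rq kr this]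
  obtain E f h c where E: "finite (E :: nat set)" "card E \<le> r" "c \<noteq> 0"
    and det: "det (?A + mat n n (\<lambda>(i,j). [:\<Sum>e\<in>E. f e i * h e j:])) = smult c ?q" by blast
  let ?B = "?A + mat n n (\<lambda>(i,j). [:\<Sum>e\<in>E. f e i * h e j:])"
  have B: "matrix_pencil n n ?B"
    using RA unfolding matrix_pencil_def by (auto intro!: degree_add_le simp del: One_nat_def)
  have "map_mat (rev_poly 1) ?B = A + mat n n (\<lambda>(i,j). [:0, \<Sum>e\<in>E. f e i * h e j:])"
  proof (rule eq_matI)
    fix i j assume "i < dim_row (A + mat n n (\<lambda>(i,j). [:0, \<Sum>e\<in>E. f e i * h e j:]))"
      "j < dim_col (A + mat n n (\<lambda>(i,j). [:0, \<Sum>e\<in>E. f e i * h e j:]))"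
    then have ij: "i < n" "j < n" by auto
    have c1: "rev_poly 1 [:c:] = [:0, c:]" for c :: 'a by (simp add: rev_poly_1[unfolded One_nat_def])
    show "map_mat (rev_poly 1) ?B $$ (i,j) = (A + mat n n (\<lambda>(i,j). [:0, \<Sum>e\<in>E. f e i * h e j:])) $$ (i,j)"
      using ij Ac deg[OF ij] rev_poly_add[of "rev_poly 1 (A $$ (i,j))" 1 "[:\<Sum>e\<in>E. f e i * h e j:]"]
        degree_rev_poly_le[OF deg[OF ij]] rev_poly_rev_poly[OF deg[OF ij]]
      by (simp add: c1 del: One_nat_def)
  qed (use Ac in auto)
  then have "det (A + mat n n (\<lambda>(i,j). [:0, \<Sum>e\<in>E. f e i * h e j:])) = rev_poly n (smult c ?q)"
    using rev_poly_det[OF B] det by simp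
  also have "\<dots> = smult c q" by (simp add: rev_poly_smult rev_poly_rev_poly q(1))
  finally show ?thesis using E by blast
qed

lemma minors_hom:
  assumes "comm_ring_hom h"
  shows "minors k (map_mat h A) = h ` minors k A"
proof -
  interpret comm_ring_hom h by fact
  have "det (submatrix (map_mat h A) I J) = h (det (submatrix A I J))"
    if "I \<subseteq> {..<dim_row A}" "J \<subseteq> {..<dim_col A}" "card I = k" "card J = k" for I J
  proof -
    have pk: "pick I i < dim_row A" "pick J i < dim_col A" if "i < k" for i
      using pick_in_set_le[of i I] pick_in_set_le[of i J] that \<open>I \<subseteq> _\<close> \<open>J \<subseteq> _\<close> \<open>card I = k\<close> \<open>card J = k\<close> by auto
    have "submatrix (map_mat h A) I J = map_mat h (submatrix A I J)"
      using submatrix_eq_mat[of I "map_mat h A" J k] submatrix_eq_mat[of I A J k] that pk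
      by (auto intro!: eq_matI)
    then show ?thesis by simp
  qed
  then show ?thesis unfolding minors_def by (auto simp: image_def) metis+
qed

lemma pcompose_hom: "comm_ring_hom (\<lambda>p. pcompose p (t :: 'a::comm_ring_1 poly))"
  by unfold_locales (auto simp: pcompose_add pcompose_mult pcompose_1)

text \<open>A shift moves \<open>z\<close> to zero; the factor \<open>s\<close> of the perturbation
  comes back as \<open>s - z\<close>.\<close>

lemma perturb_at_point:
  fixes A :: "'a::field poly mat" and q :: "'a poly" and z :: 'a
  assumes A: "matrix_pencil n n A" and dA: "det (map_mat (\<lambda>p. poly p z) A) \<noteq> 0"
    and q: "degree q \<le> n" "poly q z \<noteq> 0" and kr: "k + r = n"
    and gcd: "\<And>d. (\<And>x. x \<in> minors k A \<Longrightarrow> d dvd x) \<Longrightarrow> d dvd q"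
    and x0: "x0 \<in> minors k A" "x0 \<noteq> 0" "degree q \<le> r + degree x0"
  shows "\<exists>E f h c. finite (E :: nat set) \<and> card E \<le> r \<and> c \<noteq> 0 \<and>
    det (A + mat n n (\<lambda>(i,j). smult (\<Sum>e\<in>E. f e i * h e j) [:-z, 1:])) = smult c q"
proof -
  define sh where "sh p = pcompose p [:z, 1:]" for p
  define sh' where "sh' p = pcompose p [:-z, 1:]" for p
  interpret sh: comm_ring_hom sh unfolding sh_def by (rule pcompose_hom)
  interpret sh': comm_ring_hom sh' unfolding sh'_def by (rule pcompose_hom)
  have "pcompose [:z, 1:] [:-z, 1:] = [:0, 1:]" "pcompose [:-z, 1:] [:z, 1:] = [:0, 1:]"
    by (simp_all add: pcompose_pCons)
  then have sh'_sh: "sh' (sh p) = p" "sh (sh' p) = p" for p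
    unfolding sh_def sh'_def pcompose_assoc[symmetric] by (simp_all only: pcompose_idR)
  have deg: "degree (sh p) = degree p" for p by (simp add: sh_def degree_pcompose)
  have c0: "coeff (sh p) 0 = poly p z" for p by (simp add: sh_def poly_0_coeff_0[symmetric] poly_pcompose)
  have Ac: "A \<in> carrier_mat n n" using A by (simp add: matrix_pencil_def)
  let ?A = "map_mat sh A"
  have minors: "minors k ?A = sh ` minors k A" by (rule minors_hom) (rule sh.comm_ring_hom_axioms)
  have "matrix_pencil n n ?A" using A by (auto simp: matrix_pencil_def deg)
  moreover have "map_mat (\<lambda>p. coeff p 0) ?A = map_mat (\<lambda>p. poly p z) A"
    by (rule eq_matI) (auto simp: c0)
  then have "det (map_mat (\<lambda>p. coeff p 0) ?A) \<noteq> 0" using dA by simp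
  moreover have "degree (sh q) \<le> n" "coeff (sh q) 0 \<noteq> 0" using q by (simp_all add: deg c0)
  moreover note kr
  moreover have "d dvd sh q" if d: "\<And>x. x \<in> minors k ?A \<Longrightarrow> d dvd x" for d
  proof -
    have "sh' d dvd x" if "x \<in> minors k A" for x
      using sh'.hom_dvd[OF d[of "sh x"]] that by (simp add: minors sh'_sh)
    then have "sh' d dvd q" by (rule gcd)
    then show ?thesis using sh.hom_dvd[of "sh' d" q] by (simp add: sh'_sh)
  qed
  moreover have "sh x0 \<in> minors k ?A" using x0(1) by (simp add: minors)
  moreover have "sh x0 \<noteq> 0" using x0(2) sh'_sh(1)[of x0] by auto
  moreover have "degree (sh q) \<le> r + degree (sh x0)" using x0(3) by (simp add: deg)
  ultimately obtain E f h c where E: "finite (E :: nat set)" "card E \<le> r" "c \<noteq> 0"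
    and det: "det (?A + mat n n (\<lambda>(i,j). [:0, \<Sum>e\<in>E. f e i * h e j:])) = smult c (sh q)"
    using perturb_at_zero[of n ?A "sh q" k r "sh x0"] by blast
  let ?B = "?A + mat n n (\<lambda>(i,j). [:0, \<Sum>e\<in>E. f e i * h e j:])"
  have "map_mat sh' ?B = A + mat n n (\<lambda>(i,j). smult (\<Sum>e\<in>E. f e i * h e j) [:-z, 1:])"
  proof (rule eq_matI)
    have c1: "sh' [:0, c:] = smult c [:-z, 1:]" for c by (simp add: sh'_def pcompose_pCons)
    fix i j assume "i < dim_row (A + mat n n (\<lambda>(i,j). smult (\<Sum>e\<in>E. f e i * h e j) [:-z, 1:]))"
      "j < dim_col (A + mat n n (\<lambda>(i,j). smult (\<Sum>e\<in>E. f e i * h e j) [:-z, 1:]))"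
    then show "map_mat sh' ?B $$ (i,j) = (A + mat n n (\<lambda>(i,j). smult (\<Sum>e\<in>E. f e i * h e j) [:-z, 1:])) $$ (i,j)"
      using Ac by (simp add: sh'.hom_add sh'_sh c1)
  qed (use Ac in auto)
  then have "det (A + mat n n (\<lambda>(i,j). smult (\<Sum>e\<in>E. f e i * h e j) [:-z, 1:])) = sh' (smult c (sh q))"
    using sh'.hom_det[of ?B] det by simp
  also have "\<dots> = smult c q" using sh'_sh(1)[of q] by (simp add: sh'_def pcompose_smult)
  finally show ?thesis using E by blast
qed

section \<open>Low rank perturbations of regular pencils\<close>

text \<open>Multilinearity in the rows: each \<open>f\<close> decides for every row whether it is
  taken from \<open>A\<close> (value 0) or from \<open>P\<close> (value 1).\<close>

lemma det_add_induct:
  fixes A P :: "'a::comm_ring_1 mat"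
  assumes A: "A \<in> carrier_mat n n" and P: "P \<in> carrier_mat n n"
    and mixed: "\<And>Z I. Z \<in> carrier_mat n n \<Longrightarrow> I \<subseteq> {..<n} \<Longrightarrow>
      (\<And>i j. i \<in> I \<Longrightarrow> j < n \<Longrightarrow> Z $$ (i,j) = A $$ (i,j)) \<Longrightarrow>
      (\<And>i j. i < n \<Longrightarrow> i \<notin> I \<Longrightarrow> j < n \<Longrightarrow> Z $$ (i,j) = P $$ (i,j)) \<Longrightarrow> Q (det Z)"
    and add: "\<And>x y. Q x \<Longrightarrow> Q y \<Longrightarrow> Q (x + y)" and zero: "Q 0"
  shows "Q (det (A + P))"
proof -
  let ?a = "\<lambda>i c. if c = (0::nat) then row A i else row P i"
  let ?F = "{f. (\<forall>i\<in>{0..<n}. f i \<in> {0,1::nat}) \<and> (\<forall>i. i \<notin> {0..<n} \<longrightarrow> f i = i)}"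
  have rows: "A + P = mat\<^sub>r n n (\<lambda>i. finsum_vec TYPE('a) n (?a i) {0,1})"
  proof (rule eq_matI)
    fix i j assume "i < dim_row (mat\<^sub>r n n (\<lambda>i. finsum_vec TYPE('a) n (?a i) {0,1}))"
      "j < dim_col (mat\<^sub>r n n (\<lambda>i. finsum_vec TYPE('a) n (?a i) {0,1}))"
    then have ij: "i < n" "j < n" by auto
    have "finsum_vec TYPE('a) n (?a i) {0,1} $ j = (\<Sum>c\<in>{0,1}. ?a i c $ j)"
      by (rule index_finsum_vec) (use ij A P in auto)
    then show "(A + P) $$ (i,j) = mat\<^sub>r n n (\<lambda>i. finsum_vec TYPE('a) n (?a i) {0,1}) $$ (i,j)"
      using ij A P by simp
  qed (use A P in auto)
  have expand: "det (A + P) = (\<Sum>f\<in>?F. det (mat\<^sub>r n n (\<lambda>i. ?a i (f i))))"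
    unfolding rows by (rule det_linear_rows_sum) (use A P in auto)
  have each: "Q (det (mat\<^sub>r n n (\<lambda>i. ?a i (f i))))" for f
    by (rule mixed[of _ "{i. i < n \<and> f i = 0}"]) (use A P in auto)
  have "Q (\<Sum>f\<in>G. det (mat\<^sub>r n n (\<lambda>i. ?a i (f i))))" for G :: "(nat \<Rightarrow> nat) set"
    by (induction G rule: infinite_finite_induct) (use zero add each in auto)
  then show ?thesis unfolding expand .
qed

text \<open>
  Expanding the determinant along rows: a term with fewer than \<open>n - r\<close> rows from \<open>A\<close> has more
  than \<open>r\<close> rows from \<open>P\<close> and vanishes.
\<close>

context
  fixes A P :: "'a::field poly mat" and n r :: nat
  assumes A: "matrix_pencil n n A" and P: "matrix_pencil n n P" and r: "normal_rank P \<le> r" "r \<le> n"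
begin

lemma minors_above_rank: "x \<in> minors (Suc r) P \<Longrightarrow> x = 0"
proof -
  assume "x \<in> minors (Suc r) P"
  interpret h: inj_comm_ring_hom "to_fract :: 'a poly \<Rightarrow> 'a poly fract" by (unfold_locales, auto)
  have Pc: "P \<in> carrier_mat n n" using P by (simp add: matrix_pencil_def)
  have "to_fract x \<in> minors (Suc r) (map_mat to_fract P)"
    using \<open>x \<in> _\<close> minors_hom[OF h.comm_ring_hom_axioms] by blast
  then obtain I J where IJ: "J \<subseteq> {..<n}" "card J = Suc r" "to_fract x = det (submatrix (map_mat to_fract P) I J)"
    using Pc unfolding minors_def by auto
  show "x = 0"
  proof (rule ccontr)
    assume "x \<noteq> 0"
    then have "det (submatrix (map_mat to_fract P) I J) \<noteq> 0" using IJ(3) by (metis h.hom_0_iff)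
    then have "card {j. j < n \<and> j \<in> J} \<le> vec_space.rank n (map_mat to_fract P)"
      using Pc by (intro vec_space.rank_gt_minor) auto
    moreover have "{j. j < n \<and> j \<in> J} = J" using IJ(1) by auto
    ultimately show False using IJ(2) r(1) normal_rank_eq[OF Pc] by simp
  qed
qed

lemma mixed_det_zero:
  assumes "Z \<in> carrier_mat n n" "I \<subseteq> {..<n}" "card I < n - r"
    and "\<And>i j. i < n \<Longrightarrow> i \<notin> I \<Longrightarrow> j < n \<Longrightarrow> Z $$ (i,j) = P $$ (i,j)"
  shows "det Z = 0"
proof -
  have fin: "finite I" using assms(2) finite_subset by blast
  have "card ({..<n} - I) = n - card I" using assms(2) fin by (simp add: card_Diff_subset)
  then have "Suc r \<le> card ({..<n} - I)" using assms(3) r(2) by simp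
  then have "0 dvd det Z"
    using assms(1,4) minors_above_rank P
    by (intro det_dvd_of_minors[of Z n "{..<n} - I" "Suc r" P id id]) (auto simp: matrix_pencil_def)
  then show ?thesis by simp
qed

lemma det_add_dvd:
  assumes "\<And>x. x \<in> minors (n - r) A \<Longrightarrow> d dvd x"
  shows "d dvd det (A + P)"
proof (rule det_add_induct[of A n])
  fix Z I assume Z: "Z \<in> carrier_mat n n" "I \<subseteq> {..<n}"
    "\<And>i j. i \<in> I \<Longrightarrow> j < n \<Longrightarrow> Z $$ (i,j) = A $$ (i,j)"
    "\<And>i j. i < n \<Longrightarrow> i \<notin> I \<Longrightarrow> j < n \<Longrightarrow> Z $$ (i,j) = P $$ (i,j)"
  show "d dvd det Z"
  proof (cases "card I < n - r")
    case True
    then show ?thesis using mixed_det_zero[OF Z(1,2)] Z(4) by simp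
  next
    case False
    then show ?thesis using Z A assms
      by (intro det_dvd_of_minors[of Z n I "n - r" A id id]) (auto simp: matrix_pencil_def)
  qed
qed (use A P in \<open>auto simp: matrix_pencil_def\<close>)

lemma degree_det_add_le:
  assumes "\<And>x. x \<in> minors (n - r) A \<Longrightarrow> degree x \<le> b"
  shows "degree (det (A + P)) \<le> b + r"
proof (rule det_add_induct[of A n])
  fix Z I assume Z: "Z \<in> carrier_mat n n" "I \<subseteq> {..<n}"
    "\<And>i j. i \<in> I \<Longrightarrow> j < n \<Longrightarrow> Z $$ (i,j) = A $$ (i,j)"
    "\<And>i j. i < n \<Longrightarrow> i \<notin> I \<Longrightarrow> j < n \<Longrightarrow> Z $$ (i,j) = P $$ (i,j)"
  show "degree (det Z) \<le> b + r"
  proof (cases "card I < n - r")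
    case True
    then show ?thesis using mixed_det_zero[OF Z(1,2)] Z(4) by simp
  next
    case False
    have "degree (Z $$ (i,j)) \<le> 1" if "i < n" "j < n" for i j
      using Z(3,4)[of i j] A P that by (cases "i \<in> I") (auto simp: matrix_pencil_def)
    then have "degree (det Z) + (n - r) \<le> b + n" using False Z A assms
      by (intro degree_det_of_minors[of Z n I "n - r" A id id]) (auto simp: matrix_pencil_def)
    then show ?thesis using r(2) by simp
  qed
qed (use A P in \<open>auto simp: matrix_pencil_def intro: degree_add_le\<close>)

end

text \<open>Over the field of fractions the common factor \<open>p\<close> is absorbed into the left
  vectors.\<close>

lemma normal_rank_outer_le:
  fixes P :: "'a::field poly mat"
  assumes P: "P \<in> carrier_mat n n" and E: "finite E"
    and ent: "\<And>i j. i < n \<Longrightarrow> j < n \<Longrightarrow> P $$ (i,j) = smult (\<Sum>e\<in>E. f e i * h e j) p"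
  shows "normal_rank P \<le> card E"
proof -
  interpret t: comm_ring_hom "to_fract :: 'a poly \<Rightarrow> 'a poly fract" by (unfold_locales, auto)
  have "map_mat to_fract P $$ (i,j) = (\<Sum>e\<in>E. to_fract (smult (f e i) p) * to_fract [:h e j:])"
    if ij: "i < n" "j < n" for i j
  proof -
    have "P $$ (i,j) = (\<Sum>e\<in>E. smult (f e i) p * [:h e j:])"
      unfolding ent[OF ij] by (simp add: smult_sum mult.commute)
    then have "to_fract (P $$ (i,j)) = (\<Sum>e\<in>E. to_fract (smult (f e i) p) * to_fract [:h e j:])"
      by (simp only: t.hom_sum t.hom_mult)
    then show ?thesis using ij P by simp
  qed
  then show ?thesis
    using vec_space.rank_le_sum_outer[OF E, of "map_mat to_fract P" n n] P by (simp add: normal_rank_eq)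
qed

text \<open>A regular pencil has normal rank \<open>n\<close>, so outside its spectrum the evaluated
  matrix is nonsingular. At a base point this matrix comes from one over the field itself, and the
  embedding into the closure is injective on determinants.\<close>

lemma base_point_not_in_spectra:
  fixes A :: "'a::field poly mat" and q :: "'a poly"
  assumes A: "regular_pencil n A" and q: "degree q \<le> n"
    and base: "\<not> (base_points :: 'a alg_closure ext_point set) \<subseteq> pencil_spectrum A \<union> poly_spectrum n q"
  shows "det (map_mat (\<lambda>p. coeff p 1) A) \<noteq> 0 \<and> degree q = n \<or>
    (\<exists>z. det (map_mat (\<lambda>p. poly p z) A) \<noteq> 0 \<and> poly q z \<noteq> 0)"
proof -
  interpret ac: inj_comm_ring_hom "to_ac :: 'a \<Rightarrow> 'a alg_closure"
    by (unfold_locales, auto)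
  have Ac: "A \<in> carrier_mat n n" and dA: "det A \<noteq> 0" using A by (auto simp: regular_pencil_def matrix_pencil_def)
  interpret h: inj_comm_ring_hom "to_fract :: 'a poly \<Rightarrow> 'a poly fract" by (unfold_locales, auto)
  have "det (map_mat to_fract A) \<noteq> 0" using dA by simp
  then have nr: "normal_rank A = n"
    using vec_space.det_rank_iff[of "map_mat to_fract A" n] normal_rank_eq[OF Ac] Ac by simp
  have full: "det (N :: 'a mat) \<noteq> 0" if "N \<in> carrier_mat n n" "\<not> mat_rank (map_mat to_ac N) < normal_rank A" for N
  proof -
    have N: "map_mat to_ac N \<in> carrier_mat n n" using that by simp
    then have "vec_space.rank n (map_mat to_ac N) = n"
      using that(2) nr vec_space.rank_le_nc[OF N] by (simp add: mat_rank_def)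
    then have "det (map_mat to_ac N) \<noteq> 0" using vec_space.det_rank_iff[OF N] by blast
    then show ?thesis by simp
  qed
  obtain w where w: "w \<in> (base_points :: 'a alg_closure ext_point set)" "w \<notin> pencil_spectrum A" "w \<notin> poly_spectrum n q"
    using base by blast
  show ?thesis
  proof (cases w)
    case Infty
    have "map_mat (\<lambda>p. to_ac (coeff p 1)) A = map_mat to_ac (map_mat (\<lambda>p. coeff p 1) A)"
      by (rule eq_matI) auto
    then have "\<not> mat_rank (map_mat to_ac (map_mat (\<lambda>p. coeff p 1) A)) < normal_rank A"
      using w(2) Infty by (simp add: pencil_spectrum_def)
    then have "det (map_mat (\<lambda>p. coeff p 1) A) \<noteq> 0" using Ac by (intro full) auto
    moreover have "degree q = n" using w(3) Infty q by (auto simp: poly_spectrum_def split: if_splits)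
    ultimately show ?thesis by blast
  next
    case (Fin y)
    then obtain z where z: "y = to_ac z" using w(1) by (auto simp: base_points_def)
    have "map_mat (\<lambda>p. poly (map_poly to_ac p) y) A = map_mat to_ac (map_mat (\<lambda>p. poly p z) A)"
      by (rule eq_matI) (auto simp: z)
    then have "\<not> mat_rank (map_mat to_ac (map_mat (\<lambda>p. poly p z) A)) < normal_rank A"
      using w(2) Fin by (simp add: pencil_spectrum_def)
    then have "det (map_mat (\<lambda>p. poly p z) A) \<noteq> 0" using Ac by (intro full) auto
    moreover have "poly q z \<noteq> 0" using w(3) Fin z by (auto simp: poly_spectrum_def)
    ultimately show ?thesis by blast
  qed
qed

theorem corollary4p2:
  fixes A :: "'a::field poly mat" and q :: "'a poly" and n r :: nat
  assumes "n \<ge> 2"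
    and "regular_pencil n A"
    and "q \<noteq> 0" and "Polynomial.lead_coeff q = 1" and "Polynomial.degree q \<le> n"
    and "\<not> (base_points :: 'a alg_closure ext_point set) \<subseteq> pencil_spectrum A \<union> poly_spectrum n q"
    and "r \<le> n"
  shows "(\<exists>P. matrix_pencil n n P \<and> normal_rank P = r \<and>
            (\<exists>k. k \<noteq> 0 \<and> det (A + P) = Polynomial.smult k q)) \<longleftrightarrow>
         (\<Prod>i=1..n - r. invariant_factor A i) dvd q \<and>
         (\<Sum>i=1..n - r. mult_infinity A i) \<le> n - Polynomial.degree q"
proof -
  let ?k = "n - r"
  have A: "matrix_pencil n n A" and Ac: "A \<in> carrier_mat n n"
    using assms(2) by (auto simp: regular_pencil_def matrix_pencil_def)
  have k: "?k \<le> n" "?k + r = n" using assms(7) by auto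
  note gcd = regular_det_divisor(1)[OF assms(2) k(1)]
  obtain x0 where x0: "x0 \<in> minors ?k A" "x0 \<noteq> 0" "degree x0 = max_minor_degree A ?k"
    using regular_minor_nonzero[OF assms(2) k(1)] max_minor_degree_attained by metis
  have bk: "max_minor_degree A ?k \<le> ?k" using degree_minor_le[OF A x0(1)] x0(3) by simp
  \<comment> \<open>\<open>bk\<close> makes \<open>?k - max_minor_degree A ?k\<close> a true
    difference, so that the inequality can be solved for \<open>degree q\<close>.\<close>
  have rhs: "(\<Prod>i=1..?k. invariant_factor A i) dvd q \<and> (\<Sum>i=1..?k. mult_infinity A i) \<le> n - degree q \<longleftrightarrow>
      det_divisor A ?k dvd q \<and> degree q \<le> max_minor_degree A ?k + r"
    using prod_invariant_factor[OF assms(2) k(1)] sum_mult_infinity[OF assms(2) k(1)] assms(5,7) bk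
    by (auto simp: min_pow_t_def)
  show ?thesis
    unfolding rhs
  proof
    assume "\<exists>P. matrix_pencil n n P \<and> normal_rank P = r \<and> (\<exists>k. k \<noteq> 0 \<and> det (A + P) = smult k q)"
    then obtain P c where P: "matrix_pencil n n P" "normal_rank P \<le> r" and c: "c \<noteq> 0" "det (A + P) = smult c q"
      by auto
    have "det_divisor A ?k dvd det (A + P)"
      using gcd by (intro det_add_dvd[OF A P assms(7)]) (simp add: is_gcd_of_def)
    moreover have "degree (det (A + P)) \<le> max_minor_degree A ?k + r"
      by (rule degree_det_add_le[OF A P assms(7) degree_le_max_minor_degree])
    ultimately show "det_divisor A ?k dvd q \<and> degree q \<le> max_minor_degree A ?k + r"
      using c by (simp add: dvd_smult_iff)
  next
    assume D: "det_divisor A ?k dvd q \<and> degree q \<le> max_minor_degree A ?k + r"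
    have dvd_q: "d dvd q" if "\<And>x. x \<in> minors ?k A \<Longrightarrow> d dvd x" for d
      using that gcd D by (meson dvd_trans is_gcd_of_def)
    \<comment> \<open>Both kinds of base point give a constant matrix of rank at most
      \<open>r\<close> times one polynomial \<open>p\<close>, which is \<open>1\<close> at infinity
      and \<open>s - z\<close> at a finite point.\<close>
    have "\<exists>E f h c p. finite (E :: nat set) \<and> card E \<le> r \<and> c \<noteq> 0 \<and> degree p \<le> 1 \<and>
        det (A + mat n n (\<lambda>(i,j). smult (\<Sum>e\<in>E. f e i * h e j) p)) = smult c q"
      using base_point_not_in_spectra[OF assms(2,5,6)]
    proof (elim disjE conjE exE)
      assume "det (map_mat (\<lambda>p. coeff p 1) A) \<noteq> 0" "degree q = n"
      from perturb_leading_regular[OF A this assms(3) k(2) dvd_q] obtain E f h c where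
        *: "finite (E :: nat set)" "card E \<le> r" "c \<noteq> 0"
          "det (A + mat n n (\<lambda>(i,j). [:\<Sum>e\<in>E. f e i * h e j:])) = smult c q" by blast
      then have "det (A + mat n n (\<lambda>(i,j). smult (\<Sum>e\<in>E. f e i * h e j) 1)) = smult c q"
        by simp
      moreover have "degree (1 :: 'a poly) \<le> 1" by simp
      ultimately show ?thesis using *(1-3) by blast
    next
      fix z assume z: "det (map_mat (\<lambda>p. poly p z) A) \<noteq> 0" "poly q z \<noteq> 0"
      have "degree q \<le> r + degree x0" using D x0(3) by simp
      from perturb_at_point[OF A z(1) assms(5) z(2) k(2) dvd_q x0(1,2) this]
      obtain E f h c where *: "finite (E :: nat set)" "card E \<le> r" "c \<noteq> 0"
          "det (A + mat n n (\<lambda>(i,j). smult (\<Sum>e\<in>E. f e i * h e j) [:-z, 1:])) = smult c q" by blast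
      moreover have "degree [:-z, 1:] \<le> 1" by simp
      ultimately show ?thesis by blast
    qed
    then obtain E f h c p where E: "finite (E :: nat set)" "card E \<le> r" and c: "c \<noteq> 0" and p: "degree p \<le> 1"
      and det: "det (A + mat n n (\<lambda>(i,j). smult (\<Sum>e\<in>E. f e i * h e j) p)) = smult c q" by blast
    let ?P = "mat n n (\<lambda>(i,j). smult (\<Sum>e\<in>E. f e i * h e j) p)"
    have B: "matrix_pencil n n (A + ?P)"
      using A p unfolding matrix_pencil_def
      by (auto intro!: degree_add_le order_trans[OF degree_smult_le] simp del: One_nat_def)
    have BA: "A + ?P - A = ?P" using Ac by (intro eq_matI) auto
    have "normal_rank ?P \<le> r"
      using normal_rank_outer_le[OF _ E(1), of ?P n f h p] E(2) by simp
    \<comment> \<open>Raising the rank requires a nonzero determinant, which holds because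
      \<open>c\<close> and \<open>q\<close> are nonzero.\<close>
    then obtain B' where B': "matrix_pencil n n B'" "det B' = smult c q" "normal_rank (B' - A) = r"
      using attain_normal_rank[OF assms(1) A B _ _ assms(7)] det c assms(3) BA by auto
    have "matrix_pencil n n (B' - A)"
      using B'(1) A unfolding matrix_pencil_def by (auto intro!: degree_diff_le simp del: One_nat_def)
    moreover have "A + (B' - A) = B'"
      using Ac B'(1) by (intro eq_matI) (auto simp: matrix_pencil_def)
    then have "det (A + (B' - A)) = smult c q" using B'(2) by simp
    ultimately show "\<exists>P. matrix_pencil n n P \<and> normal_rank P = r \<and> (\<exists>k. k \<noteq> 0 \<and> det (A + P) = smult k q)"
      using B'(3) c by blast
  qed
qed

end
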